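(* Let $X,\overline{X},U_1,U_2$ be Banach spaces, let $A$ generate a $C_0$-semigroup $(T(t))_{t\ge 0}$ on $X$, let $B_1\in L(\overline{X},X_{-1})$ and $B_2\in L(U_2,X_{-1})$, and let $F:X\times U_1\to\overline{X}$ satisfy the standing assumptions (F1)–(F3) listed in the context. Consider the bilinear system $\Sigma(A,[B_1,B_2],F)$: $$\dot x(t)=Ax(t)+B_1F(x(t),u_1(t))+B_2u_2(t),\quad t\ge 0,\qquad x(0)=x_0 .$$ (a) If the linear systems $\Sigma(A,[0,B_1])$ (that is, $\dot x=Ax+B_1v$ with $\overline{X}$-valued input $v$) and $\Sigma(A,[0,B_2])$ (that is, $\dot x=Ax+B_2u_2$ with $U_2$-valued input $u_2$) are integral ISS, then the bilinear system $\Sigma(A,[B_1,B_2],F)$ is integral ISS and (integral ISS, ISS). (b) The assumption that $\Sigma(A,[0,B_2])$ is integral ISS is necessary: if $\Sigma(A,[B_1,B_2],F)$ is integral ISS, then $\Sigma(A,[0,B_2])$ is integral ISS.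
   Context: Spaces. For a generator $A$ of a $C_0$-semigroup $(T(t))_{t\ge0}$ on $X$, $X_{-1}$ is the completion of $X$ with respect to $\|x\|_{X_{-1}}=\|(\beta-A)^{-1}x\|_X$ for some $\beta\in\rho(A)$. The semigroup extends uniquely to a $C_0$-semigroup $(T_{-1}(t))_{t\ge0}$ on $X_{-1}$. $L(Y,Z)$ denotes the bounded linear operators from $Y$ to $Z$. Standing assumptions on $F:X\times U_1\to\overline{X}$: (F1) there is $m>0$ with $\|F(x,u)\|_{\overline{X}}\le m\|x\|_X\|u\|_{U_1}$ for all $x\in X$, $u\in U_1$; (F2) for every bounded $X_b\subset X$ there is $L_{X_b}>0$ with $\|F(x,u)-F(\tilde x,u)\|_{\overline{X}}\le L_{X_b}\|u\|_{U_1}\|x-\tilde x\|_X$ for all $x,\tilde x\in X_b$, $u\in U_1$; (F3) $s\mapsto F(f(s),g(s))$ is measurable for every interval $I$ and all measurable $f:I\to X$, $g:I\to U_1$. Mild solutions. For $0\le t_0<t_1$, $x_0\in X$ and locally integrable inputs $u_1,u_2$ with values in $U_1$, $U_2$, a continuous $x:[t_0,t_1]\to X$ is a mild solution on $[t_0,t_1]$ if for all $t\in[t_0,t_1]$ $$x(t)=T(t-t_0)x_0+\int_{t_0}^tT_{-1}(t-s)\big[B_1F(x(s),u_1(s))+B_2u_2(s)\big]\,\mathrm ds .$$ $x:[0,\infty)\to X$ is a global mild solution if its restriction to $[0,t_1]$ is a mild solution on $[0,t_1]$ for every $t_1>0$. For a linear system $\Sigma(A,[0,B])$, $B\in L(U,X_{-1})$,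 $U$ a Banach space, with input $u$, the integrand is $T_{-1}(t-s)Bu(s)$. Comparison functions. With $\mathbb R_0^+=[0,\infty)$: $\mathcal K$ is the set of continuous strictly increasing $\mu:\mathbb R_0^+\to\mathbb R_0^+$ with $\mu(0)=0$; $\mathcal K_\infty$ is the set of unbounded functions in $\mathcal K$; $\mathcal L$ is the set of continuous strictly decreasing $\gamma:\mathbb R_0^+\to\mathbb R_0^+$ with $\lim_{t\to\infty}\gamma(t)=0$; $\mathcal{KL}$ is the set of $\beta:(\mathbb R_0^+)^2\to\mathbb R_0^+$ with $\beta(\cdot,t)\in\mathcal K$ for all $t\ge0$ and $\beta(s,\cdot)\in\mathcal L$ for all $s>0$. Stability notions. - $\Sigma(A,[B_1,B_2],F)$ is integral ISS if there are $\beta\in\mathcal{KL}$, $\theta_1,\theta_2\in\mathcal K_\infty$, $\mu_1,\mu_2\in\mathcal K$ such that for all $x_0\in X$, $u_1\in L^\infty(0,\infty;U_1)$, $u_2\in L^\infty(0,\infty;U_2)$ there is a unique global mild solution $x$ and, for all $t\ge0$, $$\|x(t)\|\le\beta(\|x_0\|,t)+\theta_1\Big(\int_0^t\mu_1(\|u_1(s)\|)\,\mathrm ds\Big)+\theta_2\Big(\int_0^t\mu_2(\|u_2(s)\|)\,\mathrm ds\Big).$$ - It is (integral ISS, ISS) if there are $\beta\in\mathcal{KL}$, $\theta_1,\mu_2\in\mathcal K_\infty$, $\mu_1\in\mathcal K$ such that for all such $x_0,u_1,u_2$ there is a unique global mild solution $x$ and, for all $t\ge0$, $$\|x(t)\|\le\beta(\|x_0\|,t)+\theta_1\Big(\int_0^t\mu_1(\|u_1(s)\|)\,\mathrm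 ds\Big)+\mu_2\big(\|u_2\|_{L^\infty(0,t;U_2)}\big).$$ - A linear system $\Sigma(A,[0,B])$ with input $u$ in a Banach space $U$ is integral ISS if there are $\beta\in\mathcal{KL}$, $\theta\in\mathcal K_\infty$, $\mu\in\mathcal K$ such that for all $x_0\in X$ and $u\in L^\infty(0,\infty;U)$ there is a unique global mild solution $x$ and $\|x(t)\|\le\beta(\|x_0\|,t)+\theta\big(\int_0^t\mu(\|u(s)\|)\,\mathrm ds\big)$ for all $t\ge0$. *)

theory Defs
  imports "HOL-Analysis.Analysis" "HOL-Probability.Essential_Supremum"
begin

section \<open>Semigroups, generators and resolvents\<close>

text \<open>Semigroups are indexed by all reals, but only the values at \<open>t \<ge> 0\<close> are ever used.\<close>

definition C0_semigroup :: "(real \<Rightarrow> 'x::banach \<Rightarrow>\<^sub>L 'x) \<Rightarrow> bool" where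
  "C0_semigroup T \<longleftrightarrow>
     T 0 = id_blinfun \<and>
     (\<forall>s\<ge>0. \<forall>t\<ge>0. T (s + t) = T s o\<^sub>L T t) \<and>
     (\<forall>x. ((\<lambda>t. T t x) \<longlongrightarrow> x) (at_right 0))"

text \<open>An unbounded operator is a domain \<open>D\<close> together with a total function \<open>A\<close>
  whose values outside \<open>D\<close> are irrelevant.\<close>

definition generates_C0_semigroup ::
  "'x::banach set \<Rightarrow> ('x \<Rightarrow> 'x) \<Rightarrow> (real \<Rightarrow> 'x \<Rightarrow>\<^sub>L 'x) \<Rightarrow> bool" where
  "generates_C0_semigroup D A T \<longleftrightarrow>
     C0_semigroup T \<and>
     D = {x. \<exists>y. ((\<lambda>t. (1 / t) *\<^sub>R (T t x - x)) \<longlongrightarrow> y) (at_right 0)} \<and>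
     (\<forall>x\<in>D. ((\<lambda>t. (1 / t) *\<^sub>R (T t x - x)) \<longlongrightarrow> A x) (at_right 0))"

definition resolvent :: "'x::banach set \<Rightarrow> ('x \<Rightarrow> 'x) \<Rightarrow> real \<Rightarrow> 'x \<Rightarrow> 'x" where
  "resolvent D A \<beta> = inv_into D (\<lambda>x. \<beta> *\<^sub>R x - A x)"

definition resolvent_set :: "'x::banach set \<Rightarrow> ('x \<Rightarrow> 'x) \<Rightarrow> real set" where
  "resolvent_set D A =
     {\<beta>. bij_betw (\<lambda>x. \<beta> *\<^sub>R x - A x) D UNIV \<and> bounded_linear (resolvent D A \<beta>)}"


section \<open>The extrapolation space\<close>

text \<open>The type \<open>'m\<close> (complete, by its class) with the embedding \<open>J\<close> is a completion of \<open>'x\<close>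
  for the norm \<open>\<lambda>x. norm (resolvent D A \<beta> x)\<close>. Completions are unique up to isometric
  isomorphism only, so the pair \<open>('m, J)\<close> is kept as a parameter. For a generator such a pair always
  exists, for instance \<open>'m = 'x\<close> and \<open>J = resolvent D A \<beta>\<close>, whose range \<open>D\<close> is dense.\<close>

definition extrapolation_space ::
  "'x::banach set \<Rightarrow> ('x \<Rightarrow> 'x) \<Rightarrow> real \<Rightarrow> ('x \<Rightarrow> 'm::banach) \<Rightarrow> bool" where
  "extrapolation_space D A \<beta> J \<longleftrightarrow>
     \<beta> \<in> resolvent_set D A \<and>
     linear J \<and>
     (\<forall>x. norm (J x) = norm (resolvent D A \<beta> x)) \<and>
     closure (range J) = UNIV"

text \<open>The extension of \<open>T t\<close> along \<open>J\<close>. For \<open>t \<ge> 0\<close> it exists because \<open>T t\<close> commutes with the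
  resolvent, and it is unique because \<open>range J\<close> is dense.\<close>

definition extrapolated_semigroup ::
  "('x::banach \<Rightarrow> 'm::banach) \<Rightarrow> (real \<Rightarrow> 'x \<Rightarrow>\<^sub>L 'x) \<Rightarrow> real \<Rightarrow> 'm \<Rightarrow>\<^sub>L 'm" where
  "extrapolated_semigroup J T t = (THE S. \<forall>x. blinfun_apply S (J x) = J (T t x))"


section \<open>Bochner measurability and integration in arbitrary Banach spaces\<close>

text \<open>The library's \<open>has_bochner_integral\<close> is restricted to second countable (separable) spaces.
  The version below repeats its definition without that restriction; Borel measurability, which
  is too weak in nonseparable spaces, is replaced by strong measurability.\<close>

definition strongly_measurable :: "'a measure \<Rightarrow> ('a \<Rightarrow> 'b::real_normed_vector) \<Rightarrow> bool" where
  "strongly_measurable M f \<longleftrightarrow>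
     (\<exists>s. (\<forall>i::nat. simple_function M (s i)) \<and> (AE x in M. (\<lambda>i. s i x) \<longlonglongrightarrow> f x))"

definition bochner_has_integral ::
  "'a measure \<Rightarrow> ('a \<Rightarrow> 'b::real_normed_vector) \<Rightarrow> 'b \<Rightarrow> bool" where
  "bochner_has_integral M f v \<longleftrightarrow>
     strongly_measurable M f \<and>
     (\<exists>s. (\<forall>i::nat. Bochner_Integration.simple_bochner_integrable M (s i)) \<and>
          (\<lambda>i. \<integral>\<^sup>+x. norm (f x - s i x) \<partial>M) \<longlonglongrightarrow> 0 \<and>
          (\<lambda>i. Bochner_Integration.simple_bochner_integral M (s i)) \<longlonglongrightarrow> v)"

text \<open>The essential supremum is taken in the extended reals. Over a null set, such as
  \<open>{0..0}\<close>, it is \<open>-\<infinity>\<close>, which \<open>real_of_ereal\<close> turns into the intended value \<open>0\<close>.\<close>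

definition Linf_norm :: "real set \<Rightarrow> (real \<Rightarrow> 'u::real_normed_vector) \<Rightarrow> real" where
  "Linf_norm I u = real_of_ereal (esssup (lebesgue_on I) (\<lambda>s. ereal (norm (u s))))"

definition Linf :: "real set \<Rightarrow> (real \<Rightarrow> 'u::real_normed_vector) set" where
  "Linf I = {u. strongly_measurable (lebesgue_on I) u \<and>
                esssup (lebesgue_on I) (\<lambda>s. ereal (norm (u s))) < \<infinity>}"


section \<open>Mild solutions\<close>

text \<open>\<open>x\<close> solves \<open>x' = A x + h\<close> mildly on \<open>[t0, t1]\<close>. The inhomogeneity \<open>h\<close> takes values in the
  extrapolation space and may itself be built from \<open>x\<close>; the equation holds in the
  extrapolation space, hence the embedding \<open>J\<close>.\<close>

definition mild_solution_inhom ::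
  "('x::banach \<Rightarrow> 'm::banach) \<Rightarrow> (real \<Rightarrow> 'x \<Rightarrow>\<^sub>L 'x) \<Rightarrow> 'x \<Rightarrow> (real \<Rightarrow> 'm) \<Rightarrow>
     real \<Rightarrow> real \<Rightarrow> (real \<Rightarrow> 'x) \<Rightarrow> bool" where
  "mild_solution_inhom J T x0 h t0 t1 x \<longleftrightarrow>
     continuous_on {t0..t1} x \<and>
     (\<forall>t\<in>{t0..t1}. \<exists>v.
        bochner_has_integral (lebesgue_on {t0..t}) (\<lambda>s. extrapolated_semigroup J T (t - s) (h s)) v \<and>
        J (x t) = J (T (t - t0) x0) + v)"

definition bilinear_mild_solution ::
  "('x::banach \<Rightarrow> 'm::banach) \<Rightarrow> (real \<Rightarrow> 'x \<Rightarrow>\<^sub>L 'x) \<Rightarrow>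
     ('xb::banach \<Rightarrow>\<^sub>L 'm) \<Rightarrow> ('u2::banach \<Rightarrow>\<^sub>L 'm) \<Rightarrow> ('x \<Rightarrow> 'u1::banach \<Rightarrow> 'xb) \<Rightarrow>
     'x \<Rightarrow> (real \<Rightarrow> 'u1) \<Rightarrow> (real \<Rightarrow> 'u2) \<Rightarrow> real \<Rightarrow> real \<Rightarrow> (real \<Rightarrow> 'x) \<Rightarrow> bool" where
  "bilinear_mild_solution J T B1 B2 F x0 u1 u2 t0 t1 x \<longleftrightarrow>
     mild_solution_inhom J T x0 (\<lambda>s. B1 (F (x s) (u1 s)) + B2 (u2 s)) t0 t1 x"

definition linear_mild_solution ::
  "('x::banach \<Rightarrow> 'm::banach) \<Rightarrow> (real \<Rightarrow> 'x \<Rightarrow>\<^sub>L 'x) \<Rightarrow> ('u::banach \<Rightarrow>\<^sub>L 'm) \<Rightarrow>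
     'x \<Rightarrow> (real \<Rightarrow> 'u) \<Rightarrow> real \<Rightarrow> real \<Rightarrow> (real \<Rightarrow> 'x) \<Rightarrow> bool" where
  "linear_mild_solution J T B x0 u t0 t1 x \<longleftrightarrow>
     mild_solution_inhom J T x0 (\<lambda>s. B (u s)) t0 t1 x"

text \<open>Trajectories on \<open>[0, \<infinity>)\<close> are functions on all reals, so uniqueness means agreement on
  \<open>[0, \<infinity>)\<close>. The argument \<open>sol t0 t1\<close> is the predicate of being a mild solution on \<open>[t0, t1]\<close>.\<close>

definition unique_global_mild_solution ::
  "(real \<Rightarrow> real \<Rightarrow> (real \<Rightarrow> 'x) \<Rightarrow> bool) \<Rightarrow> (real \<Rightarrow> 'x) \<Rightarrow> bool" where
  "unique_global_mild_solution sol x \<longleftrightarrow>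
     (\<forall>t1>0. sol 0 t1 x) \<and>
     (\<forall>y. (\<forall>t1>0. sol 0 t1 y) \<longrightarrow> (\<forall>t\<ge>0. y t = x t))"


section \<open>Comparison functions\<close>

definition class_K :: "(real \<Rightarrow> real) set" where
  "class_K = {\<mu>. \<mu> \<in> {0..} \<rightarrow> {0..} \<and> continuous_on {0..} \<mu> \<and> strict_mono_on {0..} \<mu> \<and> \<mu> 0 = 0}"

definition class_K_inf :: "(real \<Rightarrow> real) set" where
  "class_K_inf = {\<mu> \<in> class_K. \<not> bounded (\<mu> ` {0..})}"

definition class_L :: "(real \<Rightarrow> real) set" where
  "class_L = {\<gamma>. \<gamma> \<in> {0..} \<rightarrow> {0..} \<and> continuous_on {0..} \<gamma> \<and> strict_antimono_on {0..} \<gamma> \<and>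
                 (\<gamma> \<longlongrightarrow> 0) at_top}"

definition class_KL :: "(real \<Rightarrow> real \<Rightarrow> real) set" where
  "class_KL = {\<beta>. (\<forall>t\<ge>0. (\<lambda>s. \<beta> s t) \<in> class_K) \<and> (\<forall>s>0. (\<lambda>t. \<beta> s t) \<in> class_L)}"


section \<open>Stability notions\<close>

definition bilinear_integral_ISS ::
  "('x::banach \<Rightarrow> 'm::banach) \<Rightarrow> (real \<Rightarrow> 'x \<Rightarrow>\<^sub>L 'x) \<Rightarrow>
     ('xb::banach \<Rightarrow>\<^sub>L 'm) \<Rightarrow> ('u2::banach \<Rightarrow>\<^sub>L 'm) \<Rightarrow> ('x \<Rightarrow> 'u1::banach \<Rightarrow> 'xb) \<Rightarrow> bool" where
  "bilinear_integral_ISS J T B1 B2 F \<longleftrightarrow>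
     (\<exists>\<beta>\<in>class_KL. \<exists>\<theta>1\<in>class_K_inf. \<exists>\<theta>2\<in>class_K_inf. \<exists>\<mu>1\<in>class_K. \<exists>\<mu>2\<in>class_K.
        \<forall>x0. \<forall>u1\<in>Linf {0..}. \<forall>u2\<in>Linf {0..}.
          \<exists>x. unique_global_mild_solution (bilinear_mild_solution J T B1 B2 F x0 u1 u2) x \<and>
              (\<forall>t\<ge>0. norm (x t) \<le> \<beta> (norm x0) t
                 + \<theta>1 (\<integral>s. \<mu>1 (norm (u1 s)) \<partial>lebesgue_on {0..t})
                 + \<theta>2 (\<integral>s. \<mu>2 (norm (u2 s)) \<partial>lebesgue_on {0..t})))"

definition bilinear_integral_ISS_ISS ::
  "('x::banach \<Rightarrow> 'm::banach) \<Rightarrow> (real \<Rightarrow> 'x \<Rightarrow>\<^sub>L 'x) \<Rightarrow>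
     ('xb::banach \<Rightarrow>\<^sub>L 'm) \<Rightarrow> ('u2::banach \<Rightarrow>\<^sub>L 'm) \<Rightarrow> ('x \<Rightarrow> 'u1::banach \<Rightarrow> 'xb) \<Rightarrow> bool" where
  "bilinear_integral_ISS_ISS J T B1 B2 F \<longleftrightarrow>
     (\<exists>\<beta>\<in>class_KL. \<exists>\<theta>1\<in>class_K_inf. \<exists>\<mu>2\<in>class_K_inf. \<exists>\<mu>1\<in>class_K.
        \<forall>x0. \<forall>u1\<in>Linf {0..}. \<forall>u2\<in>Linf {0..}.
          \<exists>x. unique_global_mild_solution (bilinear_mild_solution J T B1 B2 F x0 u1 u2) x \<and>
              (\<forall>t\<ge>0. norm (x t) \<le> \<beta> (norm x0) t
                 + \<theta>1 (\<integral>s. \<mu>1 (norm (u1 s)) \<partial>lebesgue_on {0..t})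
                 + \<mu>2 (Linf_norm {0..t} u2)))"

definition linear_integral_ISS ::
  "('x::banach \<Rightarrow> 'm::banach) \<Rightarrow> (real \<Rightarrow> 'x \<Rightarrow>\<^sub>L 'x) \<Rightarrow> ('u::banach \<Rightarrow>\<^sub>L 'm) \<Rightarrow> bool" where
  "linear_integral_ISS J T B \<longleftrightarrow>
     (\<exists>\<beta>\<in>class_KL. \<exists>\<theta>\<in>class_K_inf. \<exists>\<mu>\<in>class_K.
        \<forall>x0. \<forall>u\<in>Linf {0..}.
          \<exists>x. unique_global_mild_solution (linear_mild_solution J T B x0 u) x \<and>
              (\<forall>t\<ge>0. norm (x t) \<le> \<beta> (norm x0) t
                 + \<theta> (\<integral>s. \<mu> (norm (u s)) \<partial>lebesgue_on {0..t})))"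

end

theory Submission
  imports Defs
begin

text \<open>
  Integral ISS of a linear system gives a linear input map \<open>\<Phi>\<close> with
  \<open>\<parallel>\<Phi> v t\<parallel> \<le> \<theta> (\<integral> \<mu> \<parallel>v\<parallel>)\<close>. By linearity the estimate can be rescaled to
  \<open>\<parallel>\<Phi> v t\<parallel> \<le> k \<theta> (\<integral> \<mu> (\<parallel>v\<parallel> / k))\<close> for every \<open>k > 0\<close>. Taking \<open>v = F(x, u\<^sub>1)\<close> and
  \<open>k = sup \<parallel>x\<parallel>\<close> turns the nonlinear estimate into one that is linear in the state: on an interval
  where \<open>\<integral> \<mu>\<^sub>1 (m \<parallel>u\<^sub>1\<parallel>)\<close> is small the state at most grows by a constant factor, and a general
  interval is cut into at most \<open>1 + \<integral> \<mu>\<^sub>1 (m \<parallel>u\<^sub>1\<parallel>) / \<delta>\<close> such pieces, which yields a factor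
  \<open>exp (\<kappa> \<integral> \<mu>\<^sub>1 (m \<parallel>u\<^sub>1\<parallel>))\<close>. Over a time span \<open>\<tau>\<close> with \<open>\<parallel>T \<tau>\<parallel> \<le> 1/4\<close> and small input the state is
  halved, so the solution decays up to that exponential factor, and Young's inequality separates
  the product into a sum. The same rescaling, applied to differences, makes the fixed point map a
  contraction on short intervals whose length depends only on the a priori bound and on the
  essential bound of \<open>u\<^sub>1\<close>.
\<close>

section \<open>Strong measurability and the Bochner integral\<close>

text \<open>The obstacle is that \<open>\<theta>\<close> and \<open>\<mu>\<close> are arbitrary
  comparison functions: the hypothesis gives no bound on the input map that is linear in an integral
  norm, so Gronwall's inequality does not apply directly. What is additive is the integral of
  \<open>\<mu>1 (m * norm (u1 s))\<close>, hence the number of pieces, and this produces the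
  exponential. The constants of the semigroup come from the same hypothesis with zero input: it
  bounds \<open>norm (T t x)\<close> by \<open>\<beta>' (norm x) t\<close>, and by homogeneity the
  operator norm by \<open>\<beta>' 1 t\<close>, which tends to 0; \<open>\<tau>\<close> is a time at
  which it is below 1/4. Integral ISS also places the convolution integral, formed in the
  extrapolation space, inside X, continuously in time; after that all estimates live in X. The
  second input enters through one constant \<open>G\<close> that bounds its effect on every window
  of length at most \<open>\<tau>\<close>. It may be the effect over all of \<open>{0..t}\<close>
  or, since the windows are short, a function of the essential supremum; so one estimate serves both
  stability notions. For (b), \<open>u1 = 0\<close> turns the bilinear equation into the linear
  one.\<close>

lemma complete_measure_restrict_space:
  assumes "complete_measure M" "A \<in> sets M"
  shows "complete_measure (restrict_space M A)"
proof
  fix B C assume "B \<subseteq> C" "C \<in> null_sets (restrict_space M A)"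
  then have "C \<in> null_sets M" "B \<subseteq> A" using assms(2)
    by (auto simp: null_sets_restrict_space)
  then have "B \<in> sets M" using \<open>B \<subseteq> C\<close> assms(1) by (metis complete_measure.complete)
  then show "B \<in> sets (restrict_space M A)"
    using \<open>B \<subseteq> A\<close> assms(2) by (subst sets_restrict_space_iff) (auto dest: sets.sets_into_space)
qed

lemma complete_lebesgue_on: "A \<in> sets lebesgue \<Longrightarrow> complete_measure (lebesgue_on A)"
  by (intro complete_measure_restrict_space completion.complete_measure_axioms)

lemma (in complete_measure) borel_measurable_AE_eq:
  fixes f g :: "'a \<Rightarrow> 'b::topological_space"
  assumes f: "f \<in> borel_measurable M" and ae: "AE x in M. f x = g x"
  shows "g \<in> borel_measurable M"
proof (rule measurableI)
  fix A :: "'b set" assume A: "A \<in> sets borel"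
  have 1: "f -` A \<inter> space M \<in> sets M" using f A by (rule measurable_sets)
  show "g -` A \<inter> space M \<in> sets M"
    by (rule in_sets_AE[OF _ 1]) (use ae in eventually_elim, auto)
qed simp

text \<open>The simple functions converge only almost everywhere, so the limit of their norms agrees
  with the norm of \<open>f\<close> up to a null set, which completeness of the measure
  absorbs.\<close>

lemma strongly_measurable_norm:
  assumes "complete_measure M" "strongly_measurable M f"
  shows "(\<lambda>x. norm (f x)) \<in> borel_measurable M"
proof -
  obtain s where s: "\<And>i::nat. simple_function M (s i)" and l: "AE x in M. (\<lambda>i. s i x) \<longlonglongrightarrow> f x"
    using assms(2) by (auto simp: strongly_measurable_def)
  have m: "(\<lambda>x. norm (s i x)) \<in> borel_measurable M" for i
    using simple_function_compose1[OF s, of norm] by (rule borel_measurable_simple_function)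
  have 1: "(\<lambda>x. lim (\<lambda>i. norm (s i x))) \<in> borel_measurable M"
    by (rule borel_measurable_lim_metric) (rule m)
  show ?thesis
  proof (rule complete_measure.borel_measurable_AE_eq[OF assms(1) 1])
    show "AE x in M. lim (\<lambda>i. norm (s i x)) = norm (f x)"
      using l by eventually_elim (auto intro: limI tendsto_norm)
  qed
qed

lemma strongly_measurable_simple: "simple_function M f \<Longrightarrow> strongly_measurable M f"
  unfolding strongly_measurable_def by (intro exI[of _ "\<lambda>_. f"]) auto

text \<open>Pairs of simple functions are simple and continuity passes to the pointwise limit, so
  the argument is valid in nonseparable spaces.\<close>

lemma strongly_measurable_compose2:
  assumes "strongly_measurable M f" "strongly_measurable M g"
    "continuous_on UNIV (\<lambda>p. h (fst p) (snd p))"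
  shows "strongly_measurable M (\<lambda>x. h (f x) (g x))"
proof -
  obtain s s' where s: "\<And>i::nat. simple_function M (s i)" "AE x in M. (\<lambda>i. s i x) \<longlonglongrightarrow> f x"
    and s': "\<And>i::nat. simple_function M (s' i)" "AE x in M. (\<lambda>i. s' i x) \<longlonglongrightarrow> g x"
    using assms by (auto simp: strongly_measurable_def)
  show ?thesis unfolding strongly_measurable_def
  proof (intro exI[of _ "\<lambda>i x. h (s i x) (s' i x)"] conjI allI)
    show "simple_function M (\<lambda>x. h (s i x) (s' i x))" for i
      using s(1) s'(1) by (rule simple_function_compose2)
    show "AE x in M. (\<lambda>i. h (s i x) (s' i x)) \<longlonglongrightarrow> h (f x) (g x)"
      using s(2) s'(2)
    proof eventually_elim
      case (elim x)
      have "isCont (\<lambda>p. h (fst p) (snd p)) (f x, g x)"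
        using assms(3) by (simp add: continuous_on_eq_continuous_at)
      from isCont_tendsto_compose[OF this tendsto_Pair[OF elim]] show ?case by simp
    qed
  qed
qed

lemma strongly_measurable_compose1:
  assumes "strongly_measurable M f" "continuous_on UNIV h"
  shows "strongly_measurable M (\<lambda>x. h (f x))"
  using strongly_measurable_compose2[OF assms(1) assms(1), of "\<lambda>x y. h x"] assms(2)
  by (simp add: continuous_on_compose2[OF assms(2)] continuous_on_fst)

lemma strongly_measurable_add:
  "strongly_measurable M f \<Longrightarrow> strongly_measurable M g \<Longrightarrow> strongly_measurable M (\<lambda>x. f x + g x)"
  by (erule (1) strongly_measurable_compose2) (intro continuous_intros)

lemma strongly_measurable_diff:
  "strongly_measurable M f \<Longrightarrow> strongly_measurable M g \<Longrightarrow> strongly_measurable M (\<lambda>x. f x - g x)"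
  by (erule (1) strongly_measurable_compose2) (intro continuous_intros)

lemma strongly_measurable_cong:
  "(\<And>x. x \<in> space M \<Longrightarrow> f x = g x) \<Longrightarrow> strongly_measurable M f = strongly_measurable M g"
  unfolding strongly_measurable_def by (intro arg_cong[of _ _ Ex] ext conj_cong refl AE_cong) simp

lemma strongly_measurable_indicator:
  assumes "strongly_measurable M f" "A \<in> sets M"
  shows "strongly_measurable M (\<lambda>x. indicator A x *\<^sub>R f x)"
  using assms by (intro strongly_measurable_compose2[OF strongly_measurable_simple, where h="(*\<^sub>R)"])
    (auto intro!: continuous_intros)

text \<open>Moves functions on different intervals to one common measure, where cutting off and
  restarting an input become multiplications by indicators.\<close>

lemma strongly_measurable_restrict_space:
  assumes A: "A \<in> sets M"
  shows "strongly_measurable (restrict_space M A) f \<longleftrightarrow> strongly_measurable M (\<lambda>x. indicator A x *\<^sub>R f x)"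
proof -
  have A': "A \<inter> space M \<in> sets M" using A by auto
  show ?thesis
  proof
    assume "strongly_measurable (restrict_space M A) f"
    then obtain s where s: "\<And>i::nat. simple_function (restrict_space M A) (s i)"
      "AE x in restrict_space M A. (\<lambda>i. s i x) \<longlonglongrightarrow> f x"
      by (auto simp: strongly_measurable_def)
    show "strongly_measurable M (\<lambda>x. indicator A x *\<^sub>R f x)"
      unfolding strongly_measurable_def
    proof (intro exI[of _ "\<lambda>i x. indicator A x *\<^sub>R s i x"] conjI allI)
      show "simple_function M (\<lambda>x. indicator A x *\<^sub>R s i x)" for i
        using s(1) simple_function_restrict_space[OF A'] by blast
      show "AE x in M. (\<lambda>i. indicator A x *\<^sub>R s i x) \<longlonglongrightarrow> indicator A x *\<^sub>R f x"
        using s(2) unfolding AE_restrict_space_iff[OF A']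
        by eventually_elim (auto simp: indicator_def)
    qed
  next
    assume "strongly_measurable M (\<lambda>x. indicator A x *\<^sub>R f x)"
    then obtain s where s: "\<And>i::nat. simple_function M (s i)"
      "AE x in M. (\<lambda>i. s i x) \<longlonglongrightarrow> indicator A x *\<^sub>R f x"
      by (auto simp: strongly_measurable_def)
    show "strongly_measurable (restrict_space M A) f"
      unfolding strongly_measurable_def
    proof (intro exI[of _ s] conjI allI)
      have "simple_function M (\<lambda>x. indicator A x *\<^sub>R s i x)" for i
        using s(1) A by (auto intro: simple_function_compose2)
      then show "simple_function (restrict_space M A) (s i)" for i
        using simple_function_restrict_space[OF A'] by blast
      show "AE x in restrict_space M A. (\<lambda>i. s i x) \<longlonglongrightarrow> f x"
        using s(2) unfolding AE_restrict_space_iff[OF A'] by eventually_elim auto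
    qed
  qed
qed

text \<open>Sampling \<open>f\<close> on the grid of mesh \<open>1 / (n + 1)\<close> gives simple
  functions because \<open>{0..b}\<close> meets finitely many grid cells. Rounding down keeps the
  sample points inside \<open>{0..b}\<close>, where continuity is available.\<close>

lemma strongly_measurable_continuous:
  fixes f :: "real \<Rightarrow> 'b::real_normed_vector"
  assumes c: "continuous_on {0..b} f"
  shows "strongly_measurable (lebesgue_on {0..b}) f"
  unfolding strongly_measurable_def
proof (intro exI[of _ "\<lambda>n t. f (of_int \<lfloor>real (Suc n) * t\<rfloor> / real (Suc n))"] conjI allI AE_I2)
  fix n
  let ?M = "lebesgue_on {0..b}"
  have "(\<lambda>t::real. \<lfloor>real (Suc n) * t\<rfloor>) \<in> measurable ?M (count_space UNIV)"
  proof -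
    have [measurable]: "(\<lambda>t::real. t) \<in> borel_measurable ?M"
      by (intro measurable_restrict_space1 measurable_completion) simp
    show ?thesis by measurable
  qed
  moreover have "finite ((\<lambda>t::real. \<lfloor>real (Suc n) * t\<rfloor>) ` space ?M)"
  proof (rule finite_subset)
    show "(\<lambda>t::real. \<lfloor>real (Suc n) * t\<rfloor>) ` space ?M \<subseteq> {0..\<lfloor>real (Suc n) * b\<rfloor>}"
      by (auto simp del: of_nat_Suc intro!: floor_mono mult_left_mono)
  qed simp
  ultimately have "simple_function ?M (\<lambda>t::real. \<lfloor>real (Suc n) * t\<rfloor>)"
    unfolding simple_function_def by (intro conjI ballI measurable_sets) auto
  from simple_function_compose1[OF this, of "\<lambda>k. f (of_int k / real (Suc n))"]
  show "simple_function ?M (\<lambda>t. f (of_int \<lfloor>real (Suc n) * t\<rfloor> / real (Suc n)))" .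
next
  fix t assume "t \<in> space (lebesgue_on {0..b})"
  then have t: "0 \<le> t" "t \<le> b" by auto
  let ?r = "\<lambda>n. of_int \<lfloor>real (Suc n) * t\<rfloor> / real (Suc n) :: real"
  have u: "?r n \<le> t" for n
    by (simp add: divide_le_eq del: of_nat_Suc) (metis mult.commute of_int_floor_le)
  have l: "t - 1 / real (Suc n) \<le> ?r n" for n
  proof -
    have "real (Suc n) * t - 1 \<le> of_int \<lfloor>real (Suc n) * t\<rfloor>" by linarith
    then have "(real (Suc n) * t - 1) / real (Suc n) \<le> ?r n" by (intro divide_right_mono) auto
    then show ?thesis by (simp add: diff_divide_distrib del: of_nat_Suc)
  qed
  have "(\<lambda>n. t - 1 / real (Suc n)) \<longlonglongrightarrow> t - 0"
    by (intro tendsto_diff tendsto_const lim_1_over_n[THEN LIMSEQ_Suc])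
  then have lim: "?r \<longlonglongrightarrow> t"
    by (intro tendsto_sandwich[OF _ _ _ tendsto_const, of "\<lambda>n. t - 1 / real (Suc n)" ?r])
      (use u l in auto)
  have in_: "?r n \<in> {0..b}" for n using u[of n] t by (auto intro!: divide_nonneg_nonneg)
  show "(\<lambda>n. f (?r n)) \<longlonglongrightarrow> f t"
    using continuous_on_tendsto_compose[OF c lim] t in_ by simp
qed

section \<open>Additivity, uniqueness and restriction of the Bochner integral\<close>

lemma tendsto_0_ennreal_squeeze:
  fixes f g :: "'a \<Rightarrow> ennreal"
  assumes "\<And>i. f i \<le> g i" "(g \<longlongrightarrow> 0) F"
  shows "(f \<longlongrightarrow> 0) F"
  by (rule tendsto_sandwich[OF _ _ tendsto_const assms(2)]) (simp_all add: assms(1))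

lemma norm_simple_bochner_integral_le:
  assumes "Bochner_Integration.simple_bochner_integrable M s"
  shows "ennreal (norm (Bochner_Integration.simple_bochner_integral M s)) \<le> (\<integral>\<^sup>+x. norm (s x) \<partial>M)"
proof -
  have i: "Bochner_Integration.simple_bochner_integrable M (\<lambda>x. norm (s x))"
    by (rule simple_bochner_integrable_compose2[OF _ assms assms]) simp
  have "ennreal (norm (Bochner_Integration.simple_bochner_integral M s)) \<le> Bochner_Integration.simple_bochner_integral M (\<lambda>x. norm (s x))"
    by (intro ennreal_leI simple_bochner_integral_norm_bound assms)
  also have "\<dots> = (\<integral>\<^sup>+x. norm (s x) \<partial>M)"
    by (rule simple_bochner_integral_eq_nn_integral[OF i]) simp
  finally show ?thesis .
qed

lemma simple_bochner_integrable_strongly_measurable: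
  "Bochner_Integration.simple_bochner_integrable M s \<Longrightarrow> strongly_measurable M s"
  by (intro strongly_measurable_simple) (auto elim: simple_bochner_integrable.cases)

lemma bochner_has_integral_add:
  assumes M: "complete_measure M" and f: "bochner_has_integral M f v" and g: "bochner_has_integral M g w"
  shows "bochner_has_integral M (\<lambda>x. f x + g x) (v + w)"
proof -
  obtain s where s: "\<And>i::nat. Bochner_Integration.simple_bochner_integrable M (s i)"
     "(\<lambda>i. \<integral>\<^sup>+x. norm (f x - s i x) \<partial>M) \<longlonglongrightarrow> 0" "(\<lambda>i. Bochner_Integration.simple_bochner_integral M (s i)) \<longlonglongrightarrow> v"
    using f by (auto simp: bochner_has_integral_def)
  obtain s' where s': "\<And>i::nat. Bochner_Integration.simple_bochner_integrable M (s' i)"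
     "(\<lambda>i. \<integral>\<^sup>+x. norm (g x - s' i x) \<partial>M) \<longlonglongrightarrow> 0" "(\<lambda>i. Bochner_Integration.simple_bochner_integral M (s' i)) \<longlonglongrightarrow> w"
    using g by (auto simp: bochner_has_integral_def)
  have smf: "strongly_measurable M f" and smg: "strongly_measurable M g"
    using f g by (auto simp: bochner_has_integral_def)
  have m: "(\<lambda>x. norm (f x - s i x)) \<in> borel_measurable M" "(\<lambda>x. norm (g x - s' i x)) \<in> borel_measurable M" for i
    by (rule strongly_measurable_norm[OF M strongly_measurable_diff[OF smf simple_bochner_integrable_strongly_measurable[OF s(1)]]],
        rule strongly_measurable_norm[OF M strongly_measurable_diff[OF smg simple_bochner_integrable_strongly_measurable[OF s'(1)]]])
  show ?thesis
    unfolding bochner_has_integral_def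
  proof (intro conjI exI[of _ "\<lambda>i x. s i x + s' i x"] allI)
    show "strongly_measurable M (\<lambda>x. f x + g x)" using smf smg by (rule strongly_measurable_add)
    show "Bochner_Integration.simple_bochner_integrable M (\<lambda>x. s i x + s' i x)" for i
      by (rule simple_bochner_integrable_compose2[OF _ s(1) s'(1)]) simp
    show "(\<lambda>i. Bochner_Integration.simple_bochner_integral M (\<lambda>x. s i x + s' i x)) \<longlonglongrightarrow> v + w"
      using tendsto_add[OF s(3) s'(3)] by (simp add: simple_bochner_integral_add s(1) s'(1))
    have "(\<integral>\<^sup>+x. norm (f x + g x - (s i x + s' i x)) \<partial>M) \<le>
        (\<integral>\<^sup>+x. norm (f x - s i x) \<partial>M) + (\<integral>\<^sup>+x. norm (g x - s' i x) \<partial>M)" for i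
    proof -
      have "(\<integral>\<^sup>+x. norm (f x + g x - (s i x + s' i x)) \<partial>M) \<le> (\<integral>\<^sup>+x. ennreal (norm (f x - s i x)) + ennreal (norm (g x - s' i x)) \<partial>M)"
        by (intro nn_integral_mono)
          (simp only: ennreal_plus[symmetric] norm_ge_zero ennreal_leI norm_diff_triangle_ineq)
      also have "\<dots> = (\<integral>\<^sup>+x. norm (f x - s i x) \<partial>M) + (\<integral>\<^sup>+x. norm (g x - s' i x) \<partial>M)"
        using m by (intro nn_integral_add) auto
      finally show ?thesis .
    qed
    then show "(\<lambda>i. \<integral>\<^sup>+x. norm (f x + g x - (s i x + s' i x)) \<partial>M) \<longlonglongrightarrow> 0"
      by (rule tendsto_0_ennreal_squeeze[OF _ tendsto_add_zero[OF s(2) s'(2)]])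
  qed
qed

lemma bochner_has_integral_bounded_linear:
  assumes M: "complete_measure M" and f: "bochner_has_integral M f v" and T: "bounded_linear T"
  shows "bochner_has_integral M (\<lambda>x. T (f x)) (T v)"
proof -
  interpret T: bounded_linear T by fact
  obtain s where s: "\<And>i::nat. Bochner_Integration.simple_bochner_integrable M (s i)"
     "(\<lambda>i. \<integral>\<^sup>+x. norm (f x - s i x) \<partial>M) \<longlonglongrightarrow> 0" "(\<lambda>i. Bochner_Integration.simple_bochner_integral M (s i)) \<longlonglongrightarrow> v"
    using f by (auto simp: bochner_has_integral_def)
  have smf: "strongly_measurable M f"
    using f by (auto simp: bochner_has_integral_def)
  have m: "(\<lambda>x. norm (f x - s i x)) \<in> borel_measurable M" for i
    by (rule strongly_measurable_norm[OF M strongly_measurable_diff[OF smf simple_bochner_integrable_strongly_measurable[OF s(1)]]])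
  obtain K where K: "K > 0" "\<And>x. norm (T x) \<le> norm x * K" using T.pos_bounded by auto
  show ?thesis
    unfolding bochner_has_integral_def
  proof (intro conjI exI[of _ "\<lambda>i x. T (s i x)"] allI)
    show "strongly_measurable M (\<lambda>x. T (f x))"
      using smf by (rule strongly_measurable_compose1) (rule T.continuous_on[OF continuous_on_id])
    show "Bochner_Integration.simple_bochner_integrable M (\<lambda>x. T (s i x))" for i
      by (rule simple_bochner_integrable_compose2[OF _ s(1) s(1)]) (simp add: T.zero)
    show "(\<lambda>i. Bochner_Integration.simple_bochner_integral M (\<lambda>x. T (s i x))) \<longlonglongrightarrow> T v"
      using T.tendsto[OF s(3)] by (simp add: simple_bochner_integral_linear[OF T.linear_axioms s(1)])
    have "(\<integral>\<^sup>+x. norm (T (f x) - T (s i x)) \<partial>M) \<le> ennreal K * (\<integral>\<^sup>+x. norm (f x - s i x) \<partial>M)" for i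
    proof -
      have "(\<integral>\<^sup>+x. norm (T (f x) - T (s i x)) \<partial>M) \<le> (\<integral>\<^sup>+x. ennreal K * ennreal (norm (f x - s i x)) \<partial>M)"
      proof (rule nn_integral_mono)
        fix x
        have "norm (T (f x) - T (s i x)) \<le> K * norm (f x - s i x)"
          using K(2)[of "f x - s i x"] by (simp add: T.diff mult.commute)
        then show "ennreal (norm (T (f x) - T (s i x))) \<le> ennreal K * ennreal (norm (f x - s i x))"
          using K(1) by (simp flip: ennreal_mult')
      qed
      also have "\<dots> = ennreal K * (\<integral>\<^sup>+x. norm (f x - s i x) \<partial>M)"
        using m by (intro nn_integral_cmult) auto
      finally show ?thesis .
    qed
    moreover have "(\<lambda>i. ennreal K * (\<integral>\<^sup>+x. norm (f x - s i x) \<partial>M)) \<longlonglongrightarrow> 0"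
      using ennreal_tendsto_cmult[OF _ s(2), of "ennreal K"] by simp
    ultimately show "(\<lambda>i. \<integral>\<^sup>+x. norm (T (f x) - T (s i x)) \<partial>M) \<longlonglongrightarrow> 0"
      by (rule tendsto_0_ennreal_squeeze)
  qed
qed

lemma bochner_has_integral_zero: "bochner_has_integral M (\<lambda>x. 0) (0::'b::real_normed_vector)"
proof -
  have "Bochner_Integration.simple_bochner_integral M (\<lambda>x. 0) = (0::'b)"
    unfolding simple_bochner_integral_def by (rule sum.neutral) auto
  then show ?thesis
    unfolding bochner_has_integral_def
    by (intro conjI exI[of _ "\<lambda>_ _. 0"])
      (auto intro!: strongly_measurable_simple simple_bochner_integrable.intros)
qed

text \<open>By additivity, uniqueness reduces to this case. The approximants of the zero function
  tend to 0 in L1, and the norm of the integral of a simple function is at most its L1 norm.\<close>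

lemma bochner_has_integral_zero_unique:
  assumes M: "complete_measure M" and f: "bochner_has_integral M (\<lambda>x. 0) v"
  shows "v = 0"
proof -
  obtain s where s: "\<And>i::nat. Bochner_Integration.simple_bochner_integrable M (s i)"
     "(\<lambda>i. \<integral>\<^sup>+x. norm (0 - s i x) \<partial>M) \<longlonglongrightarrow> 0" "(\<lambda>i. Bochner_Integration.simple_bochner_integral M (s i)) \<longlonglongrightarrow> v"
    using f by (auto simp: bochner_has_integral_def)
  have "(\<lambda>i. ennreal (norm (Bochner_Integration.simple_bochner_integral M (s i)))) \<longlonglongrightarrow> 0"
    using norm_simple_bochner_integral_le[OF s(1)]
    by (intro tendsto_0_ennreal_squeeze[OF _ s(2)]) simp
  moreover have "(\<lambda>i. ennreal (norm (Bochner_Integration.simple_bochner_integral M (s i)))) \<longlonglongrightarrow> ennreal (norm v)"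
    by (intro tendsto_ennrealI tendsto_norm s)
  ultimately have "ennreal (norm v) = 0" using LIMSEQ_unique by blast
  then show ?thesis by simp
qed

lemma bochner_has_integral_unique:
  assumes M: "complete_measure M" and f: "bochner_has_integral M f v" "bochner_has_integral M f w"
  shows "v = w"
proof -
  have "bochner_has_integral M (\<lambda>x. - f x) (- w)"
    using bochner_has_integral_bounded_linear[OF M f(2) bounded_linear_minus[OF bounded_linear_ident]] by simp
  from bochner_has_integral_add[OF M f(1) this] have "bochner_has_integral M (\<lambda>x. 0) (v - w)" by simp
  from bochner_has_integral_zero_unique[OF M this] show ?thesis by simp
qed

lemma bochner_has_integral_restrict_space:
  assumes A: "A \<in> sets M"
  shows "bochner_has_integral (restrict_space M A) f v \<longleftrightarrow> bochner_has_integral M (\<lambda>x. indicator A x *\<^sub>R f x) v"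
proof -
  have A': "A \<inter> space M \<in> sets M" using A by auto
  show ?thesis
  proof
    assume "bochner_has_integral (restrict_space M A) f v"
    then obtain s where s: "\<And>i::nat. Bochner_Integration.simple_bochner_integrable (restrict_space M A) (s i)"
      "(\<lambda>i. \<integral>\<^sup>+x. norm (f x - s i x) \<partial>restrict_space M A) \<longlonglongrightarrow> 0"
      "(\<lambda>i. Bochner_Integration.simple_bochner_integral (restrict_space M A) (s i)) \<longlonglongrightarrow> v"
      and sm: "strongly_measurable (restrict_space M A) f"
      by (auto simp: bochner_has_integral_def)
    show "bochner_has_integral M (\<lambda>x. indicator A x *\<^sub>R f x) v"
      unfolding bochner_has_integral_def
    proof (intro exI[of _ "\<lambda>i x. indicator A x *\<^sub>R s i x"] conjI allI)
      show "strongly_measurable M (\<lambda>x. indicator A x *\<^sub>R f x)"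
        using sm strongly_measurable_restrict_space[OF A] by blast
      show "Bochner_Integration.simple_bochner_integrable M (\<lambda>x. indicator A x *\<^sub>R s i x)" for i
        using s(1) simple_bochner_integrable_restrict_space[OF A'] by blast
      show "(\<lambda>i. Bochner_Integration.simple_bochner_integral M (\<lambda>x. indicator A x *\<^sub>R s i x)) \<longlonglongrightarrow> v"
        using s(3) by (simp add: simple_bochner_integral_restrict_space[OF A' s(1)])
      have "(\<integral>\<^sup>+x. norm (indicator A x *\<^sub>R f x - indicator A x *\<^sub>R s i x) \<partial>M) = (\<integral>\<^sup>+x. norm (f x - s i x) \<partial>restrict_space M A)" for i
        unfolding nn_integral_restrict_space[OF A']
        by (intro nn_integral_cong) (auto simp: indicator_def)
      then show "(\<lambda>i. \<integral>\<^sup>+x. norm (indicator A x *\<^sub>R f x - indicator A x *\<^sub>R s i x) \<partial>M) \<longlonglongrightarrow> 0"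
        using s(2) by simp
    qed
  next
    assume "bochner_has_integral M (\<lambda>x. indicator A x *\<^sub>R f x) v"
    then obtain s where s: "\<And>i::nat. Bochner_Integration.simple_bochner_integrable M (s i)"
      "(\<lambda>i. \<integral>\<^sup>+x. norm (indicator A x *\<^sub>R f x - s i x) \<partial>M) \<longlonglongrightarrow> 0"
      "(\<lambda>i. Bochner_Integration.simple_bochner_integral M (s i)) \<longlonglongrightarrow> v"
      and sm: "strongly_measurable M (\<lambda>x. indicator A x *\<^sub>R f x)"
      by (auto simp: bochner_has_integral_def)
    have si: "Bochner_Integration.simple_bochner_integrable M (\<lambda>x. indicator A x *\<^sub>R s i x)" for i
    proof (rule simple_bochner_integrable.intros)
      show "simple_function M (\<lambda>x. indicator A x *\<^sub>R s i x)"
        using s(1)[of i] A by (auto intro: simple_function_compose2 elim: simple_bochner_integrable.cases)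
      have m: "s i \<in> measurable M (count_space UNIV)"
        using s(1)[of i] by (auto intro: measurable_simple_function elim: simple_bochner_integrable.cases)
      have "emeasure M {y \<in> space M. indicator A y *\<^sub>R s i y \<noteq> 0} \<le> emeasure M {y \<in> space M. s i y \<noteq> 0}"
        by (intro emeasure_mono) (use m in auto)
      then show "emeasure M {y \<in> space M. indicator A y *\<^sub>R s i y \<noteq> 0} \<noteq> \<infinity>"
        using s(1)[of i] by (auto simp: simple_bochner_integrable.simps top_unique)
    qed
    then have si': "Bochner_Integration.simple_bochner_integrable (restrict_space M A) (s i)" for i
      using simple_bochner_integrable_restrict_space[OF A'] by blast
    have le: "(\<integral>\<^sup>+x. norm (f x - s i x) \<partial>restrict_space M A) \<le> (\<integral>\<^sup>+x. norm (indicator A x *\<^sub>R f x - s i x) \<partial>M)" for i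
      unfolding nn_integral_restrict_space[OF A']
      by (intro nn_integral_mono) (auto simp: indicator_def)
    show "bochner_has_integral (restrict_space M A) f v"
      unfolding bochner_has_integral_def
    proof (intro exI[of _ s] conjI allI si')
      show "strongly_measurable (restrict_space M A) f"
        using sm strongly_measurable_restrict_space[OF A] by blast
      show "(\<lambda>i. \<integral>\<^sup>+x. norm (f x - s i x) \<partial>restrict_space M A) \<longlonglongrightarrow> 0"
        using le by (rule tendsto_0_ennreal_squeeze[OF _ s(2)])
      \<comment> \<open>The approximants need not vanish off \<open>A\<close>. There the target is
        0, so the part of \<open>s i\<close> that is cut away is itself approximation error and
        disappears in the limit.\<close>
      have d: "norm (Bochner_Integration.simple_bochner_integral M (s i) - Bochner_Integration.simple_bochner_integral M (\<lambda>x. indicator A x *\<^sub>R s i x))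
          \<le> (\<integral>\<^sup>+x. norm (indicator A x *\<^sub>R f x - s i x) \<partial>M)" for i
      proof -
        have "Bochner_Integration.simple_bochner_integral M (s i) - Bochner_Integration.simple_bochner_integral M (\<lambda>x. indicator A x *\<^sub>R s i x)
          = Bochner_Integration.simple_bochner_integral M (\<lambda>x. s i x - indicator A x *\<^sub>R s i x)"
          by (rule simple_bochner_integral_diff[OF s(1) si, symmetric])
        moreover have "ennreal (norm (Bochner_Integration.simple_bochner_integral M (\<lambda>x. s i x - indicator A x *\<^sub>R s i x)))
           \<le> (\<integral>\<^sup>+x. norm (s i x - indicator A x *\<^sub>R s i x) \<partial>M)"
          by (rule norm_simple_bochner_integral_le[OF simple_bochner_integrable_compose2[OF _ s(1) si]]) simp
        moreover have "\<dots> \<le> (\<integral>\<^sup>+x. norm (indicator A x *\<^sub>R f x - s i x) \<partial>M)"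
          by (intro nn_integral_mono) (auto simp: indicator_def)
        ultimately show ?thesis by (simp add: order_trans)
      qed
      have "(\<lambda>i. ennreal (norm (Bochner_Integration.simple_bochner_integral M (s i) - Bochner_Integration.simple_bochner_integral M (\<lambda>x. indicator A x *\<^sub>R s i x)))) \<longlonglongrightarrow> ennreal 0"
        unfolding ennreal_0 using d by (rule tendsto_0_ennreal_squeeze[OF _ s(2)])
      then have "(\<lambda>i. norm (Bochner_Integration.simple_bochner_integral M (s i) - Bochner_Integration.simple_bochner_integral M (\<lambda>x. indicator A x *\<^sub>R s i x))) \<longlonglongrightarrow> 0"
        by (subst (asm) tendsto_ennreal_iff) auto
      from tendsto_diff[OF s(3) tendsto_norm_zero_cancel[OF this]]
      have "(\<lambda>i. Bochner_Integration.simple_bochner_integral M (\<lambda>x. indicator A x *\<^sub>R s i x)) \<longlonglongrightarrow> v" by simp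
      then show "(\<lambda>i. Bochner_Integration.simple_bochner_integral (restrict_space M A) (s i)) \<longlonglongrightarrow> v"
        by (simp add: simple_bochner_integral_restrict_space[OF A' si'])
    qed
  qed
qed

section \<open>The extrapolated semigroup\<close>

text \<open>The bound makes \<open>g\<close> factor through \<open>J\<close> even if
  \<open>J\<close> is not injective, and the factor is Lipschitz on \<open>range J\<close>. It
  therefore extends uniformly continuously to the closure; linearity and the norm bound pass to
  limits.\<close>

lemma dense_extension_exists:
  fixes J :: "'a::real_vector \<Rightarrow> 'b::banach" and g :: "'a \<Rightarrow> 'c::banach"
  assumes J: "linear J" and g: "linear g" and dense: "closure (range J) = UNIV"
    and bound: "\<And>x. norm (g x) \<le> C * norm (J x)"
  shows "\<exists>S. \<forall>x. blinfun_apply S (J x) = g x"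
proof -
  have nb: "norm (g x) \<le> \<bar>C\<bar> * norm (J x)" for x
    by (rule order_trans[OF bound]) (simp add: mult_right_mono)
  have gJ: "g x = g y" if "J x = J y" for x y
    using nb[of "x - y"] that by (simp add: linear_diff[OF g] linear_diff[OF J])
  define h where "h y = g (inv J y)" for y
  have h: "h (J x) = g x" for x
    unfolding h_def by (rule gJ) (simp add: f_inv_into_f)
  have "uniformly_continuous_on (range J) h"
    unfolding uniformly_continuous_on_def
  proof (intro allI impI)
    fix e :: real assume e: "0 < e"
    have "dist (h (J x)) (h (J y)) < e" if "dist (J x) (J y) < e / (\<bar>C\<bar> + 1)" for x y
    proof -
      have "dist (h (J x)) (h (J y)) \<le> \<bar>C\<bar> * dist (J x) (J y)"
        using nb[of "x - y"] by (simp add: h dist_norm linear_diff[OF g] linear_diff[OF J])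
      also have "\<dots> \<le> (\<bar>C\<bar> + 1) * dist (J x) (J y)" by (intro mult_right_mono) auto
      also have "\<dots> < e" using that by (simp add: field_simps)
      finally show ?thesis .
    qed
    then show "\<exists>d>0. \<forall>x\<in>range J. \<forall>x'\<in>range J. dist x' x < d \<longrightarrow> dist (h x') (h x) < e"
      using e by (intro exI[of _ "e / (\<bar>C\<bar> + 1)"]) auto
  qed
  from uniformly_continuous_on_extension_on_closure[OF this]
  obtain k where k: "uniformly_continuous_on UNIV k" and kh: "\<And>y. y \<in> range J \<Longrightarrow> h y = k y"
    unfolding dense by metis
  have kJ: "k (J x) = g x" for x using kh[of "J x"] h by simp
  have kc: "isCont k y" for y
    using uniformly_continuous_imp_continuous[OF k] by (simp add: continuous_on_eq_continuous_at)
  have appr: "\<exists>s. (\<lambda>n. J (s n)) \<longlonglongrightarrow> y" for y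
  proof -
    have "y \<in> closure (range J)" by (simp add: dense)
    then obtain f where f: "\<And>n. f n \<in> range J" "f \<longlonglongrightarrow> y" by (auto simp: closure_sequential)
    then have "\<forall>n. \<exists>x. f n = J x" by blast
    then obtain s where "\<And>n. f n = J (s n)" by metis
    then have "f = (\<lambda>n. J (s n))" by blast
    with f show ?thesis by blast
  qed
  have "bounded_linear k"
  proof (rule bounded_linear_intro[where K = "\<bar>C\<bar>"])
    fix y z
    obtain s s' where s: "(\<lambda>n. J (s n)) \<longlonglongrightarrow> y" "(\<lambda>n. J (s' n)) \<longlonglongrightarrow> z" using appr by metis
    have "(\<lambda>n. k (J (s n)) + k (J (s' n))) \<longlonglongrightarrow> k y + k z"
      by (intro tendsto_add isCont_tendsto_compose[OF kc] s)
    moreover have "(\<lambda>n. k (J (s n) + J (s' n))) \<longlonglongrightarrow> k (y + z)"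
      by (intro tendsto_add isCont_tendsto_compose[OF kc] s)
    moreover have "k (J (s n) + J (s' n)) = k (J (s n)) + k (J (s' n))" for n
      using kJ[of "s n + s' n"] by (simp add: linear_add[OF g] linear_add[OF J] kJ)
    ultimately show "k (y + z) = k y + k z" using LIMSEQ_unique by simp
  next
    fix r y
    obtain s where s: "(\<lambda>n. J (s n)) \<longlonglongrightarrow> y" using appr by metis
    have "(\<lambda>n. r *\<^sub>R k (J (s n))) \<longlonglongrightarrow> r *\<^sub>R k y"
      by (intro tendsto_scaleR tendsto_const isCont_tendsto_compose[OF kc] s)
    moreover have "(\<lambda>n. k (r *\<^sub>R J (s n))) \<longlonglongrightarrow> k (r *\<^sub>R y)"
      by (intro tendsto_scaleR tendsto_const isCont_tendsto_compose[OF kc] s)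
    moreover have "k (r *\<^sub>R J (s n)) = r *\<^sub>R k (J (s n))" for n
      using kJ[of "r *\<^sub>R s n"] by (simp add: linear_scale[OF g] linear_scale[OF J] kJ)
    ultimately show "k (r *\<^sub>R y) = r *\<^sub>R k y" using LIMSEQ_unique by simp
  next
    fix y
    obtain s where s: "(\<lambda>n. J (s n)) \<longlonglongrightarrow> y" using appr by metis
    show "norm (k y) \<le> norm y * \<bar>C\<bar>"
    proof (rule LIMSEQ_le)
      show "(\<lambda>n. norm (k (J (s n)))) \<longlonglongrightarrow> norm (k y)"
        by (intro tendsto_norm isCont_tendsto_compose[OF kc] s)
      show "(\<lambda>n. norm (J (s n)) * \<bar>C\<bar>) \<longlonglongrightarrow> norm y * \<bar>C\<bar>"
        by (intro tendsto_mult tendsto_norm tendsto_const s)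
      show "\<exists>N. \<forall>n\<ge>N. norm (k (J (s n))) \<le> norm (J (s n)) * \<bar>C\<bar>"
        using nb by (auto simp: kJ mult.commute)
    qed
  qed
  then show ?thesis by (intro exI[of _ "Blinfun k"]) (simp add: bounded_linear_Blinfun_apply kJ)
qed

lemma blinfun_eq_on_dense:
  fixes J :: "'a \<Rightarrow> 'b::real_normed_vector"
  assumes dense: "closure (range J) = UNIV" and eq: "\<And>x. blinfun_apply S (J x) = blinfun_apply S' (J x)"
  shows "S = S'"
proof (rule blinfun_eqI)
  fix y
  have "closed {y. blinfun_apply S y = blinfun_apply S' y}"
    by (intro closed_Collect_eq continuous_intros)
  moreover have "range J \<subseteq> {y. blinfun_apply S y = blinfun_apply S' y}" using eq by auto
  ultimately have "closure (range J) \<subseteq> {y. blinfun_apply S y = blinfun_apply S' y}"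
    by (rule closure_minimal[rotated])
  then show "blinfun_apply S y = blinfun_apply S' y" using dense by auto
qed

text \<open>\<open>T t\<close> is bounded and commutes with \<open>T h\<close>, so it carries the
  difference quotients of \<open>x\<close> to those of \<open>T t x\<close>.\<close>

lemma generator_commute:
  assumes gen: "generates_C0_semigroup D A T" and x: "x \<in> D" and t: "t \<ge> 0"
  shows "T t x \<in> D \<and> A (T t x) = T t (A x)"
proof -
  have comp: "\<And>s t. s \<ge> 0 \<Longrightarrow> t \<ge> 0 \<Longrightarrow> T (s + t) = T s o\<^sub>L T t"
    and D: "D = {x. \<exists>y. ((\<lambda>t. (1 / t) *\<^sub>R (T t x - x)) \<longlongrightarrow> y) (at_right 0)}"
    and A: "\<And>x. x \<in> D \<Longrightarrow> ((\<lambda>t. (1 / t) *\<^sub>R (T t x - x)) \<longlongrightarrow> A x) (at_right 0)"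
    using gen by (auto simp: generates_C0_semigroup_def C0_semigroup_def)
  have "((\<lambda>h. T t ((1 / h) *\<^sub>R (T h x - x))) \<longlongrightarrow> T t (A x)) (at_right 0)"
    by (intro tendsto_intros A x)
  moreover have "\<forall>\<^sub>F h in at_right 0. T t ((1 / h) *\<^sub>R (T h x - x)) = (1 / h) *\<^sub>R (T h (T t x) - T t x)"
    unfolding eventually_at_right_field
  proof (intro exI[of _ 1] conjI allI impI)
    fix h :: real assume "0 < h"
    then have "T t (T h x) = T h (T t x)"
      using comp[of t h] comp[of h t] t by (metis add.commute blinfun_apply_blinfun_compose less_imp_le)
    then show "T t ((1 / h) *\<^sub>R (T h x - x)) = (1 / h) *\<^sub>R (T h (T t x) - T t x)"
      by (simp add: blinfun.scaleR_right blinfun.diff_right)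
  qed simp
  ultimately have l: "((\<lambda>h. (1 / h) *\<^sub>R (T h (T t x) - T t x)) \<longlongrightarrow> T t (A x)) (at_right 0)"
    by (rule Lim_transform_eventually)
  then have d: "T t x \<in> D" by (subst D) blast
  from tendsto_unique[OF trivial_limit_at_right_real A[OF d] l] d show ?thesis by simp
qed

lemma resolvent_commute:
  assumes gen: "generates_C0_semigroup D A T" and \<beta>: "\<beta> \<in> resolvent_set D A" and t: "t \<ge> 0"
  shows "resolvent D A \<beta> (T t x) = T t (resolvent D A \<beta> x)"
proof -
  have b: "bij_betw (\<lambda>x. \<beta> *\<^sub>R x - A x) D UNIV" using \<beta> by (simp add: resolvent_set_def)
  define y where "y = resolvent D A \<beta> x"
  have y: "y \<in> D" "\<beta> *\<^sub>R y - A y = x"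
    using b inv_into_into[of x "\<lambda>x. \<beta> *\<^sub>R x - A x" D] f_inv_into_f[of x "\<lambda>x. \<beta> *\<^sub>R x - A x" D]
    by (auto simp: y_def resolvent_def bij_betw_def)
  have c: "T t y \<in> D" "A (T t y) = T t (A y)" using generator_commute[OF gen y(1) t] by auto
  have "\<beta> *\<^sub>R T t y - A (T t y) = T t x"
    unfolding c y(2)[symmetric] by (simp add: blinfun.scaleR_right blinfun.diff_right)
  then have "resolvent D A \<beta> (T t x) = T t y"
    unfolding resolvent_def using b c(1)
    by (metis (no_types, lifting) bij_betw_imp_inj_on inv_into_f_f)
  then show ?thesis by (simp add: y_def)
qed

text \<open>\<open>J x\<close> has the norm of the resolvent at \<open>x\<close>, and the resolvent
  is injective. Equations in the extrapolation space can thus be read back in X.\<close>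

lemma extrapolation_space_inj:
  assumes "extrapolation_space D A \<beta> J"
  shows "inj J"
proof -
  have l: "linear J" and n: "\<And>x. norm (J x) = norm (resolvent D A \<beta> x)"
    and b: "bij_betw (\<lambda>x. \<beta> *\<^sub>R x - A x) D UNIV" and bl: "bounded_linear (resolvent D A \<beta>)"
    using assms by (auto simp: extrapolation_space_def resolvent_set_def)
  have i: "inj (resolvent D A \<beta>)"
    using bij_betw_inv_into[OF b] by (simp add: resolvent_def bij_betw_def)
  show ?thesis
  proof (subst linear_injective_0[OF l], intro allI impI)
    fix x assume "J x = 0"
    then have "resolvent D A \<beta> x = 0" using n[of x] by simp
    also have "\<dots> = resolvent D A \<beta> 0" by (simp add: linear_simps(3)[OF bl])
    finally show "x = 0" using i by (simp add: inj_eq)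
  qed
qed

locale extrapolation =
  fixes D :: "'x::banach set" and A :: "'x \<Rightarrow> 'x" and T :: "real \<Rightarrow> 'x \<Rightarrow>\<^sub>L 'x"
    and \<beta> :: real and J :: "'x \<Rightarrow> 'm::banach"
  assumes gen: "generates_C0_semigroup D A T" and extrapol: "extrapolation_space D A \<beta> J"
begin

abbreviation "T1 \<equiv> extrapolated_semigroup J T"

lemma J_linear: "linear J" and J_dense: "closure (range J) = UNIV"
  using extrapol by (auto simp: extrapolation_space_def)

lemma J_eq_iff: "J x = J y \<longleftrightarrow> x = y"
  using extrapolation_space_inj[OF extrapol] by (simp add: inj_eq)

lemma T_0: "T 0 = id_blinfun"
  using gen by (simp add: generates_C0_semigroup_def C0_semigroup_def)

lemma T_add: "s \<ge> 0 \<Longrightarrow> t \<ge> 0 \<Longrightarrow> T (s + t) x = T s (T t x)"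
  using gen by (simp add: generates_C0_semigroup_def C0_semigroup_def)

text \<open>Since \<open>T t\<close> commutes with the resolvent, \<open>norm (J (T t x))\<close> is
  at most \<open>norm (T t) * norm (J x)\<close>. This bound gives the extension along
  \<open>J\<close> and density makes it unique, so the description in
  \<open>extrapolated_semigroup\<close> denotes it.\<close>

lemma T1_J:
  assumes t: "t \<ge> 0"
  shows "T1 t (J x) = J (T t x)"
proof -
  have \<beta>: "\<beta> \<in> resolvent_set D A" and nJ: "\<And>x. norm (J x) = norm (resolvent D A \<beta> x)"
    using extrapol by (auto simp: extrapolation_space_def)
  have "\<exists>S. \<forall>x. blinfun_apply S (J x) = J (T t x)"
  proof (rule dense_extension_exists[OF J_linear _ J_dense])
    show "linear (\<lambda>x. J (T t x))"
      using linear_compose[OF bounded_linear.linear[OF blinfun.bounded_linear_right] J_linear]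
      by (simp add: o_def)
    show "norm (J (T t x)) \<le> norm (T t) * norm (J x)" for x
      unfolding nJ resolvent_commute[OF gen \<beta> t] by (rule norm_blinfun)
  qed
  then have "\<exists>!S. \<forall>x. blinfun_apply S (J x) = J (T t x)"
    using blinfun_eq_on_dense[OF J_dense] by metis
  from theI'[OF this] show ?thesis by (simp add: extrapolated_semigroup_def)
qed

lemma T1_add:
  assumes "s \<ge> 0" "t \<ge> 0"
  shows "T1 (s + t) y = T1 s (T1 t y)"
proof -
  have "T1 (s + t) = T1 s o\<^sub>L T1 t"
    by (rule blinfun_eq_on_dense[OF J_dense]) (simp add: T1_J T_add assms)
  then show ?thesis by simp
qed

end

section \<open>Bounded inputs and the linear input map\<close>

text \<open>Later arguments handle essential boundedness through an explicit almost-everywhere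
  bound; this is the passage from the extended real essential supremum.\<close>

lemma Linf_iff:
  assumes A: "A \<in> sets lebesgue"
  shows "u \<in> Linf A \<longleftrightarrow> strongly_measurable (lebesgue_on A) u \<and> (\<exists>C. AE s in lebesgue_on A. norm (u s) \<le> C)"
proof safe
  assume u: "u \<in> Linf A"
  then show "strongly_measurable (lebesgue_on A) u" by (simp add: Linf_def)
  let ?e = "esssup (lebesgue_on A) (\<lambda>s. ereal (norm (u s)))"
  have fin: "?e < \<infinity>" using u by (simp add: Linf_def)
  have "AE s in lebesgue_on A. ereal (norm (u s)) \<le> ?e" by (rule esssup_AE)
  then have "AE s in lebesgue_on A. norm (u s) \<le> real_of_ereal ?e"
    by eventually_elim (use fin in \<open>cases ?e, auto\<close>)
  then show "\<exists>C. AE s in lebesgue_on A. norm (u s) \<le> C" ..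
next
  fix C assume sm: "strongly_measurable (lebesgue_on A) u" and C: "AE s in lebesgue_on A. norm (u s) \<le> C"
  have "(\<lambda>s. norm (u s)) \<in> borel_measurable (lebesgue_on A)"
    by (rule strongly_measurable_norm[OF complete_lebesgue_on[OF A] sm])
  then have "esssup (lebesgue_on A) (\<lambda>s. ereal (norm (u s))) \<le> ereal C"
    using C by (intro esssup_I) auto
  then have "esssup (lebesgue_on A) (\<lambda>s. ereal (norm (u s))) < \<infinity>" by auto
  with sm show "u \<in> Linf A" by (simp add: Linf_def)
qed

lemma Linf_cong:
  assumes A: "A \<in> sets lebesgue" and eq: "\<And>s. s \<in> A \<Longrightarrow> u s = v s"
  shows "u \<in> Linf A \<longleftrightarrow> v \<in> Linf A"
proof -
  have "strongly_measurable (lebesgue_on A) u = strongly_measurable (lebesgue_on A) v"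
    by (rule strongly_measurable_cong) (simp add: eq)
  moreover have "(AE s in lebesgue_on A. norm (u s) \<le> C) = (AE s in lebesgue_on A. norm (v s) \<le> C)" for C
    by (rule AE_cong) (simp add: eq)
  ultimately show ?thesis by (simp add: Linf_iff[OF A])
qed

lemma Linf_measurable_norm:
  assumes "A \<in> sets lebesgue" "u \<in> Linf A"
  shows "(\<lambda>s. norm (u s)) \<in> borel_measurable (lebesgue_on A)"
  using assms(2) by (intro strongly_measurable_norm[OF complete_lebesgue_on[OF assms(1)]]) (simp add: Linf_def)

lemma Linf_bounded:
  assumes "A \<in> sets lebesgue" "u \<in> Linf A"
  obtains C where "C > 0" "AE s in lebesgue_on A. norm (u s) \<le> C"
proof -
  obtain C where "AE s in lebesgue_on A. norm (u s) \<le> C" using assms(2) unfolding Linf_iff[OF assms(1)] by blast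
  then have "AE s in lebesgue_on A. norm (u s) \<le> max 1 C" by eventually_elim auto
  then show ?thesis by (intro that[of "max 1 C"]) auto
qed

lemma Linf_subset:
  assumes A: "A \<in> sets lebesgue" and B: "B \<in> sets lebesgue" and sub: "B \<subseteq> A" and u: "u \<in> Linf A"
  shows "u \<in> Linf B"
proof -
  from u A obtain C where sm: "strongly_measurable (lebesgue_on A) u"
    and C: "AE s in lebesgue_on A. norm (u s) \<le> C" unfolding Linf_iff[OF A] by blast
  have "(\<lambda>s. indicator B s *\<^sub>R indicator A s *\<^sub>R u s) = (\<lambda>s. indicator B s *\<^sub>R u s)"
    using sub by (auto simp: indicator_def fun_eq_iff)
  with strongly_measurable_indicator[OF sm[unfolded strongly_measurable_restrict_space[OF A]] B]
  have "strongly_measurable (lebesgue_on B) u"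
    unfolding strongly_measurable_restrict_space[OF B] by simp
  moreover have "AE s in lebesgue_on B. norm (u s) \<le> C"
    using C sub A B by (auto simp: AE_restrict_space_iff)
  ultimately show ?thesis unfolding Linf_iff[OF B] by blast
qed

lemma Linf_extend:
  assumes A: "A \<in> sets lebesgue" and B: "B \<in> sets lebesgue" and sub: "B \<subseteq> A" and u: "u \<in> Linf B"
  shows "(\<lambda>s. indicator B s *\<^sub>R u s) \<in> Linf A"
proof -
  have sm: "strongly_measurable (lebesgue_on B) u" using u by (simp add: Linf_def)
  obtain C where C0: "C > 0" and C: "AE s in lebesgue_on B. norm (u s) \<le> C"
    by (rule Linf_bounded[OF B u])
  have "strongly_measurable (lebesgue_on A) (\<lambda>s. indicator B s *\<^sub>R u s)"
    using strongly_measurable_indicator[OF sm[unfolded strongly_measurable_restrict_space[OF B]] A]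
    unfolding strongly_measurable_restrict_space[OF A] .
  moreover have "AE s in lebesgue. s \<in> A \<longrightarrow> norm (indicator B s *\<^sub>R u s) \<le> C"
  proof -
    have "AE s in lebesgue. s \<in> B \<longrightarrow> norm (u s) \<le> C" using C B by (simp add: AE_restrict_space_iff)
    then show ?thesis by eventually_elim (use C0 in \<open>auto simp: indicator_def\<close>)
  qed
  ultimately show ?thesis unfolding Linf_iff[OF A] using A by (auto simp: AE_restrict_space_iff)
qed

lemma Linf_indicator:
  assumes A: "A \<in> sets lebesgue" and B: "B \<in> sets lebesgue" and u: "u \<in> Linf A"
  shows "(\<lambda>s. indicator B s *\<^sub>R u s) \<in> Linf A"
proof -
  have "(\<lambda>s. indicator (B \<inter> A) s *\<^sub>R u s) \<in> Linf A"
    using A B u by (intro Linf_extend Linf_subset[OF A _ _ u]) auto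
  then show ?thesis
    by (rule iffD1[OF Linf_cong[OF A], rotated]) (simp add: indicator_def)
qed

lemma Linf_add:
  assumes A: "A \<in> sets lebesgue" and u: "u \<in> Linf A" and v: "v \<in> Linf A"
  shows "(\<lambda>s. u s + v s) \<in> Linf A"
proof -
  obtain C where C: "AE s in lebesgue_on A. norm (u s) \<le> C" using u unfolding Linf_iff[OF A] by blast
  obtain C' where C': "AE s in lebesgue_on A. norm (v s) \<le> C'" using v unfolding Linf_iff[OF A] by blast
  have "AE s in lebesgue_on A. norm (u s + v s) \<le> C + C'"
    using C C' by eventually_elim (rule norm_triangle_mono)
  moreover have "strongly_measurable (lebesgue_on A) (\<lambda>s. u s + v s)"
    using u v by (intro strongly_measurable_add) (simp_all add: Linf_def)
  ultimately show ?thesis unfolding Linf_iff[OF A] by blast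
qed

lemma Linf_scaleR:
  assumes A: "A \<in> sets lebesgue" and u: "u \<in> Linf A"
  shows "(\<lambda>s. c *\<^sub>R u s) \<in> Linf A"
proof -
  obtain C where C: "AE s in lebesgue_on A. norm (u s) \<le> C" using u unfolding Linf_iff[OF A] by blast
  have "AE s in lebesgue_on A. norm (c *\<^sub>R u s) \<le> \<bar>c\<bar> * C"
    using C by eventually_elim (simp add: mult_left_mono)
  moreover have "strongly_measurable (lebesgue_on A) (\<lambda>s. c *\<^sub>R u s)"
    using u by (intro strongly_measurable_compose1[where h = "\<lambda>x. c *\<^sub>R x"] continuous_intros) (simp add: Linf_def)
  ultimately show ?thesis
    unfolding Linf_iff[OF A] by blast
qed

lemma Linf_zero: "A \<in> sets lebesgue \<Longrightarrow> (\<lambda>s. 0) \<in> Linf A"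
  unfolding Linf_iff by (intro conjI strongly_measurable_simple exI[of _ 0]) auto

lemma bochner_has_integral_cong:
  assumes "\<And>x. x \<in> space M \<Longrightarrow> f x = g x"
  shows "bochner_has_integral M f v \<longleftrightarrow> bochner_has_integral M g v"
proof -
  have "(\<integral>\<^sup>+x. norm (f x - s x) \<partial>M) = (\<integral>\<^sup>+x. norm (g x - s x) \<partial>M)" for s
    by (intro nn_integral_cong) (simp add: assms)
  then show ?thesis
    unfolding bochner_has_integral_def by (simp add: strongly_measurable_cong[OF assms])
qed

lemma class_KL_zero: "\<beta> \<in> class_KL \<Longrightarrow> t \<ge> 0 \<Longrightarrow> \<beta> 0 t = 0"
  by (auto simp: class_KL_def class_K_def)

lemma class_K_zero: "\<mu> \<in> class_K \<Longrightarrow> \<mu> 0 = 0"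
  by (auto simp: class_K_def)

lemma class_K_inf_K: "\<mu> \<in> class_K_inf \<Longrightarrow> \<mu> \<in> class_K"
  by (auto simp: class_K_inf_def)

lemma class_K_mono: "\<mu> \<in> class_K \<Longrightarrow> 0 \<le> a \<Longrightarrow> a \<le> b \<Longrightarrow> \<mu> a \<le> \<mu> b"
  by (cases "a = b") (auto simp: class_K_def intro!: less_imp_le elim: strict_mono_onD)

lemma class_K_nonneg: "\<mu> \<in> class_K \<Longrightarrow> 0 \<le> a \<Longrightarrow> 0 \<le> \<mu> a"
  by (auto simp: class_K_def)

section \<open>The input map of an integral ISS linear system\<close>

context extrapolation
begin

text \<open>The convolution integral is formed in the extrapolation space and pulled back along
  \<open>J\<close>. The description is meaningful when the integral lies in \<open>range J\<close>,
  which integral ISS supplies for bounded inputs.\<close>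

definition Phi :: "('u::banach \<Rightarrow>\<^sub>L 'm) \<Rightarrow> (real \<Rightarrow> 'u) \<Rightarrow> real \<Rightarrow> 'x" where
  "Phi B v t = (THE y. bochner_has_integral (lebesgue_on {0..t}) (\<lambda>s. T1 (t - s) (B (v s))) (J y))"

lemma Phi_eqI:
  fixes B :: "'u::banach \<Rightarrow>\<^sub>L 'm"
  assumes "bochner_has_integral (lebesgue_on {0..t}) (\<lambda>s. T1 (t - s) (B (v s))) (J y)"
  shows "Phi B v t = y"
  unfolding Phi_def
proof (rule the_equality, rule assms)
  fix z assume "bochner_has_integral (lebesgue_on {0..t}) (\<lambda>s. T1 (t - s) (B (v s))) (J z)"
  from bochner_has_integral_unique[OF complete_lebesgue_on this assms] show "z = y" by (simp add: J_eq_iff)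
qed

lemma Phi_cong:
  fixes B :: "'u::banach \<Rightarrow>\<^sub>L 'm"
  assumes "\<And>s. s \<in> {0..t} \<Longrightarrow> v s = w s"
  shows "Phi B v t = Phi B w t"
  unfolding Phi_def by (intro arg_cong[of _ _ The] ext bochner_has_integral_cong) (simp add: assms)

lemma linear_mild_solution_iff:
  fixes B :: "'u::banach \<Rightarrow>\<^sub>L 'm"
  shows "linear_mild_solution J T B x0 u 0 t1 x \<longleftrightarrow> continuous_on {0..t1} x \<and>
     (\<forall>t\<in>{0..t1}. bochner_has_integral (lebesgue_on {0..t}) (\<lambda>s. T1 (t - s) (B (u s))) (J (x t - T t x0)))"
  unfolding linear_mild_solution_def mild_solution_inhom_def
  by (auto simp: linear_diff[OF J_linear])

context
  fixes B :: "'u::banach \<Rightarrow>\<^sub>L 'm"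
  assumes iISS: "linear_integral_ISS J T B"
begin

text \<open>With zero input the integral vanishes, so the mild solution is the orbit
  \<open>T t x0\<close>. It inherits the decay \<open>\<beta>'\<close> and the continuity that is
  built into the notion of a mild solution.\<close>

lemma linear_iISS_semigroup:
  obtains \<beta>' where "\<beta>' \<in> class_KL" "\<And>x t. t \<ge> 0 \<Longrightarrow> norm (T t x) \<le> \<beta>' (norm x) t"
    "\<And>x. continuous_on {0..} (\<lambda>t. T t x)"
proof -
  obtain \<beta>' \<theta> \<mu> where b: "\<beta>' \<in> class_KL" "\<theta> \<in> class_K_inf" "\<mu> \<in> class_K" and
    ex: "\<And>x0 u. u \<in> Linf {0..} \<Longrightarrow>
          \<exists>x. unique_global_mild_solution (linear_mild_solution J T B x0 u) x \<and>
              (\<forall>t\<ge>0. norm (x t) \<le> \<beta>' (norm x0) t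
                 + \<theta> (\<integral>s. \<mu> (norm (u s)) \<partial>lebesgue_on {0..t}))"
    using iISS unfolding linear_integral_ISS_def by blast
  have *: "continuous_on {0..} (\<lambda>t. T t x0) \<and> (\<forall>t\<ge>0. norm (T t x0) \<le> \<beta>' (norm x0) t)" for x0
  proof -
    obtain x where x: "\<And>t1. t1 > 0 \<Longrightarrow> linear_mild_solution J T B x0 (\<lambda>s. 0) 0 t1 x"
      and n: "\<And>t. t \<ge> 0 \<Longrightarrow> norm (x t) \<le> \<beta>' (norm x0) t"
      using ex[OF Linf_zero, of x0] class_K_zero[OF b(3)] class_K_zero[OF class_K_inf_K[OF b(2)]]
      by (auto simp: unique_global_mild_solution_def)
    have eq: "x t = T t x0" if t: "t \<ge> 0" for t
    proof -
      have "bochner_has_integral (lebesgue_on {0..t}) (\<lambda>s. 0) (J (x t - T t x0))"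
        using x[of "t + 1"] t by (simp add: linear_mild_solution_iff)
      from bochner_has_integral_unique[OF complete_lebesgue_on this bochner_has_integral_zero]
      have "J (x t - T t x0) = J 0" by (simp add: linear_0[OF J_linear])
      then show ?thesis unfolding J_eq_iff by simp
    qed
    have "continuous (at t within {0..}) x" if t: "t \<ge> 0" for t
    proof -
      have "continuous_on {0..t+1} x" using x[of "t + 1"] t by (simp add: linear_mild_solution_iff)
      then have "continuous (at t within {0..t+1}) x" using t by (simp add: continuous_on_eq_continuous_within)
      moreover have "at t within {0..t+1} = at t within {0..}"
        by (rule at_within_nhd[of _ "{..<t+1}"]) (use t in auto)
      ultimately show ?thesis by (simp add: continuous_within)
    qed
    then have "continuous_on {0..} x"
      by (simp add: continuous_on_eq_continuous_within)
    then have "continuous_on {0..} (\<lambda>t. T t x0)"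
      by (rule continuous_on_eq) (simp add: eq)
    with n show ?thesis by (simp add: eq)
  qed
  show ?thesis by (rule that[OF b(1)]) (use * in auto)
qed

text \<open>From the initial state 0 the term \<open>\<beta>'\<close> vanishes and the mild solution
  is the convolution integral itself, which is thereby seen to lie in X. Inputs on
  \<open>{0..b}\<close> are extended by 0, so \<open>\<theta>\<close> and \<open>\<mu>\<close> do
  not depend on the horizon \<open>b\<close>.\<close>

lemma linear_iISS_Phi:
  "\<exists>\<theta>\<in>class_K_inf. \<exists>\<mu>\<in>class_K. \<forall>b. \<forall>v\<in>Linf {0..b}. continuous_on {0..b} (Phi B v) \<and> (\<forall>t\<in>{0..b}.
       bochner_has_integral (lebesgue_on {0..t}) (\<lambda>s. T1 (t - s) (B (v s))) (J (Phi B v t)) \<and>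
       norm (Phi B v t) \<le> \<theta> (\<integral>s. \<mu> (norm (v s)) \<partial>lebesgue_on {0..t}))"
proof -
  obtain \<beta>' \<theta> \<mu> where b: "\<beta>' \<in> class_KL" "\<theta> \<in> class_K_inf" "\<mu> \<in> class_K" and
    ex: "\<And>x0 u. u \<in> Linf {0..} \<Longrightarrow>
          \<exists>x. unique_global_mild_solution (linear_mild_solution J T B x0 u) x \<and>
              (\<forall>t\<ge>0. norm (x t) \<le> \<beta>' (norm x0) t
                 + \<theta> (\<integral>s. \<mu> (norm (u s)) \<partial>lebesgue_on {0..t}))"
    using iISS unfolding linear_integral_ISS_def by blast
  have *: "continuous_on {0..b} (Phi B v) \<and> (\<forall>t\<in>{0..b}.
       bochner_has_integral (lebesgue_on {0..t}) (\<lambda>s. T1 (t - s) (B (v s))) (J (Phi B v t)) \<and>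
       norm (Phi B v t) \<le> \<theta> (\<integral>s. \<mu> (norm (v s)) \<partial>lebesgue_on {0..t}))"
    if v: "v \<in> Linf {0..b}" for v b
  proof -
    define w where "w = (\<lambda>s. indicator {0..b} s *\<^sub>R v s)"
    have w: "w \<in> Linf {0..}" unfolding w_def by (rule Linf_extend[OF _ _ _ v]) auto
    have wv: "w s = v s" if "s \<in> {0..t}" "t \<le> b" for s t using that by (auto simp: w_def)
    from ex[OF w, of 0] obtain x where x: "\<And>t1. t1 > 0 \<Longrightarrow> linear_mild_solution J T B 0 w 0 t1 x"
      and n: "\<And>t. t \<ge> 0 \<Longrightarrow> norm (x t) \<le> \<theta> (\<integral>s. \<mu> (norm (w s)) \<partial>lebesgue_on {0..t})"
      using class_KL_zero[OF b(1)] by (auto simp: unique_global_mild_solution_def)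
    have h: "bochner_has_integral (lebesgue_on {0..t}) (\<lambda>s. T1 (t - s) (B (v s))) (J (x t))"
      if t: "t \<in> {0..b}" for t
    proof -
      have "bochner_has_integral (lebesgue_on {0..t}) (\<lambda>s. T1 (t - s) (B (w s))) (J (x t))"
        using x[of "t + 1"] t by (simp add: linear_mild_solution_iff)
      then show ?thesis
        by (rule iffD1[OF bochner_has_integral_cong, rotated]) (use t in \<open>simp add: wv[of _ t]\<close>)
    qed
    have P: "Phi B v t = x t" if "t \<in> {0..b}" for t using Phi_eqI[OF h[OF that]] .
    \<comment> \<open>Solutions are provided only up to positive end points, whereas
      \<open>b\<close> may be 0 or negative.\<close>
    have "continuous_on {0..max b 1} x"
      using x[of "max b 1"] by (simp add: linear_mild_solution_iff less_max_iff_disj)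
    then have "continuous_on {0..b} x" by (rule continuous_on_subset) auto
    then have "continuous_on {0..b} (Phi B v)" by (rule continuous_on_eq) (simp add: P)
    moreover have "norm (x t) \<le> \<theta> (\<integral>s. \<mu> (norm (v s)) \<partial>lebesgue_on {0..t})" if t: "t \<in> {0..b}" for t
    proof -
      have "(\<integral>s. \<mu> (norm (w s)) \<partial>lebesgue_on {0..t}) = (\<integral>s. \<mu> (norm (v s)) \<partial>lebesgue_on {0..t})"
        by (intro Bochner_Integration.integral_cong) (use t in \<open>simp_all add: wv[of _ t]\<close>)
      then show ?thesis using n[of t] t by simp
    qed
    ultimately show ?thesis using h by (simp add: P)
  qed
  show ?thesis using * by (intro bexI[OF _ b(2)] bexI[OF _ b(3)] allI ballI) blast
qed

lemma Phi_integral: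
  "v \<in> Linf {0..b} \<Longrightarrow> 0 \<le> t \<Longrightarrow> t \<le> b \<Longrightarrow>
     bochner_has_integral (lebesgue_on {0..t}) (\<lambda>s. T1 (t - s) (B (v s))) (J (Phi B v t))"
  using linear_iISS_Phi by fastforce

lemma Phi_add:
  assumes "v \<in> Linf {0..b}" "w \<in> Linf {0..b}" "0 \<le> t" "t \<le> b"
  shows "Phi B (\<lambda>s. v s + w s) t = Phi B v t + Phi B w t"
  using bochner_has_integral_add[OF complete_lebesgue_on Phi_integral[OF assms(1,3,4)] Phi_integral[OF assms(2,3,4)]]
  by (intro Phi_eqI) (simp add: linear_add[OF J_linear] blinfun.add_right)

lemma Phi_scaleR:
  assumes "v \<in> Linf {0..b}" "0 \<le> t" "t \<le> b"
  shows "Phi B (\<lambda>s. c *\<^sub>R v s) t = c *\<^sub>R Phi B v t"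
  using bochner_has_integral_bounded_linear[OF complete_lebesgue_on Phi_integral[OF assms] bounded_linear_scaleR_right[of c]]
  by (intro Phi_eqI) (simp add: linear_scale[OF J_linear] blinfun.scaleR_right)

text \<open>An input switched off at time \<open>a\<close> leaves the state to the free evolution:
  \<open>T1 (t - a)\<close> is pulled through the integral and composed with
  \<open>T1 (a - s)\<close> to \<open>T1 (t - s)\<close>.\<close>

lemma Phi_restart:
  assumes v: "v \<in> Linf {0..b}" and a: "0 \<le> a" "a \<le> t" "t \<le> b"
  shows "Phi B (\<lambda>s. indicator {0..a} s *\<^sub>R v s) t = T (t - a) (Phi B v a)"
proof (rule Phi_eqI)
  have "bochner_has_integral (lebesgue_on {0..a}) (\<lambda>s. T1 (a - s) (B (v s))) (J (Phi B v a))"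
    using a by (intro Phi_integral[OF v]) auto
  from bochner_has_integral_bounded_linear[OF complete_lebesgue_on this blinfun.bounded_linear_right[of "T1 (t - a)"]]
  have "bochner_has_integral (lebesgue_on {0..a}) (\<lambda>s. T1 (t - a) (T1 (a - s) (B (v s)))) (J (T (t - a) (Phi B v a)))"
    using a by (simp add: T1_J)
  then have "bochner_has_integral lebesgue (\<lambda>s. indicator {0..a} s *\<^sub>R T1 (t - a) (T1 (a - s) (B (v s)))) (J (T (t - a) (Phi B v a)))"
    by (simp add: bochner_has_integral_restrict_space)
  also have "(\<lambda>s. indicator {0..a} s *\<^sub>R T1 (t - a) (T1 (a - s) (B (v s)))) =
     (\<lambda>s. indicator {0..t} s *\<^sub>R T1 (t - s) (B (indicator {0..a} s *\<^sub>R v s)))"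
  proof
    fix s
    show "indicator {0..a} s *\<^sub>R T1 (t - a) (T1 (a - s) (B (v s))) =
      indicator {0..t} s *\<^sub>R T1 (t - s) (B (indicator {0..a} s *\<^sub>R v s))"
      using T1_add[of "t - a" "a - s" "B (v s)"] a by (auto simp: indicator_def)
  qed
  finally show "bochner_has_integral (lebesgue_on {0..t}) (\<lambda>s. T1 (t - s) (B (indicator {0..a} s *\<^sub>R v s))) (J (T (t - a) (Phi B v a)))"
    by (simp add: bochner_has_integral_restrict_space)
qed

end

text \<open>Uniqueness of the integral and injectivity of \<open>J\<close> remove the extrapolation
  space from the equation. Boundedness of \<open>F (x s) (u1 s)\<close> is demanded only for
  continuous \<open>x\<close>, because it rests on a bound for the state.\<close>

lemma bilinear_mild_solution_iff:
  fixes B1 :: "'xb::banach \<Rightarrow>\<^sub>L 'm" and B2 :: "'u2::banach \<Rightarrow>\<^sub>L 'm"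
  assumes B1: "linear_integral_ISS J T B1" and B2: "linear_integral_ISS J T B2"
    and u2: "u2 \<in> Linf {0..b}" and v: "continuous_on {0..b} x \<Longrightarrow> (\<lambda>s. F (x s) (u1 s)) \<in> Linf {0..b}"
  shows "bilinear_mild_solution J T B1 B2 F x0 u1 u2 0 b x \<longleftrightarrow> continuous_on {0..b} x \<and>
    (\<forall>t\<in>{0..b}. x t = T t x0 + Phi B1 (\<lambda>s. F (x s) (u1 s)) t + Phi B2 u2 t)"
  unfolding bilinear_mild_solution_def mild_solution_inhom_def
proof (intro conj_cong refl ball_cong)
  fix t assume c: "continuous_on {0..b} x" and t: "t \<in> {0..b}"
  let ?I = "bochner_has_integral (lebesgue_on {0..t}) (\<lambda>s. T1 (t - s) (B1 (F (x s) (u1 s)) + B2 (u2 s)))"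
  have I: "?I (J (Phi B1 (\<lambda>s. F (x s) (u1 s)) t + Phi B2 u2 t))"
    using bochner_has_integral_add[OF complete_lebesgue_on Phi_integral[OF B1 v[OF c]] Phi_integral[OF B2 u2]] t
    by (simp add: linear_add[OF J_linear] blinfun.add_right)
  have U: "w = J (Phi B1 (\<lambda>s. F (x s) (u1 s)) t + Phi B2 u2 t)" if "?I w" for w
    by (rule bochner_has_integral_unique[OF complete_lebesgue_on that I]) simp
  have "(\<exists>w. ?I w \<and> J (x t) = J (T (t - 0) x0) + w) \<longleftrightarrow>
    J (x t) = J (T (t - 0) x0) + J (Phi B1 (\<lambda>s. F (x s) (u1 s)) t + Phi B2 u2 t)"
    using I U by blast
  also have "\<dots> \<longleftrightarrow> x t = T t x0 + Phi B1 (\<lambda>s. F (x s) (u1 s)) t + Phi B2 u2 t"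
    by (simp add: linear_add[OF J_linear, symmetric] J_eq_iff add.assoc)
  finally show "(\<exists>w. ?I w \<and> J (x t) = J (T (t - 0) x0) + w) \<longleftrightarrow>
    x t = T t x0 + Phi B1 (\<lambda>s. F (x s) (u1 s)) t + Phi B2 u2 t" .
qed

end

section \<open>A priori estimates for the bilinear system\<close>

lemma integrable_class_K_norm:
  assumes \<mu>: "\<mu> \<in> class_K" and u: "u \<in> Linf {a..b}" and c: "c \<ge> 0"
  shows "integrable (lebesgue_on {a..b}) (\<lambda>s. \<mu> (c * norm (u s)))"
proof -
  interpret finite_measure "lebesgue_on {a..b}" by (rule finite_measure_lebesgue_on) simp
  obtain C where C: "C > 0" "AE s in lebesgue_on {a..b}. norm (u s) \<le> C"
    by (rule Linf_bounded[OF _ u]) auto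
  \<comment> \<open>\<open>\<mu>\<close> is controlled only on \<open>{0..}\<close>; precomposing
    with \<open>max 0\<close> makes it continuous, hence Borel, on the whole line.\<close>
  have "continuous_on UNIV (\<lambda>r. \<mu> (max 0 r))"
    by (rule continuous_on_compose2[of "{0..}" \<mu>])
      (use \<mu> in \<open>auto simp: class_K_def intro!: continuous_intros\<close>)
  then have [measurable]: "(\<lambda>r. \<mu> (max 0 r)) \<in> borel_measurable borel"
    by (rule borel_measurable_continuous_onI)
  have [measurable]: "(\<lambda>s. norm (u s)) \<in> borel_measurable (lebesgue_on {a..b})"
    by (rule Linf_measurable_norm[OF _ u]) simp
  have "(\<lambda>s. \<mu> (max 0 (c * norm (u s)))) \<in> borel_measurable (lebesgue_on {a..b})"
    by measurable
  then have m: "(\<lambda>s. \<mu> (c * norm (u s))) \<in> borel_measurable (lebesgue_on {a..b})"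
    using c by simp
  show ?thesis
  proof (rule integrable_const_bound[OF _ m])
    show "AE s in lebesgue_on {a..b}. norm (\<mu> (c * norm (u s))) \<le> \<mu> (c * C)"
      using C(2)
    proof eventually_elim
      case (elim s)
      have "\<mu> (c * norm (u s)) \<le> \<mu> (c * C)" using c elim by (intro class_K_mono[OF \<mu>] mult_left_mono) auto
      moreover have "0 \<le> \<mu> (c * norm (u s))" using c by (intro class_K_nonneg[OF \<mu>]) auto
      ultimately show ?case by simp
    qed
  qed
qed

lemma integrable_subinterval_lebesgue_on:
  fixes f :: "real \<Rightarrow> real"
  assumes "integrable (lebesgue_on {a..b}) f" "a \<le> c" "d \<le> b"
  shows "integrable (lebesgue_on {c..d}) f"
  by (rule integrable_subinterval[OF assms(1)]) (use assms in auto)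

lemma integral_split_lebesgue_on:
  fixes f :: "real \<Rightarrow> real"
  assumes f: "integrable (lebesgue_on {a..b}) f" and c: "a \<le> c" "c \<le> b"
  shows "integral\<^sup>L (lebesgue_on {a..b}) f = integral\<^sup>L (lebesgue_on {a..c}) f + integral\<^sup>L (lebesgue_on {c..b}) f"
proof -
  have 1: "integrable (lebesgue_on {a..c}) f" "integrable (lebesgue_on {c..b}) f"
    by (rule integrable_subinterval_lebesgue_on[OF f]; use c in simp)+
  have "f integrable_on {a..b}" using f by (rule integrable_on_lebesgue_on) simp
  from Henstock_Kurzweil_Integration.integral_combine[OF c this] show ?thesis
    by (simp add: lebesgue_integral_eq_integral f 1)
qed

lemma continuous_indefinite_lebesgue_on:
  fixes f :: "real \<Rightarrow> real"
  assumes f: "integrable (lebesgue_on {a..b}) f"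
  shows "continuous_on {a..b} (\<lambda>t. integral\<^sup>L (lebesgue_on {a..t}) f)"
proof (rule continuous_on_eq)
  show "continuous_on {a..b} (\<lambda>t. integral {a..t} f)"
    by (rule indefinite_integral_continuous_1, rule integrable_on_lebesgue_on[OF f]) simp
  fix t assume t: "t \<in> {a..b}"
  then have "integrable (lebesgue_on {a..t}) f"
    by (intro integrable_subinterval_lebesgue_on[OF f]) auto
  then show "integral {a..t} f = integral\<^sup>L (lebesgue_on {a..t}) f"
    by (rule lebesgue_integral_eq_integral[symmetric]) simp
qed

lemma integral_lebesgue_on_sing: "integral\<^sup>L (lebesgue_on {a::real}) f = 0"
  by (rule integral_eq_zero_null_sets) (simp add: negligible_iff_null_sets[symmetric])

lemma integral_class_K_le:
  assumes \<mu>: "\<mu> \<in> class_K" and u: "u \<in> Linf {a..t}" and c: "c \<ge> 0" and t: "a \<le> t"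
    and C: "AE s in lebesgue_on {a..t}. norm (u s) \<le> C"
  shows "(\<integral>s. \<mu> (c * norm (u s)) \<partial>lebesgue_on {a..t}) \<le> (t - a) * \<mu> (c * C)"
proof -
  interpret finite_measure "lebesgue_on {a..t}" by (rule finite_measure_lebesgue_on) simp
  have "(\<integral>s. \<mu> (c * norm (u s)) \<partial>lebesgue_on {a..t}) \<le> (\<integral>s. \<mu> (c * C) \<partial>lebesgue_on {a..t})"
  proof (rule integral_mono_AE)
    show "integrable (lebesgue_on {a..t}) (\<lambda>s. \<mu> (c * norm (u s)))"
      by (rule integrable_class_K_norm[OF \<mu> u c])
    show "AE s in lebesgue_on {a..t}. \<mu> (c * norm (u s)) \<le> \<mu> (c * C)"
      using C by eventually_elim (use c in \<open>intro class_K_mono[OF \<mu>] mult_left_mono, auto\<close>)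
  qed simp
  also have "\<dots> = (t - a) * \<mu> (c * C)"
    using t by (simp add: measure_restrict_space)
  finally show ?thesis .
qed

lemma continuous_norm_bounded:
  assumes "continuous_on {0..b::real} (x :: real \<Rightarrow> 'a::real_normed_vector)"
  obtains R where "R > 0" "\<And>s. s \<in> {0..b} \<Longrightarrow> norm (x s) \<le> R"
proof -
  have "bounded (x ` {0..b})" by (intro compact_imp_bounded compact_continuous_image assms) simp
  then show ?thesis using that unfolding bounded_pos by auto
qed

text \<open>What the nonlinear analysis needs from a linear system, with the extrapolation space
  removed. \<open>cong\<close> expresses causality, \<open>restart\<close> compatibility with the
  semigroup, and the gains in \<open>bound\<close> are uniform in the horizon
  \<open>b\<close>.\<close>

locale input_map =
  fixes T :: "real \<Rightarrow> 'x::banach \<Rightarrow>\<^sub>L 'x" and \<Phi> :: "(real \<Rightarrow> 'u::banach) \<Rightarrow> real \<Rightarrow> 'x"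
    and \<theta> \<mu> :: "real \<Rightarrow> real"
  assumes \<theta>: "\<theta> \<in> class_K_inf" and \<mu>: "\<mu> \<in> class_K"
    and cong: "\<And>t v w. (\<And>s. s \<in> {0..t} \<Longrightarrow> v s = w s) \<Longrightarrow> \<Phi> v t = \<Phi> w t"
    and add: "\<And>b t v w. v \<in> Linf {0..b} \<Longrightarrow> w \<in> Linf {0..b} \<Longrightarrow> 0 \<le> t \<Longrightarrow> t \<le> b \<Longrightarrow>
        \<Phi> (\<lambda>s. v s + w s) t = \<Phi> v t + \<Phi> w t"
    and scaleR: "\<And>b t v c. v \<in> Linf {0..b} \<Longrightarrow> 0 \<le> t \<Longrightarrow> t \<le> b \<Longrightarrow> \<Phi> (\<lambda>s. c *\<^sub>R v s) t = c *\<^sub>R \<Phi> v t"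
    and restart: "\<And>b t a v. v \<in> Linf {0..b} \<Longrightarrow> 0 \<le> a \<Longrightarrow> a \<le> t \<Longrightarrow> t \<le> b \<Longrightarrow>
        \<Phi> (\<lambda>s. indicator {0..a} s *\<^sub>R v s) t = T (t - a) (\<Phi> v a)"
    and cont: "\<And>b v. v \<in> Linf {0..b} \<Longrightarrow> continuous_on {0..b} (\<Phi> v)"
    and bound: "\<And>b t v. v \<in> Linf {0..b} \<Longrightarrow> 0 \<le> t \<Longrightarrow> t \<le> b \<Longrightarrow>
        norm (\<Phi> v t) \<le> \<theta> (\<integral>s. \<mu> (norm (v s)) \<partial>lebesgue_on {0..t})"
begin

lemma \<theta>_K: "\<theta> \<in> class_K" using \<theta> by (rule class_K_inf_K)

lemma diff:
  assumes "v \<in> Linf {0..b}" "w \<in> Linf {0..b}" "0 \<le> t" "t \<le> b"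
  shows "\<Phi> (\<lambda>s. v s - w s) t = \<Phi> v t - \<Phi> w t"
  using add[OF assms(1) Linf_scaleR[OF _ assms(2), of "-1"] assms(3,4)] scaleR[OF assms(2-4), of "-1"] by simp

lemma at_0:
  assumes "v \<in> Linf {0..b}" "0 \<le> b"
  shows "\<Phi> v 0 = 0"
  using bound[OF assms(1), of 0] assms(2) class_K_zero[OF \<theta>_K] by (simp add: integral_lebesgue_on_sing)

lemma split:
  assumes v: "v \<in> Linf {0..b}" and a: "0 \<le> a" "a \<le> t" "t \<le> b"
  shows "\<Phi> v t = T (t - a) (\<Phi> v a) + \<Phi> (\<lambda>s. indicator {a<..} s *\<^sub>R v s) t"
proof -
  have "\<Phi> v t = \<Phi> (\<lambda>s. indicator {0..a} s *\<^sub>R v s + indicator {a<..} s *\<^sub>R v s) t"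
    by (rule cong) (auto simp: indicator_def)
  also have "\<dots> = \<Phi> (\<lambda>s. indicator {0..a} s *\<^sub>R v s) t + \<Phi> (\<lambda>s. indicator {a<..} s *\<^sub>R v s) t"
    using a by (intro add[where b = b] Linf_indicator v) auto
  finally show ?thesis using restart[OF v a] by simp
qed

text \<open>Applying the gain to \<open>(1 / k) *\<^sub>R w\<close> and multiplying back by
  \<open>k\<close> moves the factor out of \<open>\<theta>\<close>, although \<open>\<theta>\<close>
  need not be homogeneous. As \<open>w\<close> vanishes up to \<open>a\<close>, only the integral
  over \<open>{a..t}\<close> remains.\<close>

lemma bound_local:
  assumes w: "w \<in> Linf {0..b}" and a: "0 \<le> a" "a \<le> t" "t \<le> b" and k: "k \<ge> 0"
    and zero: "\<And>s. 0 \<le> s \<Longrightarrow> s \<le> a \<Longrightarrow> w s = 0"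
    and le: "\<And>s. a < s \<Longrightarrow> s \<le> t \<Longrightarrow> norm (w s) \<le> k * g s"
    and g: "\<And>s. 0 \<le> g s" "integrable (lebesgue_on {a..t}) (\<lambda>s. \<mu> (g s))"
  shows "norm (\<Phi> w t) \<le> k * \<theta> (\<integral>s. \<mu> (g s) \<partial>lebesgue_on {a..t})"
proof -
  have gen: "norm (\<Phi> w' t) \<le> \<theta> (\<integral>s. \<mu> (g s) \<partial>lebesgue_on {a..t})"
    if w': "w' \<in> Linf {0..b}" and zero': "\<And>s. 0 \<le> s \<Longrightarrow> s \<le> a \<Longrightarrow> w' s = 0"
      and le': "\<And>s. a < s \<Longrightarrow> s \<le> t \<Longrightarrow> norm (w' s) \<le> g s" for w'
  proof -
    have "w' \<in> Linf {0..t}" by (rule Linf_subset[OF _ _ _ w']) (use a in auto)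
    from integrable_class_K_norm[OF \<mu> this, of 1]
    have i0: "integrable (lebesgue_on {0..t}) (\<lambda>s. \<mu> (norm (w' s)))" by simp
    have i: "integrable (lebesgue_on {0..a}) (\<lambda>s. \<mu> (norm (w' s)))" "integrable (lebesgue_on {a..t}) (\<lambda>s. \<mu> (norm (w' s)))"
      by (rule integrable_subinterval_lebesgue_on[OF i0]; use a in simp)+
    have "(\<integral>s. \<mu> (norm (w' s)) \<partial>lebesgue_on {0..a}) = (\<integral>s. 0 \<partial>lebesgue_on {0..a})"
      by (intro Bochner_Integration.integral_cong) (auto simp: zero' class_K_zero[OF \<mu>])
    then have eq: "(\<integral>s. \<mu> (norm (w' s)) \<partial>lebesgue_on {0..t}) = (\<integral>s. \<mu> (norm (w' s)) \<partial>lebesgue_on {a..t})"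
      using integral_split_lebesgue_on[OF i0 a(1,2)] by simp
    have "(\<integral>s. \<mu> (norm (w' s)) \<partial>lebesgue_on {a..t}) \<le> (\<integral>s. \<mu> (g s) \<partial>lebesgue_on {a..t})"
    proof (rule integral_mono[OF i(2) g(2)])
      fix s assume "s \<in> space (lebesgue_on {a..t})"
      then have s: "a \<le> s" "s \<le> t" by auto
      show "\<mu> (norm (w' s)) \<le> \<mu> (g s)"
      proof (cases "s = a")
        case True then show ?thesis using zero'[of s] a class_K_nonneg[OF \<mu> g(1)] class_K_zero[OF \<mu>] by simp
      next
        case False then show ?thesis using le'[of s] s by (intro class_K_mono[OF \<mu>]) auto
      qed
    qed
    moreover have "0 \<le> (\<integral>s. \<mu> (norm (w' s)) \<partial>lebesgue_on {a..t})"
      by (intro Bochner_Integration.integral_nonneg class_K_nonneg[OF \<mu>]) simp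
    ultimately show ?thesis
      using bound[OF w', of t] a class_K_mono[OF \<theta>_K] unfolding eq by (meson order_trans)
  qed
  show ?thesis
  proof (cases "k = 0")
    \<comment> \<open>Division by \<open>k\<close> is impossible here, but then \<open>w\<close>
      vanishes on \<open>{0..t}\<close>, so causality and homogeneity give a zero response.\<close>
    case True
    have "\<Phi> w t = \<Phi> (\<lambda>s. 0 *\<^sub>R w s) t"
    proof (rule cong)
      fix s assume "s \<in> {0..t}"
      then show "w s = 0 *\<^sub>R w s" using zero[of s] le[of s] True by (cases "s \<le> a") auto
    qed
    then show ?thesis using scaleR[OF w, of t 0] a True by simp
  next
    case False
    then have k: "k > 0" using k by simp
    have l: "(\<lambda>s. (1 / k) *\<^sub>R w s) \<in> Linf {0..b}" by (rule Linf_scaleR[OF _ w]) simp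
    have "norm (\<Phi> (\<lambda>s. (1 / k) *\<^sub>R w s) t) \<le> \<theta> (\<integral>s. \<mu> (g s) \<partial>lebesgue_on {a..t})"
      by (rule gen[OF l]) (use zero le k in \<open>auto simp: field_simps\<close>)
    moreover have "\<Phi> (\<lambda>s. (1 / k) *\<^sub>R w s) t = (1 / k) *\<^sub>R \<Phi> w t" by (rule scaleR[OF w]) (use a in auto)
    ultimately show ?thesis using k by (simp add: field_simps)
  qed
qed

end

text \<open>\<open>M\<close> and \<open>\<tau>\<close> encode exponential stability of the semigroup
  in the only form used: a uniform bound, and contraction by 1/4 after one period
  \<open>\<tau>\<close>.\<close>

locale bilinear_system =
  in1: input_map T \<Phi>1 \<theta>1 \<mu>1 + in2: input_map T \<Phi>2 \<theta>2 \<mu>2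
  for T :: "real \<Rightarrow> 'x::banach \<Rightarrow>\<^sub>L 'x"
    and \<Phi>1 :: "(real \<Rightarrow> 'xb::banach) \<Rightarrow> real \<Rightarrow> 'x" and \<theta>1 \<mu>1
    and \<Phi>2 :: "(real \<Rightarrow> 'u2::banach) \<Rightarrow> real \<Rightarrow> 'x" and \<theta>2 \<mu>2 +
  fixes F :: "'x \<Rightarrow> 'u1::banach \<Rightarrow> 'xb" and m M \<tau> :: real
  assumes T_0: "T 0 = id_blinfun"
    and T_add: "\<And>s t x. s \<ge> 0 \<Longrightarrow> t \<ge> 0 \<Longrightarrow> T (s + t) x = T s (T t x)"
    and T_cont: "\<And>x. continuous_on {0..} (\<lambda>t. T t x)"
    and M: "M \<ge> 1" "\<And>t x. t \<ge> 0 \<Longrightarrow> norm (T t x) \<le> M * norm x"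
    and \<tau>: "\<tau> > 0" "\<And>x. norm (T \<tau> x) \<le> norm x / 4"
    and m: "m > 0"
    and F1: "\<And>x u. norm (F x u) \<le> m * norm x * norm u"
    and F2: "\<And>Xb. bounded Xb \<Longrightarrow>
               (\<exists>L>0. \<forall>x\<in>Xb. \<forall>x'\<in>Xb. \<forall>u. norm (F x u - F x' u) \<le> L * norm u * norm (x - x'))"
    and F3: "\<And>I f g. is_interval I \<Longrightarrow> strongly_measurable (lebesgue_on I) f \<Longrightarrow>
               strongly_measurable (lebesgue_on I) g \<Longrightarrow>
               strongly_measurable (lebesgue_on I) (\<lambda>s::real. F (f s) (g s))"
begin

definition rhs :: "'x \<Rightarrow> (real \<Rightarrow> 'u1) \<Rightarrow> (real \<Rightarrow> 'u2) \<Rightarrow> (real \<Rightarrow> 'x) \<Rightarrow> real \<Rightarrow> 'x" where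
  "rhs x0 u1 u2 x t = T t x0 + \<Phi>1 (\<lambda>s. F (x s) (u1 s)) t + \<Phi>2 u2 t"

definition solves :: "'x \<Rightarrow> (real \<Rightarrow> 'u1) \<Rightarrow> (real \<Rightarrow> 'u2) \<Rightarrow> real \<Rightarrow> (real \<Rightarrow> 'x) \<Rightarrow> bool" where
  "solves x0 u1 u2 b x \<longleftrightarrow> continuous_on {0..b} x \<and> (\<forall>t\<in>{0..b}. x t = rhs x0 u1 u2 x t)"

lemma F_Linf:
  assumes x: "continuous_on {0..b} x" and u: "u1 \<in> Linf {0..b}"
  shows "(\<lambda>s. F (x s) (u1 s)) \<in> Linf {0..b}"
proof -
  obtain R where R: "R > 0" "\<And>s. s \<in> {0..b} \<Longrightarrow> norm (x s) \<le> R"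
    by (rule continuous_norm_bounded[OF x]) blast
  obtain C where C: "AE s in lebesgue_on {0..b}. norm (u1 s) \<le> C"
    by (rule Linf_bounded[OF _ u]) auto
  have "AE s in lebesgue_on {0..b}. norm (F (x s) (u1 s)) \<le> m * R * C"
    using C AE_space
  proof eventually_elim
    case (elim s)
    have "norm (F (x s) (u1 s)) \<le> m * norm (x s) * norm (u1 s)" by (rule F1)
    also have "\<dots> \<le> m * R * C" using R elim m by (intro mult_mono) auto
    finally show ?case .
  qed
  moreover have "strongly_measurable (lebesgue_on {0..b}) (\<lambda>s. F (x s) (u1 s))"
    using u by (intro F3[OF is_interval_cc strongly_measurable_continuous[OF x]]) (simp add: Linf_def)
  ultimately show ?thesis by (subst Linf_iff) auto
qed

text \<open>The additive cost of the first input. By (F1), \<open>norm (F x u)\<close> is at most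
  \<open>norm x * (m * norm u)\<close>; with \<open>m\<close> inside \<open>\<mu>1\<close>, the
  factor left for \<open>bound_local\<close> is exactly a bound on the state.\<close>

definition E :: "(real \<Rightarrow> 'u1) \<Rightarrow> real \<Rightarrow> real \<Rightarrow> real" where
  "E u a t = (\<integral>s. \<mu>1 (m * norm (u s)) \<partial>lebesgue_on {a..t})"

text \<open>Bounds the response to the part of the second input on \<open>{a..t}\<close>. Unlike
  \<open>E\<close> it is not additive, only monotone in the interval.\<close>

definition P :: "(real \<Rightarrow> 'u2) \<Rightarrow> real \<Rightarrow> real \<Rightarrow> real" where
  "P u a t = \<theta>2 (\<integral>s. \<mu>2 (norm (u s)) \<partial>lebesgue_on {a..t})"

lemma E_integrable:
  assumes "u1 \<in> Linf {0..b}" "0 \<le> a" "t \<le> b"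
  shows "integrable (lebesgue_on {a..t}) (\<lambda>s. \<mu>1 (m * norm (u1 s)))"
  using m assms(2,3) by (intro integrable_class_K_norm[OF in1.\<mu>] Linf_subset[OF _ _ _ assms(1)]) auto

lemma P_integrable:
  assumes "u2 \<in> Linf {0..b}" "0 \<le> a" "t \<le> b"
  shows "integrable (lebesgue_on {a..t}) (\<lambda>s. \<mu>2 (norm (u2 s)))"
proof -
  have "u2 \<in> Linf {a..t}" using assms(2,3) by (intro Linf_subset[OF _ _ _ assms(1)]) auto
  from integrable_class_K_norm[OF in2.\<mu> this, of 1] show ?thesis by simp
qed

lemma E_nonneg: "0 \<le> E u1 a t"
  unfolding E_def using m by (intro Bochner_Integration.integral_nonneg class_K_nonneg[OF in1.\<mu>]) simp

lemma E_split:
  "u1 \<in> Linf {0..b} \<Longrightarrow> 0 \<le> a \<Longrightarrow> a \<le> c \<Longrightarrow> c \<le> t \<Longrightarrow> t \<le> b \<Longrightarrow> E u1 a t = E u1 a c + E u1 c t"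
  unfolding E_def by (intro integral_split_lebesgue_on E_integrable) auto

lemma E_cont: "u1 \<in> Linf {0..b} \<Longrightarrow> 0 \<le> a \<Longrightarrow> c \<le> b \<Longrightarrow> continuous_on {a..c} (E u1 a)"
  unfolding E_def by (intro continuous_indefinite_lebesgue_on E_integrable) auto

lemma P_mono:
  assumes u2: "u2 \<in> Linf {0..b}" and "0 \<le> a" "a \<le> a'" "a' \<le> t'" "t' \<le> t" "t \<le> b"
  shows "P u2 a' t' \<le> P u2 a t"
proof -
  let ?I = "\<lambda>a t. \<integral>s. \<mu>2 (norm (u2 s)) \<partial>lebesgue_on {a..t}"
  have nn: "0 \<le> ?I a t" for a t
    by (intro Bochner_Integration.integral_nonneg class_K_nonneg[OF in2.\<mu>]) simp
  have "?I a t = ?I a a' + ?I a' t"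
    using assms by (intro integral_split_lebesgue_on P_integrable) auto
  moreover have "?I a' t = ?I a' t' + ?I t' t"
    using assms by (intro integral_split_lebesgue_on P_integrable) auto
  ultimately have "?I a' t' \<le> ?I a t" using nn[of a a'] nn[of t' t] by simp
  then show ?thesis unfolding P_def by (rule class_K_mono[OF in2.\<theta>_K nn])
qed

lemma P_nonneg: "0 \<le> P u2 a t"
  unfolding P_def
  by (intro class_K_nonneg[OF in2.\<theta>_K] Bochner_Integration.integral_nonneg class_K_nonneg[OF in2.\<mu>]) simp

lemma rhs_cong: "(\<And>s. s \<in> {0..t} \<Longrightarrow> x s = y s) \<Longrightarrow> rhs x0 u1 u2 x t = rhs x0 u1 u2 y t"
  unfolding rhs_def by (intro arg_cong2[of _ _ _ _ "(+)"] refl in1.cong) simp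

context
  fixes x0 :: 'x and u1 :: "real \<Rightarrow> 'u1" and u2 :: "real \<Rightarrow> 'u2"
    and b :: real and x :: "real \<Rightarrow> 'x"
  assumes u1: "u1 \<in> Linf {0..b}" and u2: "u2 \<in> Linf {0..b}" and x: "continuous_on {0..b} x"
begin

lemma rhs_cont: "continuous_on {0..b} (rhs x0 u1 u2 x)"
  unfolding rhs_def
  by (intro continuous_on_add in1.cont in2.cont F_Linf x u1 u2 continuous_on_subset[OF T_cont]) auto

lemma rhs_0: "0 \<le> b \<Longrightarrow> rhs x0 u1 u2 x 0 = x0"
  unfolding rhs_def by (simp add: in1.at_0[OF F_Linf[OF x u1]] in2.at_0[OF u2] T_0)

lemma rhs_restart:
  assumes a: "0 \<le> a" "a \<le> t" "t \<le> b"
  shows "rhs x0 u1 u2 x t = T (t - a) (rhs x0 u1 u2 x a)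
      + \<Phi>1 (\<lambda>s. indicator {a<..} s *\<^sub>R F (x s) (u1 s)) t + \<Phi>2 (\<lambda>s. indicator {a<..} s *\<^sub>R u2 s) t"
proof -
  have "T t x0 = T (t - a) (T a x0)" using T_add[of "t - a" a x0] a by simp
  then show ?thesis
    unfolding rhs_def in1.split[OF F_Linf[OF x u1] a] in2.split[OF u2 a]
    by (simp add: blinfun.add_right)
qed

text \<open>Restarts at \<open>a\<close> and applies \<open>bound_local\<close> with
  \<open>k = S\<close> to the bilinear term and \<open>k = 1\<close> to the second input. It is
  stated for any continuous \<open>x\<close>, not only solutions, because the fixed point map must
  be shown to preserve a ball.\<close>

lemma rhs_estimate:
  assumes a: "0 \<le> a" "a \<le> t" "t \<le> b" and S: "\<And>s. a \<le> s \<Longrightarrow> s \<le> t \<Longrightarrow> norm (x s) \<le> S"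
  shows "norm (rhs x0 u1 u2 x t) \<le> norm (T (t - a) (rhs x0 u1 u2 x a)) + S * \<theta>1 (E u1 a t) + P u2 a t"
proof -
  have S0: "0 \<le> S" using S[of a] a by (meson norm_ge_zero order_refl order_trans)
  have 1: "norm (\<Phi>1 (\<lambda>s. indicator {a<..} s *\<^sub>R F (x s) (u1 s)) t) \<le> S * \<theta>1 (E u1 a t)"
    unfolding E_def
  proof (rule in1.bound_local[OF Linf_indicator[OF _ _ F_Linf[OF x u1]] a S0])
    fix s assume s: "a < s" "s \<le> t"
    have "norm (F (x s) (u1 s)) \<le> m * norm (x s) * norm (u1 s)" by (rule F1)
    also have "\<dots> \<le> m * S * norm (u1 s)" using m S[of s] s by (intro mult_right_mono mult_left_mono) auto
    finally show "norm (indicator {a<..} s *\<^sub>R F (x s) (u1 s)) \<le> S * (m * norm (u1 s))"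
      using s by (simp add: mult_ac)
  qed (use m E_integrable[OF u1 a(1,3)] in auto)
  have 2: "norm (\<Phi>2 (\<lambda>s. indicator {a<..} s *\<^sub>R u2 s) t) \<le> 1 * P u2 a t"
    unfolding P_def
    by (rule in2.bound_local[OF Linf_indicator[OF _ _ u2] a])
      (use P_integrable[OF u2 a(1,3)] in \<open>auto simp: indicator_def\<close>)
  show ?thesis
    unfolding rhs_restart[OF a]
    by (intro order_trans[OF norm_triangle_ineq] add_mono order_refl 1) (use 2 in simp)
qed

end

context
  fixes x0 :: 'x and u1 :: "real \<Rightarrow> 'u1" and u2 :: "real \<Rightarrow> 'u2"
    and b :: real and x :: "real \<Rightarrow> 'x"
  assumes u1: "u1 \<in> Linf {0..b}" and u2: "u2 \<in> Linf {0..b}" and sol: "solves x0 u1 u2 b x"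
begin

lemma x_cont: "continuous_on {0..b} x" using sol by (simp add: solves_def)

lemma step_estimate:
  assumes a: "0 \<le> a" "a \<le> t" "t \<le> b" and S: "\<And>s. a \<le> s \<Longrightarrow> s \<le> t \<Longrightarrow> norm (x s) \<le> S"
  shows "norm (x t) \<le> norm (T (t - a) (x a)) + S * \<theta>1 (E u1 a t) + P u2 a t"
proof -
  have "x t = rhs x0 u1 u2 x t" "x a = rhs x0 u1 u2 x a" using sol a by (auto simp: solves_def)
  then show ?thesis using rhs_estimate[OF u1 u2 x_cont a S, of x0] by simp
qed

text \<open>At a maximum point \<open>r\<close> of the norm, the bilinear term is at most
  \<open>norm (x r) / 2\<close> and is absorbed into the left-hand side; this doubles the other
  terms.\<close>

lemma small_input_bound:
  assumes a: "0 \<le> a" "a \<le> c" "c \<le> b" and small: "\<theta>1 (E u1 a c) \<le> 1/2" and G: "P u2 a c \<le> G"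
    and t: "a \<le> t" "t \<le> c"
  shows "norm (x t) \<le> 2 * M * norm (x a) + 2 * G"
proof -
  have "continuous_on {a..c} (\<lambda>t. norm (x t))"
    using a by (intro continuous_on_norm continuous_on_subset[OF x_cont]) auto
  from continuous_attains_sup[OF _ _ this] a obtain r where r: "a \<le> r" "r \<le> c"
    and max: "\<And>s. a \<le> s \<Longrightarrow> s \<le> c \<Longrightarrow> norm (x s) \<le> norm (x r)" by auto
  have "E u1 a r \<le> E u1 a c" using E_split[OF u1, of a r c] E_nonneg[of u1 r c] a r by simp
  then have \<theta>: "\<theta>1 (E u1 a r) \<le> 1/2"
    using class_K_mono[OF in1.\<theta>_K E_nonneg] small by (meson order_trans)
  have "norm (x r) \<le> norm (T (r - a) (x a)) + norm (x r) * \<theta>1 (E u1 a r) + P u2 a r"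
    using a r by (intro step_estimate max) auto
  also have "\<dots> \<le> M * norm (x a) + norm (x r) * (1/2) + G"
    using \<theta> a r M(2)[of "r - a" "x a"] P_mono[OF u2, of a a r c] G by (intro add_mono mult_left_mono) auto
  finally show ?thesis using max[OF t] by simp
qed

text \<open>Induction on the number of pieces. \<open>E u1 a\<close> is continuous, so a first piece
  can be cut off at a point \<open>d\<close> where it equals \<open>\<delta>\<close> exactly. Each
  piece reuses the same \<open>G\<close> by monotonicity of \<open>P\<close>, and the sum
  \<open>norm (x a) + G\<close> is what grows by a constant factor.\<close>

lemma growth_bound:
  assumes \<delta>: "\<delta> > 0" "\<theta>1 \<delta> \<le> 1/2"
  shows "0 \<le> a \<Longrightarrow> a \<le> c \<Longrightarrow> c \<le> b \<Longrightarrow> E u1 a c \<le> (real n + 1) * \<delta> \<Longrightarrow> P u2 a c \<le> G \<Longrightarrow>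
    a \<le> t \<Longrightarrow> t \<le> c \<Longrightarrow> norm (x t) \<le> (2 * M + 1) ^ (n + 1) * (norm (x a) + G)"
proof (induction n arbitrary: a t)
  have base: "norm (x t) \<le> (2 * M + 1) * (norm (x a) + G)" (is ?A) "norm (x t) \<le> 2 * M * norm (x a) + 2 * G" (is ?B)
    if "0 \<le> a" "a \<le> c" "c \<le> b" "E u1 a c \<le> \<delta>" "P u2 a c \<le> G" "a \<le> t" "t \<le> c" for a t c
  proof -
    have "\<theta>1 (E u1 a c) \<le> 1/2" using class_K_mono[OF in1.\<theta>_K E_nonneg that(4)] \<delta> by simp
    then show ?B using that small_input_bound by blast
    moreover have "0 \<le> G" using that(5) P_nonneg[of u2 a c] by linarith
    then have "2 * G \<le> (2 * M + 1) * G" using M(1) by (intro mult_right_mono) auto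
    ultimately show ?A by (simp add: algebra_simps) (smt (verit) norm_ge_zero)
  qed
  {
    case 0
    then show ?case using base(1)[of a c t] by simp
  next
    case (Suc n)
    have G0: "0 \<le> G" using Suc.prems(5) P_nonneg[of u2 a c] by linarith
    have K1: "2 * M + 1 \<ge> 1" using M(1) by simp
    have one: "norm (x t) \<le> (2 * M + 1) ^ (Suc n + 1) * (norm (x a) + G)"
      if "norm (x t) \<le> (2 * M + 1) * (norm (x a) + G)" for t
    proof -
      have "(2 * M + 1) ^ 1 \<le> (2 * M + 1) ^ (Suc n + 1)" using K1 by (intro power_increasing) auto
      then have "(2 * M + 1) * (norm (x a) + G) \<le> (2 * M + 1) ^ (Suc n + 1) * (norm (x a) + G)"
        using G0 by (intro mult_right_mono) auto
      with that show ?thesis by linarith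
    qed
    show ?case
    proof (cases "E u1 a c \<le> \<delta>")
      case True
      then show ?thesis using Suc.prems base(1)[of a c t] by (intro one) auto
    next
      case False
      have "E u1 a a = 0" using E_split[OF u1, of a a a] Suc.prems by simp
      then obtain d where d: "a \<le> d" "d \<le> c" "E u1 a d = \<delta>"
        using IVT'[of "E u1 a" a \<delta> c] E_cont[OF u1, of a c] Suc.prems \<delta> False by auto
      have P1: "P u2 a d \<le> G" using P_mono[OF u2, of a a d c] Suc.prems d by simp
      show ?thesis
      proof (cases "t \<le> d")
        case True
        then show ?thesis using Suc.prems d P1 by (intro one base(1)[of a d t]) auto
      next
        case False
        have P2: "P u2 d c \<le> G" using P_mono[OF u2, of a d c c] Suc.prems d by simp
        have "E u1 d c \<le> (real n + 1) * \<delta>"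
          using E_split[OF u1, of a d c] Suc.prems d by (simp add: algebra_simps)
        then have "norm (x t) \<le> (2 * M + 1) ^ (n + 1) * (norm (x d) + G)"
          using Suc.prems d False P2 by (intro Suc.IH) auto
        also have "\<dots> \<le> (2 * M + 1) ^ (n + 1) * ((2 * M + 1) * (norm (x a) + G))"
        proof (rule mult_left_mono)
          have "norm (x d) \<le> 2 * M * norm (x a) + 2 * G"
            using Suc.prems d P1 by (intro base(2)[of a d d]) auto
          \<comment> \<open>Two copies of \<open>G\<close> come from the estimate on the piece and
            one is carried along; \<open>M \<ge> 1\<close> lets the factor \<open>2 * M + 1\<close>
            cover all three.\<close>
          moreover have "3 * G \<le> (2 * M + 1) * G" using M(1) G0 by (intro mult_right_mono) auto
          moreover have "(2 * M + 1) * (norm (x a) + G) = 2 * M * norm (x a) + norm (x a) + (2 * M + 1) * G"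
            by (simp add: algebra_simps)
          ultimately show "norm (x d) + G \<le> (2 * M + 1) * (norm (x a) + G)"
            using norm_ge_zero[of "x a"] by linarith
        qed (use K1 in simp)
        finally show ?thesis by (simp add: mult_ac)
      qed
    qed
  }
qed

end

end

section \<open>Decay over periods, up to an exponential of the input\<close>

lemma class_K_small:
  assumes "\<mu> \<in> class_K" "e > 0"
  shows "\<exists>d>0. \<mu> d \<le> e"
proof -
  have "continuous (at 0 within {0..}) \<mu>" "\<mu> 0 = 0"
    using assms(1) by (auto simp: class_K_def continuous_on_eq_continuous_within)
  then obtain d where d: "d > 0" "\<And>s. s \<in> {0..} \<Longrightarrow> dist s 0 < d \<Longrightarrow> dist (\<mu> s) 0 < e"
    unfolding continuous_within_eps_delta using assms(2) by metis
  have "\<mu> (d / 2) \<le> e" using d(2)[of "d / 2"] d(1) by simp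
  then show ?thesis using d(1) by (intro exI[of _ "d / 2"]) simp
qed

context bilinear_system
begin

abbreviation "K \<equiv> 2 * M + 1"

text \<open>On a period that costs at most \<open>\<delta>\<close> the state stays below
  \<open>2 * M * norm (x a)\<close> plus a multiple of \<open>G\<close>, so the threshold
  \<open>1 / (8 * M)\<close> gives a bilinear term of \<open>norm (x a) / 4\<close>; with the 1/4
  from \<open>T \<tau>\<close> the state is halved.\<close>

definition \<delta> :: real where
  "\<delta> = (SOME d. d > 0 \<and> \<theta>1 d \<le> 1 / (8 * M))"

lemma \<delta>: "\<delta> > 0" "\<theta>1 \<delta> \<le> 1 / (8 * M)"
proof -
  have "\<exists>d. d > 0 \<and> \<theta>1 d \<le> 1 / (8 * M)"
    using class_K_small[OF in1.\<theta>_K, of "1 / (8 * M)"] M(1) by auto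
  from someI_ex[OF this] show "\<delta> > 0" "\<theta>1 \<delta> \<le> 1 / (8 * M)" by (auto simp: \<delta>_def)
qed

lemma \<delta>_half: "\<theta>1 \<delta> \<le> 1 / 2"
proof -
  have "1 / (8 * M) \<le> 1 / 2" using M(1) by (simp add: field_simps)
  then show ?thesis using \<delta>(2) by linarith
qed

text \<open>One \<open>ln K\<close> per \<open>\<delta>\<close> pays for the pieces. The second
  \<open>ln K\<close> and the \<open>ln 2\<close> are a reserve for
  \<open>K_power_le_half\<close>.\<close>

definition \<kappa> :: real where "\<kappa> = (2 * ln K + ln 2) / \<delta>"

lemma lnK: "ln K > 0" using M(1) by simp

lemma \<kappa>_pos: "\<kappa> > 0"
  unfolding \<kappa>_def using \<delta>(1) lnK by (intro divide_pos_pos add_pos_pos mult_pos_pos) auto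

lemma K_power_le:
  assumes "real n * \<delta> \<le> e"
  shows "K ^ n \<le> exp (\<kappa> * e)"
proof -
  have "K ^ n = exp (real n * ln K)" using M(1) by (simp add: exp_of_nat_mult)
  also have "\<dots> \<le> exp (\<kappa> * e)"
  proof -
    have "real n * ln K \<le> (e / \<delta>) * (2 * ln K + ln 2)"
    proof (rule mult_mono)
      have "0 \<le> e" by (rule order_trans[OF _ assms]) (use \<delta>(1) in simp)
      then show "real n \<le> e / \<delta>" "0 \<le> e / \<delta>" using assms \<delta>(1) by (simp_all add: field_simps)
    qed (use lnK in auto)
    then show ?thesis by (simp add: \<kappa>_def mult.commute)
  qed
  finally show ?thesis .
qed

text \<open>For an expensive period the semigroup cannot guarantee decay, so the factor 1/2 is
  bought from the exponential. As \<open>1 \<le> e / \<delta>\<close>, the reserve in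
  \<open>\<kappa>\<close> covers it together with the extra factor \<open>K\<close>.\<close>

lemma K_power_le_half:
  assumes "real n * \<delta> \<le> e" "e \<ge> \<delta>"
  shows "K ^ (n + 1) \<le> exp (\<kappa> * e) / 2"
proof -
  have 1: "1 \<le> e / \<delta>" "real n \<le> e / \<delta>" using assms \<delta>(1) by (simp_all add: field_simps)
  have "2 * K ^ (n + 1) = exp (ln 2 + real (n + 1) * ln K)"
    using M(1) by (subst exp_add, subst exp_of_nat_mult) simp
  also have "\<dots> \<le> exp (\<kappa> * e)"
  proof -
    have "1 * ln 2 \<le> (e / \<delta>) * ln (2::real)" using 1 by (intro mult_right_mono) auto
    moreover have "real (n + 1) * ln K \<le> (2 * (e / \<delta>)) * ln K"
      using 1 lnK by (intro mult_right_mono) auto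
    ultimately have "ln 2 + real (n + 1) * ln K \<le> (e / \<delta>) * (2 * ln K + ln 2)"
      by (simp add: algebra_simps)
    then show ?thesis by (simp add: \<kappa>_def mult.commute)
  qed
  finally show ?thesis by simp
qed

text \<open>\<open>growth_bound\<close> with index \<open>n\<close> admits cost up to
  \<open>(n + 1) * \<delta>\<close> and yields \<open>n + 1\<close> factors \<open>K\<close>, while
  the exponential pays directly for \<open>n\<close>; the remaining \<open>K\<close> is kept in
  \<open>within_period\<close> and charged to the reserve in \<open>after_period\<close>.\<close>

lemma floor_pieces:
  assumes "0 \<le> e"
  shows "real (nat \<lfloor>e / \<delta>\<rfloor>) * \<delta> \<le> e" "e \<le> (real (nat \<lfloor>e / \<delta>\<rfloor>) + 1) * \<delta>"
proof -
  have "0 \<le> e / \<delta>" using assms \<delta>(1) by simp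
  then have "real (nat \<lfloor>e / \<delta>\<rfloor>) \<le> e / \<delta>" "e / \<delta> \<le> real (nat \<lfloor>e / \<delta>\<rfloor>) + 1" by linarith+
  then show "real (nat \<lfloor>e / \<delta>\<rfloor>) * \<delta> \<le> e" "e \<le> (real (nat \<lfloor>e / \<delta>\<rfloor>) + 1) * \<delta>"
    using \<delta>(1) by (simp_all add: field_simps)
qed

context
  fixes x0 :: 'x and u1 :: "real \<Rightarrow> 'u1" and u2 :: "real \<Rightarrow> 'u2"
    and b :: real and x :: "real \<Rightarrow> 'x"
  assumes u1: "u1 \<in> Linf {0..b}" and u2: "u2 \<in> Linf {0..b}" and sol: "solves x0 u1 u2 b x"
begin

text \<open>A bound without decay, meant for the incomplete period at the end of a time
  interval.\<close>

lemma within_period: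
  assumes a: "0 \<le> a" "a \<le> t" "t \<le> b" and G: "P u2 a t \<le> G"
  shows "norm (x t) \<le> K * exp (\<kappa> * E u1 a t) * (norm (x a) + G)"
proof -
  note ctx = u1 u2 sol
  let ?n = "nat \<lfloor>E u1 a t / \<delta>\<rfloor>"
  have G0: "0 \<le> G" using P_nonneg G by (meson order_trans)
  have "norm (x t) \<le> K ^ (?n + 1) * (norm (x a) + G)"
    by (rule growth_bound[OF ctx \<delta>(1) \<delta>_half, of a t])
      (use a G floor_pieces(2)[OF E_nonneg] in auto)
  also have "\<dots> = K * K ^ ?n * (norm (x a) + G)" by simp
  also have "\<dots> \<le> K * exp (\<kappa> * E u1 a t) * (norm (x a) + G)"
    using M(1) G0 K_power_le[OF floor_pieces(1)[OF E_nonneg]]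
    by (intro mult_right_mono mult_left_mono) auto
  finally show ?thesis .
qed

text \<open>If the period is cheap, the semigroup halves the state and the input terms add at most
  \<open>G / (4 * M) + G\<close>, hence \<open>2 * G\<close>. If it is expensive, the halving is
  taken out of the exponential.\<close>

lemma after_period:
  assumes a: "0 \<le> a" "a + \<tau> \<le> b" and G: "P u2 a (a + \<tau>) \<le> G"
  shows "norm (x (a + \<tau>)) \<le> exp (\<kappa> * E u1 a (a + \<tau>)) * (norm (x a) / 2 + 2 * G)"
proof -
  note ctx = u1 u2 sol
  let ?e = "E u1 a (a + \<tau>)"
  have e0: "0 \<le> ?e" by (rule E_nonneg)
  have G0: "0 \<le> G" using P_nonneg G by (meson order_trans)
  show ?thesis
  proof (cases "?e \<le> \<delta>")
    case True
    have th: "\<theta>1 ?e \<le> 1 / (8 * M)" using class_K_mono[OF in1.\<theta>_K e0 True] \<delta>(2) by linarith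
    have th2: "\<theta>1 ?e \<le> 1 / 2" using class_K_mono[OF in1.\<theta>_K e0 True] \<delta>_half by linarith
    let ?S = "2 * M * norm (x a) + 2 * G"
    have "norm (x (a + \<tau>)) \<le> norm (T (a + \<tau> - a) (x a)) + ?S * \<theta>1 ?e + P u2 a (a + \<tau>)"
      using a \<tau>(1) th2 G by (intro step_estimate[OF ctx] small_input_bound[OF ctx, of a "a + \<tau>"]) auto
    also have "\<dots> \<le> norm (x a) / 4 + ?S * (1 / (8 * M)) + G"
      using th G0 M(1) \<tau>(2)[of "x a"] G by (intro add_mono mult_left_mono) auto
    also have "\<dots> = norm (x a) / 2 + G / (4 * M) + G" using M(1) by (simp add: field_simps)
    also have "\<dots> \<le> norm (x a) / 2 + 2 * G"
    proof -
      have "G / (4 * M) \<le> G / 1" using M(1) G0 by (intro divide_left_mono) auto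
      then show ?thesis by simp
    qed
    also have "\<dots> \<le> exp (\<kappa> * ?e) * (norm (x a) / 2 + 2 * G)"
    proof -
      have "1 \<le> exp (\<kappa> * ?e)" using \<kappa>_pos e0 by simp
      from mult_right_mono[OF this, of "norm (x a) / 2 + 2 * G"] G0 show ?thesis by simp
    qed
    finally show ?thesis .
  next
    case False
    let ?n = "nat \<lfloor>?e / \<delta>\<rfloor>"
    have "norm (x (a + \<tau>)) \<le> K ^ (?n + 1) * (norm (x a) + G)"
      by (rule growth_bound[OF ctx \<delta>(1) \<delta>_half, of a "a + \<tau>"])
        (use a \<tau>(1) G floor_pieces(2)[OF e0] in auto)
    also have "\<dots> \<le> exp (\<kappa> * ?e) / 2 * (norm (x a) + G)"
      using G0 K_power_le_half[OF floor_pieces(1)[OF e0]] False by (intro mult_right_mono) auto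
    also have "\<dots> = exp (\<kappa> * ?e) * (norm (x a) / 2 + G / 2)" by (simp add: field_simps)
    also have "\<dots> \<le> exp (\<kappa> * ?e) * (norm (x a) / 2 + 2 * G)" using G0 by (intro mult_left_mono) auto
    finally show ?thesis .
  qed
qed

text \<open>The constant \<open>4 * G\<close> is the fixed point of the recursion
  \<open>g / 2 + 2 * G\<close>, and the exponentials multiply because \<open>E\<close> is additive.
  Since \<open>G\<close> is tested only on windows of length at most \<open>\<tau>\<close>, it need
  not grow with time.\<close>

lemma iterated_bound:
  assumes G: "\<And>a t. 0 \<le> a \<Longrightarrow> a \<le> t \<Longrightarrow> t \<le> b \<Longrightarrow> t \<le> a + \<tau> \<Longrightarrow> P u2 a t \<le> G"
    and b: "0 \<le> b"
  shows "real k * \<tau> \<le> b \<Longrightarrow> norm (x (real k * \<tau>)) \<le> exp (\<kappa> * E u1 0 (real k * \<tau>)) * ((1/2)^k * norm x0 + 4 * G)"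
proof (induction k)
  note ctx = u1 u2 sol
  have G0: "0 \<le> G" using P_nonneg G[of 0 0] \<tau>(1) b by (meson order_refl add_nonneg_nonneg less_imp_le order_trans)
  {
    case 0
    have "x 0 = x0"
      using sol b rhs_0[OF u1 u2 x_cont[OF ctx]] by (simp add: solves_def)
    moreover have "norm x0 \<le> exp (\<kappa> * E u1 0 0) * (norm x0 + 4 * G)"
    proof -
      have "1 \<le> exp (\<kappa> * E u1 0 0)" using \<kappa>_pos E_nonneg by simp
      from mult_right_mono[OF this, of "norm x0 + 4 * G"] G0 show ?thesis by simp
    qed
    ultimately show ?case by simp
  next
    case (Suc k)
    let ?a = "real k * \<tau>"
    have a: "0 \<le> ?a" "?a + \<tau> \<le> b" "?a \<le> b" "real (Suc k) * \<tau> = ?a + \<tau>" using Suc.prems \<tau>(1) by (auto simp: algebra_simps)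
    have "norm (x (?a + \<tau>)) \<le> exp (\<kappa> * E u1 ?a (?a + \<tau>)) * (norm (x ?a) / 2 + 2 * G)"
      using a \<tau>(1) by (intro after_period G) auto
    also have "\<dots> \<le> exp (\<kappa> * E u1 ?a (?a + \<tau>)) * (exp (\<kappa> * E u1 0 ?a) * ((1/2)^Suc k * norm x0 + 4 * G))"
    proof (rule mult_left_mono)
      have "1 \<le> exp (\<kappa> * E u1 0 ?a)" using \<kappa>_pos E_nonneg by simp
      from mult_right_mono[OF this, of "2 * G"] G0 have "2 * G \<le> exp (\<kappa> * E u1 0 ?a) * (2 * G)" by simp
      moreover have "norm (x ?a) \<le> exp (\<kappa> * E u1 0 ?a) * ((1/2)^k * norm x0 + 4 * G)"
        by (rule Suc.IH[OF a(3)])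
      ultimately show "norm (x ?a) / 2 + 2 * G \<le> exp (\<kappa> * E u1 0 ?a) * ((1/2)^Suc k * norm x0 + 4 * G)"
        by (simp add: algebra_simps)
    qed simp
    also have "\<dots> = exp (\<kappa> * E u1 0 (?a + \<tau>)) * ((1/2)^Suc k * norm x0 + 4 * G)"
      using E_split[OF u1, of 0 ?a "?a + \<tau>"] a \<tau>(1) by (simp add: distrib_left exp_add)
    finally show ?case unfolding a(4) .
  }
qed

text \<open>With \<open>k\<close> full periods before \<open>t\<close>, \<open>k\<close> is at least
  \<open>t / \<tau> - 1\<close>, which gives the factor 2 in front of the decay. The incomplete
  period costs \<open>K\<close> and one further \<open>G\<close>, hence
  \<open>5 * K * G\<close>.\<close>

lemma a_priori_bound:
  assumes G: "\<And>a t. 0 \<le> a \<Longrightarrow> a \<le> t \<Longrightarrow> t \<le> b \<Longrightarrow> t \<le> a + \<tau> \<Longrightarrow> P u2 a t \<le> G"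
    and t: "0 \<le> t" "t \<le> b"
  shows "norm (x t) \<le> exp (\<kappa> * E u1 0 t) * (2 * K * 2 powr (- t / \<tau>) * norm x0 + 5 * K * G)"
proof -
  note ctx = u1 u2 sol
  define k where "k = nat \<lfloor>t / \<tau>\<rfloor>"
  have "0 \<le> t / \<tau>" using t \<tau>(1) by simp
  then have k: "real k \<le> t / \<tau>" "t / \<tau> \<le> real k + 1" unfolding k_def by linarith+
  let ?a = "real k * \<tau>"
  have a: "0 \<le> ?a" "?a \<le> t" "?a \<le> b" "t \<le> ?a + \<tau>" using k \<tau>(1) t by (auto simp: field_simps)
  have G0: "0 \<le> G" using P_nonneg G[of 0 0] \<tau>(1) t by (meson order_refl add_nonneg_nonneg less_imp_le order_trans)
  have e1: "1 \<le> exp (\<kappa> * E u1 0 ?a)" using \<kappa>_pos E_nonneg by simp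
  have "(1/2::real)^k = 2 powr (- real k)" by (simp add: powr_minus powr_realpow power_divide inverse_eq_divide)
  also have "\<dots> \<le> 2 powr (1 + (- t / \<tau>))" using k by (intro powr_mono) auto
  also have "\<dots> = 2 * 2 powr (- t / \<tau>)" by (subst powr_add) simp
  finally have p: "(1/2::real)^k \<le> 2 * 2 powr (- t / \<tau>)" .
  have "norm (x t) \<le> K * exp (\<kappa> * E u1 ?a t) * (norm (x ?a) + G)"
    using a t by (intro within_period G) auto
  also have "\<dots> \<le> K * exp (\<kappa> * E u1 ?a t) * (exp (\<kappa> * E u1 0 ?a) * (2 * 2 powr (- t / \<tau>) * norm x0 + 5 * G))"
  proof (rule mult_left_mono)
    have "norm (x ?a) \<le> exp (\<kappa> * E u1 0 ?a) * ((1/2)^k * norm x0 + 4 * G)"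
      using t a by (intro iterated_bound[OF G]) (auto intro: order_trans[OF a(1) a(3)])
    also have "\<dots> \<le> exp (\<kappa> * E u1 0 ?a) * (2 * 2 powr (- t / \<tau>) * norm x0 + 4 * G)"
      using p by (intro mult_left_mono add_mono mult_right_mono) auto
    finally have "norm (x ?a) + G \<le> exp (\<kappa> * E u1 0 ?a) * (2 * 2 powr (- t / \<tau>) * norm x0 + 4 * G) + exp (\<kappa> * E u1 0 ?a) * G"
      using mult_right_mono[OF e1 G0] by simp
    then show "norm (x ?a) + G \<le> exp (\<kappa> * E u1 0 ?a) * (2 * 2 powr (- t / \<tau>) * norm x0 + 5 * G)"
      by (simp add: algebra_simps)
  qed (use M(1) in simp)
  also have "\<dots> = K * exp (\<kappa> * E u1 0 t) * (2 * 2 powr (- t / \<tau>) * norm x0 + 5 * G)"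
    using E_split[OF u1, of 0 ?a t] a t by (simp add: distrib_left exp_add)
  finally show ?thesis by (simp add: algebra_simps)
qed

end

end

section \<open>Existence and uniqueness\<close>

context bilinear_system
begin

text \<open>Functions that agree up to \<open>a\<close> have equal nonlinear terms there, so
  \<open>bound_local\<close> on \<open>{a..t}\<close> applies with \<open>k = S\<close> and the
  Lipschitz constant inside \<open>\<mu>1\<close>. The length \<open>h\<close> depends on
  \<open>R\<close> and a bound for \<open>u1\<close> alone and is the same for every
  \<open>a\<close>.\<close>

lemma contraction_step_length:
  assumes u1: "u1 \<in> Linf {0..b}" and R: "R > 0"
  obtains h where "h > 0"
    and "\<And>a t. 0 \<le> a \<Longrightarrow> a \<le> t \<Longrightarrow> t \<le> a + h \<Longrightarrow> t \<le> b \<Longrightarrow> \<theta>1 (E u1 a t) \<le> 1 / 2"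
    and "\<And>a t x y S. 0 \<le> a \<Longrightarrow> a \<le> t \<Longrightarrow> t \<le> a + h \<Longrightarrow> t \<le> b \<Longrightarrow>
       continuous_on {0..t} x \<Longrightarrow> continuous_on {0..t} y \<Longrightarrow>
       (\<And>s. s \<in> {0..t} \<Longrightarrow> norm (x s) \<le> R) \<Longrightarrow> (\<And>s. s \<in> {0..t} \<Longrightarrow> norm (y s) \<le> R) \<Longrightarrow>
       (\<And>s. s \<in> {0..a} \<Longrightarrow> x s = y s) \<Longrightarrow> (\<And>s. s \<in> {a..t} \<Longrightarrow> norm (x s - y s) \<le> S) \<Longrightarrow>
       norm (rhs x0 u1 u2 x t - rhs x0 u1 u2 y t) \<le> S / 2"
proof -
  obtain L where L: "L > 0" "\<And>x y u. norm x \<le> R \<Longrightarrow> norm y \<le> R \<Longrightarrow>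
      norm (F x u - F y u) \<le> L * norm u * norm (x - y)"
    using F2[of "cball 0 R"] by auto
  obtain C where C: "C > 0" "AE s in lebesgue_on {0..b}. norm (u1 s) \<le> C"
    by (rule Linf_bounded[OF _ u1]) auto
  obtain d where d: "d > 0" "\<theta>1 d \<le> 1 / 2" using class_K_small[OF in1.\<theta>_K, of "1/2"] by auto
  \<comment> \<open>\<open>Q\<close> dominates the cost per unit time both for the size of
    \<open>F\<close> (constant \<open>m\<close>) and for its differences (constant
    \<open>L\<close>), so a time span \<open>d / Q\<close> costs at most \<open>d\<close>. The
    summand 1 keeps \<open>Q\<close> positive.\<close>
  define Q where "Q = \<mu>1 (m * C) + \<mu>1 (L * C) + 1"
  have Q: "\<mu>1 (m * C) \<le> Q" "\<mu>1 (L * C) \<le> Q" "Q > 0"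
    using class_K_nonneg[OF in1.\<mu>, of "m * C"] class_K_nonneg[OF in1.\<mu>, of "L * C"] m L C by (auto simp: Q_def)
  define h where "h = d / Q"
  have small: "\<theta>1 (\<integral>s. \<mu>1 (k * norm (u1 s)) \<partial>lebesgue_on {a..t}) \<le> 1 / 2"
    if a: "0 \<le> a" "a \<le> t" "t \<le> a + h" "t \<le> b" and k: "0 \<le> k" "\<mu>1 (k * C) \<le> Q" for a t k
  proof -
    have sub: "{a..t} \<subseteq> {0..b}" using a by auto
    have "AE s in lebesgue_on {a..t}. norm (u1 s) \<le> C"
      using C(2) sub by (auto simp: AE_restrict_space_iff)
    then have "(\<integral>s. \<mu>1 (k * norm (u1 s)) \<partial>lebesgue_on {a..t}) \<le> (t - a) * \<mu>1 (k * C)"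
      using a k by (intro integral_class_K_le[OF in1.\<mu>] Linf_subset[OF _ _ sub u1]) auto
    also have "\<dots> \<le> h * Q" using a k class_K_nonneg[OF in1.\<mu>, of "k * C"] C(1) Q(3) by (intro mult_mono) auto
    also have "\<dots> = d" using Q by (simp add: h_def)
    finally have "(\<integral>s. \<mu>1 (k * norm (u1 s)) \<partial>lebesgue_on {a..t}) \<le> d" .
    moreover have "0 \<le> (\<integral>s. \<mu>1 (k * norm (u1 s)) \<partial>lebesgue_on {a..t})"
      using k by (intro Bochner_Integration.integral_nonneg class_K_nonneg[OF in1.\<mu>]) simp
    ultimately show ?thesis using class_K_mono[OF in1.\<theta>_K] d(2) by (meson order_trans)
  qed
  show ?thesis
  proof (rule that[of h])
    show "h > 0" using d Q by (simp add: h_def)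
    show "\<theta>1 (E u1 a t) \<le> 1 / 2" if "0 \<le> a" "a \<le> t" "t \<le> a + h" "t \<le> b" for a t
      unfolding E_def using small[OF that _ Q(1)] m by simp
    fix a t S :: real and x y :: "real \<Rightarrow> 'x"
    assume a: "0 \<le> a" "a \<le> t" "t \<le> a + h" "t \<le> b"
      and x: "continuous_on {0..t} x" and y: "continuous_on {0..t} y"
      and xR: "\<And>s. s \<in> {0..t} \<Longrightarrow> norm (x s) \<le> R" and yR: "\<And>s. s \<in> {0..t} \<Longrightarrow> norm (y s) \<le> R"
      and eq: "\<And>s. s \<in> {0..a} \<Longrightarrow> x s = y s" and S: "\<And>s. s \<in> {a..t} \<Longrightarrow> norm (x s - y s) \<le> S"
    have S0: "0 \<le> S" using S[of a] a by (meson atLeastAtMost_iff norm_ge_zero order_refl order_trans)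
    have u1t: "u1 \<in> Linf {0..t}" using a by (intro Linf_subset[OF _ _ _ u1]) auto
    have "rhs x0 u1 u2 x t - rhs x0 u1 u2 y t = \<Phi>1 (\<lambda>s. F (x s) (u1 s)) t - \<Phi>1 (\<lambda>s. F (y s) (u1 s)) t"
      by (simp add: rhs_def)
    also have "\<dots> = \<Phi>1 (\<lambda>s. F (x s) (u1 s) - F (y s) (u1 s)) t"
      using a by (intro in1.diff[symmetric, OF F_Linf[OF x u1t] F_Linf[OF y u1t]]) auto
    also have "norm \<dots> \<le> S * \<theta>1 (\<integral>s. \<mu>1 (L * norm (u1 s)) \<partial>lebesgue_on {a..t})"
    proof (rule in1.bound_local[OF _ a(1,2) order_refl S0])
      have "(\<lambda>s. F (x s) (u1 s) + (-1) *\<^sub>R F (y s) (u1 s)) \<in> Linf {0..t}"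
        by (intro Linf_add Linf_scaleR F_Linf x y u1t) auto
      then show "(\<lambda>s. F (x s) (u1 s) - F (y s) (u1 s)) \<in> Linf {0..t}" by simp
      show "F (x s) (u1 s) - F (y s) (u1 s) = 0" if "0 \<le> s" "s \<le> a" for s
        using eq[of s] that by simp
      show "norm (F (x s) (u1 s) - F (y s) (u1 s)) \<le> S * (L * norm (u1 s))" if "a < s" "s \<le> t" for s
      proof -
        have "norm (F (x s) (u1 s) - F (y s) (u1 s)) \<le> L * norm (u1 s) * norm (x s - y s)"
          using that a by (intro L(2) xR yR) auto
        also have "\<dots> \<le> L * norm (u1 s) * S" using L(1) that by (intro mult_left_mono S) auto
        finally show ?thesis by (simp add: mult_ac)
      qed
      show "integrable (lebesgue_on {a..t}) (\<lambda>s. \<mu>1 (L * norm (u1 s)))"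
        using a L(1) by (intro integrable_class_K_norm[OF in1.\<mu>] Linf_subset[OF _ _ _ u1]) auto
    qed (use L in simp)
    also have "\<dots> \<le> S * (1/2)" using small[OF a _ Q(2)] L(1) S0 by (intro mult_left_mono) auto
    finally show "norm (rhs x0 u1 u2 x t - rhs x0 u1 u2 y t) \<le> S / 2" by simp
  qed
qed

lemma solves_0:
  assumes "u1 \<in> Linf {0..b}" "u2 \<in> Linf {0..b}" "solves x0 u1 u2 b x" "0 \<le> b"
  shows "x 0 = x0"
  using rhs_0[OF assms(1,2) x_cont[OF assms(1-3)] assms(4)] assms(3,4) by (simp add: solves_def)

lemma solves_subinterval:
  assumes "solves x0 u1 u2 b x" "c \<le> b"
  shows "solves x0 u1 u2 c x"
  using assms by (auto simp: solves_def intro: continuous_on_subset)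

text \<open>Agreement is propagated in steps of the uniform length \<open>h\<close>: at a point of
  maximal difference on the next step, the contraction estimate bounds the difference by half of
  itself.\<close>

lemma solves_unique:
  assumes u1: "u1 \<in> Linf {0..b}" and u2: "u2 \<in> Linf {0..b}"
    and x: "solves x0 u1 u2 b x" and y: "solves x0 u1 u2 b y" and t: "t \<in> {0..b}"
  shows "x t = y t"
proof -
  have b: "0 \<le> b" using t by auto
  have cx: "continuous_on {0..b} x" and cy: "continuous_on {0..b} y" using x y by (auto simp: solves_def)
  obtain R1 where R1: "R1 > 0" "\<And>s. s \<in> {0..b} \<Longrightarrow> norm (x s) \<le> R1" by (rule continuous_norm_bounded[OF cx]) blast
  obtain R2 where R2: "R2 > 0" "\<And>s. s \<in> {0..b} \<Longrightarrow> norm (y s) \<le> R2" by (rule continuous_norm_bounded[OF cy]) blast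
  define R where "R = max R1 R2"
  have R: "R > 0" "\<And>s. s \<in> {0..b} \<Longrightarrow> norm (x s) \<le> R" "\<And>s. s \<in> {0..b} \<Longrightarrow> norm (y s) \<le> R"
    using R1 R2 unfolding R_def by (auto intro: order_trans[OF _ max.cobounded1] order_trans[OF _ max.cobounded2])
  obtain h where h: "h > 0" and contr: "\<And>a t S. 0 \<le> a \<Longrightarrow> a \<le> t \<Longrightarrow> t \<le> a + h \<Longrightarrow> t \<le> b \<Longrightarrow>
       continuous_on {0..t} x \<Longrightarrow> continuous_on {0..t} y \<Longrightarrow>
       (\<And>s. s \<in> {0..t} \<Longrightarrow> norm (x s) \<le> R) \<Longrightarrow> (\<And>s. s \<in> {0..t} \<Longrightarrow> norm (y s) \<le> R) \<Longrightarrow>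
       (\<And>s. s \<in> {0..a} \<Longrightarrow> x s = y s) \<Longrightarrow> (\<And>s. s \<in> {a..t} \<Longrightarrow> norm (x s - y s) \<le> S) \<Longrightarrow>
       norm (rhs x0 u1 u2 x t - rhs x0 u1 u2 y t) \<le> S / 2"
    by (rule contraction_step_length[OF u1 R(1), where ?x0.0 = x0 and ?u2.0 = u2]) blast
  have "\<forall>s\<in>{0..b}. s \<le> real n * h \<longrightarrow> x s = y s" for n
  proof (induction n)
    case 0
    then show ?case using solves_0[OF u1 u2 x b] solves_0[OF u1 u2 y b] by auto
  next
    case (Suc n)
    let ?a = "real n * h"
    show ?case
    proof (intro ballI impI)
      fix s assume s: "s \<in> {0..b}" "s \<le> real (Suc n) * h"
      show "x s = y s"
      proof (cases "s \<le> ?a")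
        case True
        then show ?thesis using Suc s by blast
      next
        case False
        have a: "0 \<le> ?a" "?a \<le> s" "s \<le> ?a + h" "s \<le> b" using False s h by (auto simp: algebra_simps)
        have "continuous_on {?a..s} (\<lambda>r. norm (x r - y r))"
          using a by (intro continuous_intros continuous_on_subset[OF cx] continuous_on_subset[OF cy]) auto
        from continuous_attains_sup[OF _ _ this] a obtain r where r: "?a \<le> r" "r \<le> s"
          and max: "\<And>q. ?a \<le> q \<Longrightarrow> q \<le> s \<Longrightarrow> norm (x q - y q) \<le> norm (x r - y r)" by auto
        have "norm (rhs x0 u1 u2 x r - rhs x0 u1 u2 y r) \<le> norm (x r - y r) / 2"
          by (rule contr[OF a(1) r(1)])
            (use a r R Suc max in \<open>auto intro: continuous_on_subset[OF cx] continuous_on_subset[OF cy]\<close>)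
        moreover have "x r = rhs x0 u1 u2 x r" "y r = rhs x0 u1 u2 y r"
          using x y order_trans[OF a(1) r(1)] order_trans[OF r(2) a(4)] by (simp_all add: solves_def)
        ultimately have "norm (x r - y r) \<le> norm (x r - y r) / 2" by simp
        then have "norm (x r - y r) \<le> 0" by simp
        with max[OF a(2) order_refl] show ?thesis by simp
      qed
    qed
  qed
  moreover obtain n where "t < real n * h" using reals_Archimedean3[OF h] by blast
  ultimately show ?thesis using t by (meson less_imp_le)
qed

text \<open>Banach's fixed point theorem on functions that continue \<open>x\<close> and stay in the
  ball of radius \<open>R\<close>. The map preserves the ball because
  \<open>M * R0 + R / 2 + P u2 a c\<close> is at most \<open>R\<close>.\<close>

lemma solves_extend:
  assumes u1: "u1 \<in> Linf {0..c}" and u2: "u2 \<in> Linf {0..c}" and x: "solves x0 u1 u2 a x"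
    and a: "0 \<le> a" "a \<le> c"
    and R0: "\<And>t. t \<in> {0..a} \<Longrightarrow> norm (x t) \<le> R0" and R: "R0 \<le> R" "2 * (M * R0 + P u2 a c) \<le> R" "0 \<le> R"
    and half: "\<And>t. a \<le> t \<Longrightarrow> t \<le> c \<Longrightarrow> \<theta>1 (E u1 a t) \<le> 1 / 2"
    and contr: "\<And>t x y S. a \<le> t \<Longrightarrow> t \<le> c \<Longrightarrow>
       continuous_on {0..t} x \<Longrightarrow> continuous_on {0..t} y \<Longrightarrow>
       (\<And>s. s \<in> {0..t} \<Longrightarrow> norm (x s) \<le> R) \<Longrightarrow> (\<And>s. s \<in> {0..t} \<Longrightarrow> norm (y s) \<le> R) \<Longrightarrow>
       (\<And>s. s \<in> {0..a} \<Longrightarrow> x s = y s) \<Longrightarrow> (\<And>s. s \<in> {a..t} \<Longrightarrow> norm (x s - y s) \<le> S) \<Longrightarrow>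
       norm (rhs x0 u1 u2 x t - rhs x0 u1 u2 y t) \<le> S / 2"
  shows "\<exists>y. solves x0 u1 u2 c y"
proof -
  \<comment> \<open>The fixed point is sought among bounded continuous functions on the whole line;
    evaluating \<open>rhs\<close> at the clamped time extends it constantly outside
    \<open>{0..c}\<close>.\<close>
  define cl where "cl = (\<lambda>t. max 0 (min c t))"
  have cl: "cl t \<in> {0..c}" "t \<in> {0..c} \<Longrightarrow> cl t = t" for t using a by (auto simp: cl_def)
  \<comment> \<open>Prescribing singletons on \<open>{0..a}\<close> puts the continuation condition
    into the set itself, which is closed as each \<open>X t\<close> is closed.\<close>
  define X where "X = (\<lambda>t. if t \<in> {0..a} then {x t} else cball 0 R)"
  define s where "s = PiC UNIV X"
  have X_R: "norm y \<le> R" if "y \<in> X t" for y t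
    using that R0[of t] R(1) by (auto simp: X_def split: if_splits)
  have s_iff: "f \<in> s \<longleftrightarrow> (\<forall>t. f t \<in> X t)" for f by (auto simp: s_def mem_PiC_iff)
  define \<Psi> where "\<Psi> = (\<lambda>f. Bcontfun (\<lambda>t. rhs x0 u1 u2 (apply_bcontfun f) (cl t)))"
  have cf: "continuous_on {0..t} (apply_bcontfun f)" for f :: "real \<Rightarrow>\<^sub>C 'x" and t by simp
  have \<Psi>: "apply_bcontfun (\<Psi> f) t = rhs x0 u1 u2 (apply_bcontfun f) (cl t)" for f t
  proof -
    have c: "continuous_on {0..c} (rhs x0 u1 u2 (apply_bcontfun f))" by (rule rhs_cont[OF u1 u2 cf])
    have "bounded (rhs x0 u1 u2 (apply_bcontfun f) ` {0..c})"
      by (intro compact_imp_bounded compact_continuous_image c) simp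
    then have "bounded (range (\<lambda>t. rhs x0 u1 u2 (apply_bcontfun f) (cl t)))"
      by (rule bounded_subset) (use cl in auto)
    moreover have "continuous_on UNIV (\<lambda>t. rhs x0 u1 u2 (apply_bcontfun f) (cl t))"
      by (rule continuous_on_compose2[OF c]) (use a in \<open>auto simp: cl_def intro!: continuous_intros\<close>)
    ultimately have "(\<lambda>t. rhs x0 u1 u2 (apply_bcontfun f) (cl t)) \<in> bcontfun" by (simp add: bcontfun_def)
    then show ?thesis by (simp add: \<Psi>_def Bcontfun_inverse)
  qed
  have rx: "rhs x0 u1 u2 (apply_bcontfun f) t = x t" if f: "f \<in> s" and t: "t \<in> {0..a}" for f t
  proof -
    have "rhs x0 u1 u2 (apply_bcontfun f) t = rhs x0 u1 u2 x t"
    proof (rule rhs_cong)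
      fix r assume "r \<in> {0..t}"
      then have "r \<in> {0..a}" using t by auto
      with f show "f r = x r" unfolding s_iff by (auto simp: X_def dest: spec[of _ r])
    qed
    then show ?thesis using x t by (simp add: solves_def)
  qed
  have maps: "\<Psi> f \<in> s" if f: "f \<in> s" for f
    unfolding s_iff
  proof
    fix t
    show "\<Psi> f t \<in> X t"
    proof (cases "t \<in> {0..a}")
      case True
      then show ?thesis using a cl(2)[of t] rx[OF f True] by (simp add: \<Psi> X_def)
    next
      case False
      have "norm (rhs x0 u1 u2 (apply_bcontfun f) (cl t)) \<le> R"
      proof (cases "cl t \<le> a")
        case True
        have "cl t \<in> {0..a}" using True cl(1)[of t] by auto
        then show ?thesis using rx[OF f] R0 R(1) by (metis order_trans)
      next
        case False
        then have t: "a \<le> cl t" "cl t \<le> c" using cl(1)[of t] by auto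
        have aa: "rhs x0 u1 u2 (apply_bcontfun f) a = x a" using rx[OF f, of a] a by simp
        have "norm (rhs x0 u1 u2 (apply_bcontfun f) (cl t)) \<le>
            norm (T (cl t - a) (x a)) + R * \<theta>1 (E u1 a (cl t)) + P u2 a (cl t)"
          unfolding aa[symmetric] using f X_R by (intro rhs_estimate[OF u1 u2 cf a(1) t]) (auto simp: s_iff)
        also have "\<dots> \<le> M * R0 + R * (1 / 2) + P u2 a c"
        proof (intro add_mono)
          have "norm (T (cl t - a) (x a)) \<le> M * norm (x a)" using t by (intro M(2)) simp
          also have "\<dots> \<le> M * R0" using M(1) R0[of a] a by (intro mult_left_mono) auto
          finally show "norm (T (cl t - a) (x a)) \<le> M * R0" .
          show "R * \<theta>1 (E u1 a (cl t)) \<le> R * (1 / 2)" using half[OF t] R(3) by (intro mult_left_mono) auto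
          show "P u2 a (cl t) \<le> P u2 a c" using a t by (intro P_mono[OF u2]) auto
        qed
        also have "\<dots> \<le> R" using R(2) by simp
        finally show ?thesis .
      qed
      then show ?thesis using False by (auto simp: \<Psi> X_def)
    qed
  qed
  have contraction: "dist (\<Psi> f) (\<Psi> g) \<le> 1 / 2 * dist f g" if f: "f \<in> s" and g: "g \<in> s" for f g
  proof (rule dist_bound)
    fix t
    show "dist (\<Psi> f t) (\<Psi> g t) \<le> 1 / 2 * dist f g"
    proof (cases "cl t \<le> a")
      case True
      then have "cl t \<in> {0..a}" using cl(1)[of t] by auto
      then show ?thesis using rx[OF f] rx[OF g] by (simp add: \<Psi>)
    next
      case False
      then have t: "a \<le> cl t" "cl t \<le> c" using cl(1)[of t] by auto
      have "norm (rhs x0 u1 u2 (apply_bcontfun f) (cl t) - rhs x0 u1 u2 (apply_bcontfun g) (cl t)) \<le> dist f g / 2"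
      proof (rule contr[OF t cf cf])
        show "norm (f r) \<le> R" "norm (g r) \<le> R" for r using f g X_R by (auto simp: s_iff)
        show "f r = g r" if "r \<in> {0..a}" for r
          using f g that unfolding s_iff by (auto simp: X_def dest!: spec[of _ r])
        show "norm (f r - g r) \<le> dist f g" for r using dist_bounded[of f r g] by (simp add: dist_norm)
      qed
      then show ?thesis by (simp add: \<Psi> dist_norm)
    qed
  qed
  have "complete s" unfolding s_def complete_eq_closed
    by (rule closed_PiC) (auto simp: X_def)
  moreover have "s \<noteq> {}"
  proof -
    have cx: "continuous_on {0..a} x" using x by (simp add: solves_def)
    \<comment> \<open>The old solution, frozen outside \<open>{0..a}\<close>, shows that the set is
      nonempty.\<close>
    have "(\<lambda>t. x (max 0 (min a t))) \<in> bcontfun"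
    proof (rule bcontfun_normI)
      show "continuous_on UNIV (\<lambda>t. x (max 0 (min a t)))"
        by (rule continuous_on_compose2[OF cx]) (use a in \<open>auto intro!: continuous_intros\<close>)
      show "norm (x (max 0 (min a t))) \<le> R0" for t using a by (intro R0) auto
    qed
    then obtain f where f: "(\<lambda>t. x (max 0 (min a t))) = apply_bcontfun f" by (rule bcontfunE)
    have "f t \<in> X t" for t
    proof -
      have "norm (x (max 0 (min a t))) \<le> R0" using a by (intro R0) auto
      then have "norm (x (max 0 (min a t))) \<le> R" using R(1) by simp
      then show ?thesis using fun_cong[OF f, of t, symmetric] by (auto simp: X_def)
    qed
    then show ?thesis using s_iff by blast
  qed
  ultimately obtain f where f: "\<Psi> f = f"
    using Banach_fix[of s "1/2" \<Psi>] maps contraction by auto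
  have "solves x0 u1 u2 c (apply_bcontfun f)"
    unfolding solves_def
  proof
    show "\<forall>t\<in>{0..c}. apply_bcontfun f t = rhs x0 u1 u2 (apply_bcontfun f) t"
      using \<Psi>[of f] unfolding f by (metis cl(2))
  qed (rule cf)
  then show ?thesis by blast
qed

text \<open>The a priori bound \<open>R0\<close> holds for every solution on every
  \<open>{0..c}\<close> with \<open>c \<le> b\<close>, so a single \<open>R\<close> and a single
  step length \<open>h\<close> serve all extensions, and finitely many of them reach
  \<open>b\<close>.\<close>

lemma solution_exists:
  assumes u1: "u1 \<in> Linf {0..b}" and u2: "u2 \<in> Linf {0..b}" and b: "0 \<le> b"
  shows "\<exists>x. solves x0 u1 u2 b x"
proof -
  define G where "G = P u2 0 b"
  define R0 where "R0 = exp (\<kappa> * E u1 0 b) * (2 * K * norm x0 + 5 * K * G)"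
  have G0: "0 \<le> G" unfolding G_def by (rule P_nonneg)
  have R0: "norm (x t) \<le> R0" if x: "solves x0 u1 u2 c x" and c: "c \<le> b" "t \<in> {0..c}" for x t c
  proof -
    have uc: "u1 \<in> Linf {0..c}" "u2 \<in> Linf {0..c}"
      using c by (auto intro!: Linf_subset[OF _ _ _ u1] Linf_subset[OF _ _ _ u2])
    have "norm (x t) \<le> exp (\<kappa> * E u1 0 t) * (2 * K * 2 powr (- t / \<tau>) * norm x0 + 5 * K * G)"
      using c unfolding G_def by (intro a_priori_bound[OF uc x] P_mono[OF u2]) auto
    also have "\<dots> \<le> exp (\<kappa> * E u1 0 b) * (2 * K * 1 * norm x0 + 5 * K * G)"
    proof (intro mult_mono add_mono order_refl)
      have "E u1 0 b = E u1 0 t + E u1 t b" using c by (intro E_split[OF u1]) auto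
      then show "exp (\<kappa> * E u1 0 t) \<le> exp (\<kappa> * E u1 0 b)" using E_nonneg[of u1 t b] \<kappa>_pos by simp
      have "- t / \<tau> \<le> 0" using c \<tau>(1) by (simp add: divide_nonpos_pos)
      then show "2 powr (- t / \<tau>) \<le> 1" using powr_mono[of "- t / \<tau>" 0 2] by simp
    qed (use M(1) G0 in auto)
    finally show ?thesis by (simp add: R0_def)
  qed
  have R00: "0 \<le> R0" unfolding R0_def using M(1) G0 by (intro mult_nonneg_nonneg add_nonneg_nonneg) auto
  \<comment> \<open>Large enough for both conditions of \<open>solves_extend\<close>; the summand 1
    makes it positive even if \<open>R0\<close> and \<open>G\<close> vanish.\<close>
  define R where "R = R0 + 2 * (M * R0 + G) + 1"
  have "0 \<le> M * R0" using M(1) R00 by simp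
  then have R: "R0 \<le> R" "2 * (M * R0 + G) \<le> R" "0 < R" using R00 G0 by (auto simp: R_def)
  obtain h where h: "h > 0"
    and half: "\<And>a t. 0 \<le> a \<Longrightarrow> a \<le> t \<Longrightarrow> t \<le> a + h \<Longrightarrow> t \<le> b \<Longrightarrow> \<theta>1 (E u1 a t) \<le> 1 / 2"
    and contr: "\<And>a t x y S. 0 \<le> a \<Longrightarrow> a \<le> t \<Longrightarrow> t \<le> a + h \<Longrightarrow> t \<le> b \<Longrightarrow>
       continuous_on {0..t} x \<Longrightarrow> continuous_on {0..t} y \<Longrightarrow>
       (\<And>s. s \<in> {0..t} \<Longrightarrow> norm (x s) \<le> R) \<Longrightarrow> (\<And>s. s \<in> {0..t} \<Longrightarrow> norm (y s) \<le> R) \<Longrightarrow>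
       (\<And>s. s \<in> {0..a} \<Longrightarrow> x s = y s) \<Longrightarrow> (\<And>s. s \<in> {a..t} \<Longrightarrow> norm (x s - y s) \<le> S) \<Longrightarrow>
       norm (rhs x0 u1 u2 x t - rhs x0 u1 u2 y t) \<le> S / 2"
    by (rule contraction_step_length[OF u1 R(3), where ?x0.0 = x0 and ?u2.0 = u2]) blast
  have "\<exists>x. solves x0 u1 u2 (min b (real n * h)) x" for n
  proof (induction n)
    case 0
    have 0: "u1 \<in> Linf {0..0}" "u2 \<in> Linf {0..0}"
      using b by (auto intro!: Linf_subset[OF _ _ _ u1] Linf_subset[OF _ _ _ u2])
    have "solves x0 u1 u2 0 (\<lambda>_. x0)"
      unfolding solves_def using rhs_0[OF 0, of "\<lambda>_. x0" x0] by simp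
    then show ?case using b by auto
  next
    case (Suc n)
    let ?a = "min b (real n * h)" and ?c = "min b (real (Suc n) * h)"
    obtain x where x: "solves x0 u1 u2 ?a x" using Suc by blast
    have ac: "0 \<le> ?a" "?a \<le> ?c" "?c \<le> ?a + h" "?a \<le> b" "?c \<le> b" using h b by (auto simp: algebra_simps)
    have uc: "u1 \<in> Linf {0..?c}" "u2 \<in> Linf {0..?c}"
      by (auto intro!: Linf_subset[OF _ _ _ u1] Linf_subset[OF _ _ _ u2])
    show ?case
    proof (rule solves_extend[OF uc x ac(1,2), of R0 R])
      show "norm (x t) \<le> R0" if "t \<in> {0..?a}" for t by (rule R0[OF x ac(4) that])
      have "2 * (M * R0 + p) \<le> R" if "p \<le> G" for p
        by (rule order_trans[OF _ R(2)]) (use that in simp)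
      then show "2 * (M * R0 + P u2 ?a ?c) \<le> R"
        using P_mono[OF u2 order_refl ac(1,2,5) order_refl] by (simp add: G_def)
      show "\<theta>1 (E u1 ?a t) \<le> 1 / 2" if "?a \<le> t" "t \<le> ?c" for t
        by (rule half) (use ac that in linarith)+
      fix t S :: real and x y :: "real \<Rightarrow> 'x"
      assume t: "?a \<le> t" "t \<le> ?c"
      assume *: "continuous_on {0..t} x" "continuous_on {0..t} y"
       "\<And>s. s \<in> {0..t} \<Longrightarrow> norm (x s) \<le> R" "\<And>s. s \<in> {0..t} \<Longrightarrow> norm (y s) \<le> R"
       "\<And>s. s \<in> {0..?a} \<Longrightarrow> x s = y s" "\<And>s. s \<in> {?a..t} \<Longrightarrow> norm (x s - y s) \<le> S"
      have "t \<le> ?a + h" "t \<le> b" using t ac by linarith+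
      then show "norm (rhs x0 u1 u2 x t - rhs x0 u1 u2 y t) \<le> S / 2"
        by (intro contr[OF ac(1) t(1)] *)
    qed (use R in auto)
  qed
  moreover obtain n where "b < real n * h" using reals_Archimedean3[OF h] by blast
  ultimately show ?thesis by (metis less_imp_le min.absorb1)
qed

text \<open>Solutions on \<open>{0..n}\<close> agree on overlaps by uniqueness, so evaluating at
  time \<open>t\<close> the one with horizon \<open>nat \<lceil>t\<rceil>\<close> glues them
  together.\<close>

lemma global_solution_exists:
  assumes u1: "u1 \<in> Linf {0..}" and u2: "u2 \<in> Linf {0..}"
  shows "\<exists>x. \<forall>b. solves x0 u1 u2 b x"
proof -
  have ub: "u1 \<in> Linf {0..b}" "u2 \<in> Linf {0..b}" for b
    by (auto intro!: Linf_subset[OF _ _ _ u1] Linf_subset[OF _ _ _ u2])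
  have "\<forall>n::nat. \<exists>x. solves x0 u1 u2 (real n) x" using solution_exists[OF ub] by simp
  then obtain X where X: "\<And>n::nat. solves x0 u1 u2 (real n) (X n)" by metis
  define x where "x = (\<lambda>t. X (nat \<lceil>t\<rceil>) t)"
  have eq: "x t = X n t" if t: "t \<in> {0..real n}" for t n
  proof -
    have c: "t \<le> real (nat \<lceil>t\<rceil>)" "nat \<lceil>t\<rceil> \<le> n" using t by (auto simp: ceiling_le_iff le_of_int_ceiling)
    have "solves x0 u1 u2 t (X (nat \<lceil>t\<rceil>))" "solves x0 u1 u2 t (X n)"
      using c t by (auto intro: solves_subinterval[OF X])
    then show ?thesis using solves_unique[OF ub] t by (simp add: x_def)
  qed
  have "solves x0 u1 u2 b x" for b
  proof (rule solves_subinterval)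
    let ?n = "nat \<lceil>b\<rceil>"
    show "b \<le> real ?n" by linarith
    have "rhs x0 u1 u2 x t = rhs x0 u1 u2 (X ?n) t" if "t \<in> {0..real ?n}" for t
      using that by (intro rhs_cong eq) auto
    then show "solves x0 u1 u2 (real ?n) x"
      using X[of ?n] eq[where n = ?n] unfolding solves_def
      by (auto intro: continuous_on_eq)
  qed
  then show ?thesis by blast
qed

end

section \<open>Comparison functions and stability\<close>

text \<open>The nonnegative unbounded minorant \<open>g\<close> supplies the unboundedness of
  \<open>f\<close>.\<close>

lemma class_K_inf_real:
  assumes "continuous_on {0..} f" "f 0 = (0::real)" "strict_mono_on {0..} f"
    and "\<And>r. 0 \<le> r \<Longrightarrow> g r \<le> f r" "\<not> bounded (g ` {0..})" "\<And>r. 0 \<le> r \<Longrightarrow> 0 \<le> g r"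
  shows "f \<in> class_K_inf"
proof -
  have "f r \<ge> 0" if "r \<ge> 0" for r
    using assms(4,6)[OF that] by simp
  moreover have "\<not> bounded (f ` {0..})"
  proof
    assume "bounded (f ` {0..})"
    then obtain B where B: "\<And>r. 0 \<le> r \<Longrightarrow> \<bar>f r\<bar> \<le> B" by (auto simp: bounded_iff)
    have "\<bar>g r\<bar> \<le> B" if "0 \<le> r" for r using B[OF that] assms(4,6)[OF that] by simp
    then have "bounded (g ` {0..})" by (auto simp: bounded_iff)
    with assms(5) show False ..
  qed
  ultimately show ?thesis using assms(1-3) by (auto simp: class_K_inf_def class_K_def)
qed

lemma unbounded_id: "\<not> bounded ((\<lambda>r::real. r) ` {0..})"
proof
  assume "bounded ((\<lambda>r::real. r) ` {0..})"
  then obtain B where B: "\<And>r::real. 0 \<le> r \<Longrightarrow> \<bar>r\<bar> \<le> B" by (auto simp: bounded_iff)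
  from B[of "\<bar>B\<bar> + 1"] show False by simp
qed

lemma class_K_scale_arg:
  assumes "\<mu> \<in> class_K" "c > 0"
  shows "(\<lambda>r. \<mu> (c * r)) \<in> class_K"
proof -
  have "continuous_on {0..} (\<lambda>r. \<mu> (c * r))"
    by (rule continuous_on_compose2[of "{0..}" \<mu>])
      (use assms in \<open>auto simp: class_K_def intro!: continuous_intros\<close>)
  moreover have "strict_mono_on {0..} (\<lambda>r. \<mu> (c * r))"
    using assms by (auto simp: class_K_def strict_mono_on_def)
  ultimately show ?thesis using assms by (auto simp: class_K_def)
qed

lemma quad_strict_mono:
  fixes p q :: real
  assumes "0 \<le> p" "p < q" shows "p + p\<^sup>2 / 2 < q + q\<^sup>2 / 2"
  using assms(2) power_strict_mono[OF assms(2,1), of 2] by linarith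

lemma class_K_inf_quad:
  assumes g: "g \<in> class_K_inf" and c: "c > 0"
  shows "(\<lambda>r. c * g r + (c * g r)\<^sup>2 / 2) \<in> class_K_inf"
proof (rule class_K_inf_real[where g = "\<lambda>r. c * g r"])
  have gK: "g \<in> class_K" by (rule class_K_inf_K[OF g])
  then show "continuous_on {0..} (\<lambda>r. c * g r + (c * g r)\<^sup>2 / 2)"
    by (auto simp: class_K_def intro!: continuous_intros)
  show "c * g 0 + (c * g 0)\<^sup>2 / 2 = 0" using class_K_zero[OF gK] by simp
  show "strict_mono_on {0..} (\<lambda>r. c * g r + (c * g r)\<^sup>2 / 2)"
  proof (rule strict_mono_onI)
    fix r s :: real assume rs: "r \<in> {0..}" "s \<in> {0..}" "r < s"
    have "strict_mono_on {0..} g" using gK by (simp add: class_K_def)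
    from strict_mono_onD[OF this rs] have "g r < g s" .
    then have "c * g r < c * g s" using c by simp
    then show "c * g r + (c * g r)\<^sup>2 / 2 < c * g s + (c * g s)\<^sup>2 / 2"
      using rs c class_K_nonneg[OF gK, of r] by (intro quad_strict_mono) auto
  qed
  show "\<not> bounded ((\<lambda>r. c * g r) ` {0..})"
  proof
    assume "bounded ((\<lambda>r. c * g r) ` {0..})"
    then have "bounded ((\<lambda>x. (1 / c) *\<^sub>R x) ` (\<lambda>r. c * g r) ` {0..})" by (rule bounded_scaling)
    then have "bounded (g ` {0..})" using c by (simp add: image_image)
    with g show False by (simp add: class_K_inf_def)
  qed
  show "c * g r \<ge> 0" if "r \<ge> 0" for r using class_K_nonneg[OF gK that] c by simp
qed auto

lemma class_K_inf_exp_sq: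
  assumes c: "c > 0"
  shows "(\<lambda>r. (exp (c * r) - 1)\<^sup>2) \<in> class_K_inf"
proof (rule class_K_inf_real[where g = "\<lambda>r. (c * r)\<^sup>2"])
  show "continuous_on {0..} (\<lambda>r. (exp (c * r) - 1)\<^sup>2)" by (intro continuous_intros)
  show "strict_mono_on {0..} (\<lambda>r. (exp (c * r) - 1)\<^sup>2)"
    by (rule strict_mono_onI) (use c in \<open>auto intro!: power_strict_mono\<close>)
  show "(c * r)\<^sup>2 \<le> (exp (c * r) - 1)\<^sup>2" if "0 \<le> r" for r
  proof (rule power_mono)
    show "c * r \<le> exp (c * r) - 1" using exp_ge_add_one_self[of "c * r"] by linarith
  qed (use c that in simp)
  show "\<not> bounded ((\<lambda>r. (c * r)\<^sup>2) ` {0..})"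
  proof
    assume "bounded ((\<lambda>r. (c * r)\<^sup>2) ` {0..})"
    then obtain B where B: "\<And>r. 0 \<le> r \<Longrightarrow> \<bar>(c * r)\<^sup>2\<bar> \<le> B" by (auto simp: bounded_iff)
    have "\<bar>(c * ((B + 1) / c))\<^sup>2\<bar> \<le> B" if "0 \<le> B" using that c by (intro B) simp
    moreover have "0 \<le> B" using B[of 0] by simp
    ultimately have "(B + 1)\<^sup>2 \<le> B" using c by simp
    moreover have "(B + 1)\<^sup>2 = B\<^sup>2 + 2 * B + 1" by (simp add: power2_eq_square algebra_simps)
    ultimately show False using \<open>0 \<le> B\<close> by (simp add: add_nonneg_pos) (smt (verit) zero_le_power2)
  qed
qed auto

lemma class_KL_quad:
  fixes k :: real
  assumes k: "k > 0" and \<tau>: "\<tau> > 0"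
  shows "(\<lambda>r t. k * 2 powr (- t / \<tau>) * r + (k * 2 powr (- t / \<tau>) * r)\<^sup>2 / 2) \<in> class_KL"
  unfolding class_KL_def
proof (intro CollectI conjI allI impI)
  fix t :: real assume "t \<ge> 0"
  have id: "(\<lambda>r. r) \<in> class_K_inf"
    by (rule class_K_inf_real[where g = "\<lambda>r. r"]) (use unbounded_id in \<open>auto intro: strict_mono_onI\<close>)
  show "(\<lambda>r. k * 2 powr (- t / \<tau>) * r + (k * 2 powr (- t / \<tau>) * r)\<^sup>2 / 2) \<in> class_K"
    by (rule class_K_inf_K, rule class_K_inf_quad[OF id]) (use k in simp)
next
  fix r :: real assume r: "r > 0"
  let ?f = "\<lambda>t. k * 2 powr (- t / \<tau>) * r"
  have dec: "?f t < ?f s" if "s < t" for s t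
  proof -
    have "- t / \<tau> < - s / \<tau>" using that \<tau> by (intro divide_strict_right_mono) auto
    then show ?thesis using k r by simp
  qed
  have lim: "(?f \<longlongrightarrow> 0) at_top"
  proof -
    have "((\<lambda>t. 2 powr (- t / \<tau>)) \<longlongrightarrow> 0) at_top"
    proof (rule tendsto_eq_rhs)
      have "filterlim (\<lambda>t. t * (ln 2 / \<tau>)) at_top at_top"
        by (rule filterlim_at_top_mult_tendsto_pos[OF tendsto_const, of "ln 2 / \<tau>", simplified mult.commute])
          (use \<tau> in \<open>auto intro: filterlim_ident\<close>)
      then have "filterlim (\<lambda>t. - (t * (ln 2 / \<tau>))) at_bot at_top" by (simp add: filterlim_uminus_at_bot)
      then have "((\<lambda>t. exp (- (t * (ln 2 / \<tau>)))) \<longlongrightarrow> 0) at_top"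
        by (rule filterlim_compose[OF exp_at_bot])
      then show "((\<lambda>t. 2 powr (- t / \<tau>)) \<longlongrightarrow> 0) at_top" by (simp add: powr_def)
    qed simp
    from tendsto_mult_left_zero[OF tendsto_mult_right_zero[OF this, of k], of r] show ?thesis .
  qed
  have "((\<lambda>t. ?f t + (?f t)\<^sup>2 / 2) \<longlongrightarrow> 0 + 0\<^sup>2 / 2) at_top" by (intro tendsto_intros lim) simp
  moreover have "continuous_on {0..} (\<lambda>t. ?f t + (?f t)\<^sup>2 / 2)"
    using \<tau> by (intro continuous_intros) auto
  moreover have "monotone_on {0..} (<) (>) (\<lambda>t. ?f t + (?f t)\<^sup>2 / 2)"
  proof (rule monotone_onI)
    fix s t :: real assume "s < t"
    from dec[OF this] show "?f s + (?f s)\<^sup>2 / 2 > ?f t + (?f t)\<^sup>2 / 2"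
      using k r by (intro quad_strict_mono) auto
  qed
  ultimately show "(\<lambda>t. ?f t + (?f t)\<^sup>2 / 2) \<in> class_L"
    using k r by (auto simp: class_L_def)
qed

text \<open>Young's inequality, applied to \<open>w * p\<close> and \<open>w * q\<close>. Writing
  the exponential factor as \<open>1 + w\<close> makes every term on the right vanish at 0, as gains
  must; it also explains the recurring shape \<open>p + p\<^sup>2 / 2\<close>.\<close>

lemma exp_product_split:
  fixes w p q :: real
  shows "(1 + w) * (p + q) \<le> (p + p\<^sup>2 / 2) + w\<^sup>2 + (q + q\<^sup>2 / 2)"
proof -
  have "0 \<le> (w - p)\<^sup>2 + (w - q)\<^sup>2" by simp
  then show ?thesis by (simp add: power2_eq_square algebra_simps)
qed

lemma Linf_norm_bound:
  assumes u: "u \<in> Linf {0..t}" and t: "t \<ge> 0"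
  shows "0 \<le> Linf_norm {0..t} u" "AE s in lebesgue_on {0..t}. norm (u s) \<le> Linf_norm {0..t} u"
proof -
  let ?e = "esssup (lebesgue_on {0..t}) (\<lambda>s. ereal (norm (u s)))"
  have fin: "?e < \<infinity>" using u by (simp add: Linf_def)
  have ae: "AE s in lebesgue_on {0..t}. ereal (norm (u s)) \<le> ?e" by (rule esssup_AE)
  show "AE s in lebesgue_on {0..t}. norm (u s) \<le> Linf_norm {0..t} u"
    using ae unfolding Linf_norm_def by eventually_elim (use fin in \<open>cases ?e, auto\<close>)
  show "0 \<le> Linf_norm {0..t} u"
  proof (cases "?e \<ge> 0")
    case True
    then show ?thesis by (simp add: Linf_norm_def real_of_ereal_pos)
  next
    \<comment> \<open>Norms are nonnegative, so a negative essential supremum means that the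
      interval is a null set, as for \<open>t = 0\<close>. Then it is \<open>-\<infinity>\<close>,
      which \<open>real_of_ereal\<close> sends to 0.\<close>
    case False
    have "?e = - \<infinity>"
    proof (rule ccontr)
      assume ne: "?e \<noteq> - \<infinity>"
      have "\<not> ereal (norm (u s)) \<le> ?e" for s
      proof
        assume "ereal (norm (u s)) \<le> ?e"
        moreover have "0 \<le> ereal (norm (u s))" by simp
        ultimately have "0 \<le> ?e" by (rule order_trans[rotated])
        with False show False ..
      qed
      with ae have "AE s in lebesgue_on {0..t}. False" by simp
      then have "emeasure (lebesgue_on {0..t}) (space (lebesgue_on {0..t})) = 0"
        by (simp only: eventually_False ae_filter_eq_bot_iff)
      then have "?e = - \<infinity>"
        by (rule esssup_zero_space) (use Linf_measurable_norm[OF _ u] in simp)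
      with ne show False ..
    qed
    then show ?thesis by (simp add: Linf_norm_def)
  qed
qed

section \<open>The gains of the bilinear system\<close>

context bilinear_system
begin

text \<open>\<open>B\<close>, \<open>\<theta>'\<close> and \<open>Q\<close> are the three summands
  of \<open>exp_product_split\<close> for \<open>w = exp (\<kappa> * r) - 1\<close> and the two
  terms of the a priori bound.\<close>

definition B where "B r t = 2 * K * 2 powr (- t / \<tau>) * r + (2 * K * 2 powr (- t / \<tau>) * r)\<^sup>2 / 2"

definition \<theta>' where "\<theta>' r = (exp (\<kappa> * r) - 1)\<^sup>2"

definition Q where "Q g = 5 * K * g + (5 * K * g)\<^sup>2 / 2" for g :: real

text \<open>Integral ISS takes \<open>G = P u2 0 t\<close>; the mixed notion takes the bound of
  \<open>P_le_Linf_norm\<close>, available because only windows of length at most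
  \<open>\<tau>\<close> are tested.\<close>

lemma solution_bound:
  assumes u1: "u1 \<in> Linf {0..t}" and u2: "u2 \<in> Linf {0..t}" and x: "solves x0 u1 u2 t x" and t: "0 \<le> t"
    and G: "\<And>a s. 0 \<le> a \<Longrightarrow> a \<le> s \<Longrightarrow> s \<le> t \<Longrightarrow> s \<le> a + \<tau> \<Longrightarrow> P u2 a s \<le> G"
  shows "norm (x t) \<le> B (norm x0) t + \<theta>' (E u1 0 t) + Q G"
proof -
  have "norm (x t) \<le> exp (\<kappa> * E u1 0 t) * (2 * K * 2 powr (- t / \<tau>) * norm x0 + 5 * K * G)"
    by (rule a_priori_bound[OF u1 u2 x G t order_refl])
  also have "\<dots> = (1 + (exp (\<kappa> * E u1 0 t) - 1)) * (2 * K * 2 powr (- t / \<tau>) * norm x0 + 5 * K * G)" by simp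
  also have "\<dots> \<le> B (norm x0) t + \<theta>' (E u1 0 t) + Q G"
    unfolding B_def \<theta>'_def Q_def by (rule exp_product_split)
  finally show ?thesis .
qed

lemma B_KL: "B \<in> class_KL"
  unfolding B_def by (rule class_KL_quad[of "2 * K" \<tau>]) (use M(1) \<tau> in auto)

lemma \<theta>'_K_inf: "\<theta>' \<in> class_K_inf"
  unfolding \<theta>'_def by (rule class_K_inf_exp_sq[OF \<kappa>_pos])

lemma Q_K_inf: "g \<in> class_K_inf \<Longrightarrow> (\<lambda>r. Q (g r)) \<in> class_K_inf"
  unfolding Q_def by (erule class_K_inf_quad) (use M(1) in simp)

lemma \<mu>1_K: "(\<lambda>r. \<mu>1 (m * r)) \<in> class_K"
  by (rule class_K_scale_arg[OF in1.\<mu> m])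

text \<open>\<open>\<mu>2\<close> is only of class K and may be bounded, so
  \<open>\<theta>2 (\<tau> * \<mu>2 r)\<close> may be bounded too; the added \<open>r\<close> makes
  the gain unbounded.\<close>

lemma ISS_gain_K_inf: "(\<lambda>r. Q (\<theta>2 (\<tau> * \<mu>2 r) + r)) \<in> class_K_inf"
proof (rule Q_K_inf, rule class_K_inf_real[where g = "\<lambda>r. r"])
  have c: "continuous_on {0..} \<theta>2" "continuous_on {0..} \<mu>2" using in2.\<theta>_K in2.\<mu> by (auto simp: class_K_def)
  have "continuous_on {0..} (\<lambda>r. \<theta>2 (\<tau> * \<mu>2 r))"
  proof (rule continuous_on_compose2[OF c(1)])
    show "continuous_on {0..} (\<lambda>r. \<tau> * \<mu>2 r)" by (intro continuous_on_mult_left c(2))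
    show "(\<lambda>r. \<tau> * \<mu>2 r) ` {0..} \<subseteq> {0..}"
    proof
      fix y assume "y \<in> (\<lambda>r. \<tau> * \<mu>2 r) ` {0..}"
      then obtain r where "0 \<le> r" "y = \<tau> * \<mu>2 r" by auto
      then show "y \<in> {0..}" using \<tau>(1) class_K_nonneg[OF in2.\<mu>, of r] by simp
    qed
  qed
  then show "continuous_on {0..} (\<lambda>r. \<theta>2 (\<tau> * \<mu>2 r) + r)" by (intro continuous_intros)
  show "\<theta>2 (\<tau> * \<mu>2 0) + 0 = 0" by (simp add: class_K_zero[OF in2.\<theta>_K] class_K_zero[OF in2.\<mu>])
  show "strict_mono_on {0..} (\<lambda>r. \<theta>2 (\<tau> * \<mu>2 r) + r)"
  proof (rule strict_mono_onI)
    fix r s :: real assume rs: "r \<in> {0..}" "s \<in> {0..}" "r < s"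
    have "\<mu>2 r \<le> \<mu>2 s" "0 \<le> \<mu>2 r" using rs by (auto intro!: class_K_mono[OF in2.\<mu>] class_K_nonneg[OF in2.\<mu>])
    then have "\<theta>2 (\<tau> * \<mu>2 r) \<le> \<theta>2 (\<tau> * \<mu>2 s)"
      using \<tau>(1) by (intro class_K_mono[OF in2.\<theta>_K] mult_left_mono) auto
    then show "\<theta>2 (\<tau> * \<mu>2 r) + r < \<theta>2 (\<tau> * \<mu>2 s) + s" using rs by simp
  qed
  show "r \<le> \<theta>2 (\<tau> * \<mu>2 r) + r" if "0 \<le> r" for r
    using class_K_nonneg[OF in2.\<theta>_K, of "\<tau> * \<mu>2 r"] class_K_nonneg[OF in2.\<mu> that] \<tau>(1) by simp
qed (use unbounded_id in auto)

text \<open>The integral is at most the window length times \<open>\<mu>2\<close> of the essential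
  supremum; capping the length by \<open>\<tau>\<close> keeps the bound from growing with the length
  of \<open>{0..t}\<close>.\<close>

lemma P_le_Linf_norm:
  assumes u2: "u2 \<in> Linf {0..t}" and t: "0 \<le> t" and a: "0 \<le> a" "a \<le> s" "s \<le> t" "s \<le> a + \<tau>"
  shows "P u2 a s \<le> \<theta>2 (\<tau> * \<mu>2 (Linf_norm {0..t} u2)) + Linf_norm {0..t} u2"
proof -
  let ?N = "Linf_norm {0..t} u2"
  note N = Linf_norm_bound[OF u2 t]
  have sub: "{a..s} \<subseteq> {0..t}" using a by auto
  have "AE r in lebesgue_on {a..s}. norm (u2 r) \<le> ?N"
    using N(2) sub by (auto simp: AE_restrict_space_iff)
  from integral_class_K_le[OF in2.\<mu> Linf_subset[OF _ _ sub u2] _ a(2) this, of 1]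
  have "(\<integral>r. \<mu>2 (norm (u2 r)) \<partial>lebesgue_on {a..s}) \<le> (s - a) * \<mu>2 ?N" by simp
  also have "\<dots> \<le> \<tau> * \<mu>2 ?N" using a(4) class_K_nonneg[OF in2.\<mu> N(1)] by (intro mult_right_mono) auto
  finally have "P u2 a s \<le> \<theta>2 (\<tau> * \<mu>2 ?N)"
    unfolding P_def
    by (intro class_K_mono[OF in2.\<theta>_K] Bochner_Integration.integral_nonneg class_K_nonneg[OF in2.\<mu>]) auto
  then show ?thesis using N(1) by simp
qed

end

section \<open>Transfer to mild solutions of the original systems\<close>

context extrapolation
begin

lemma input_map_Phi:
  fixes B :: "'u::banach \<Rightarrow>\<^sub>L 'm"
  assumes B: "linear_integral_ISS J T B"
  obtains \<theta> \<mu> where "input_map T (Phi B) \<theta> \<mu>"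
proof -
  obtain \<theta> \<mu> where *: "\<theta> \<in> class_K_inf" "\<mu> \<in> class_K" "\<forall>b. \<forall>v\<in>Linf {0..b}. continuous_on {0..b} (Phi B v) \<and> (\<forall>t\<in>{0..b}.
       bochner_has_integral (lebesgue_on {0..t}) (\<lambda>s. T1 (t - s) (B (v s))) (J (Phi B v t)) \<and>
       norm (Phi B v t) \<le> \<theta> (\<integral>s. \<mu> (norm (v s)) \<partial>lebesgue_on {0..t}))"
    using linear_iISS_Phi[OF B] by blast
  have "input_map T (Phi B) \<theta> \<mu>"
  proof (unfold_locales, goal_cases)
    case (3 t v w) then show ?case by (rule Phi_cong)
  next
    case (4 b t v w) then show ?case by (rule Phi_add[OF B])
  next
    case (5 b t v c) then show ?case by (rule Phi_scaleR[OF B])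
  next
    case (6 b t a v) then show ?case by (rule Phi_restart[OF B])
  next
    case (8 b t v) then show ?case using *(3) by auto
  qed (use * in auto)
  then show ?thesis by (rule that)
qed

text \<open>Normalising \<open>x\<close> turns the KL bound into
  \<open>norm (T t x) \<le> \<beta>' 1 t * norm x\<close>. The value at 0 gives \<open>M\<close>,
  the limit 0 gives \<open>\<tau>\<close>, and \<open>max 1\<close> ensures \<open>M \<ge> 1\<close>
  and \<open>\<tau> > 0\<close>.\<close>

lemma exponential_stability_constants:
  assumes B: "linear_integral_ISS J T B"
  obtains M \<tau> where "M \<ge> 1" "\<And>t x. t \<ge> 0 \<Longrightarrow> norm (T t x) \<le> M * norm x"
    "\<tau> > 0" "\<And>x. norm (T \<tau> x) \<le> norm x / 4" "\<And>x. continuous_on {0..} (\<lambda>t. T t x)"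
proof -
  obtain \<beta>' where KL: "\<beta>' \<in> class_KL" and bd: "\<And>x t. t \<ge> 0 \<Longrightarrow> norm (T t x) \<le> \<beta>' (norm x) t"
    and c: "\<And>x. continuous_on {0..} (\<lambda>t. T t x)"
    by (rule linear_iISS_semigroup[OF B]) blast
  have L: "(\<lambda>t. \<beta>' 1 t) \<in> class_L" using KL by (auto simp: class_KL_def)
  have bound: "norm (T t x) \<le> \<beta>' 1 t * norm x" if t: "t \<ge> 0" for t x
  proof (cases "x = 0")
    case False
    have "norm (T t ((1 / norm x) *\<^sub>R x)) \<le> \<beta>' (norm ((1 / norm x) *\<^sub>R x)) t" by (rule bd[OF t])
    then have "norm (T t x) / norm x \<le> \<beta>' 1 t" using False by (simp add: blinfun.scaleR_right)
    then show ?thesis using False by (simp add: field_simps)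
  qed simp
  have dec: "\<beta>' 1 t \<le> \<beta>' 1 0" if "t \<ge> 0" for t
    using L that by (cases "t = 0") (auto simp: class_L_def monotone_on_def intro!: less_imp_le)
  have "((\<lambda>t. \<beta>' 1 t) \<longlongrightarrow> 0) at_top" using L by (simp add: class_L_def)
  then have "\<forall>\<^sub>F t in at_top. \<beta>' 1 t < 1 / 4" by (rule order_tendstoD) simp
  then obtain \<tau>0 where \<tau>0: "\<And>t. t \<ge> \<tau>0 \<Longrightarrow> \<beta>' 1 t < 1 / 4" by (auto simp: eventually_at_top_linorder)
  show ?thesis
  proof (rule that[of "max 1 (\<beta>' 1 0)" "max 1 \<tau>0"])
    show "norm (T t x) \<le> max 1 (\<beta>' 1 0) * norm x" if "t \<ge> 0" for t x
      using dec[OF that] by (intro order_trans[OF bound[OF that]] mult_right_mono) auto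
    show "norm (T (max 1 \<tau>0) x) \<le> norm x / 4" for x
    proof -
      have "norm (T (max 1 \<tau>0) x) \<le> \<beta>' 1 (max 1 \<tau>0) * norm x" by (rule bound) simp
      also have "\<dots> \<le> (1 / 4) * norm x" using \<tau>0[of "max 1 \<tau>0"] by (intro mult_right_mono) auto
      finally show ?thesis by simp
    qed
  qed (use c in auto)
qed

lemma bilinear_stability:
  fixes B1 :: "'xb::banach \<Rightarrow>\<^sub>L 'm" and B2 :: "'u2::banach \<Rightarrow>\<^sub>L 'm" and F :: "'x \<Rightarrow> 'u1::banach \<Rightarrow> 'xb"
  assumes F1: "\<exists>m>0. \<forall>x u. norm (F x u) \<le> m * norm x * norm u"
    and F2: "\<forall>Xb. bounded Xb \<longrightarrow>
               (\<exists>L>0. \<forall>x\<in>Xb. \<forall>x'\<in>Xb. \<forall>u. norm (F x u - F x' u) \<le> L * norm u * norm (x - x'))"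
    and F3: "\<forall>I f g. is_interval I \<and> strongly_measurable (lebesgue_on I) f \<and>
               strongly_measurable (lebesgue_on I) g \<longrightarrow>
               strongly_measurable (lebesgue_on I) (\<lambda>s::real. F (f s) (g s))"
    and B1: "linear_integral_ISS J T B1" and B2: "linear_integral_ISS J T B2"
  shows "bilinear_integral_ISS J T B1 B2 F \<and> bilinear_integral_ISS_ISS J T B1 B2 F"
proof -
  obtain \<theta>1 \<mu>1 where i1: "input_map T (Phi B1) \<theta>1 \<mu>1" by (rule input_map_Phi[OF B1])
  obtain \<theta>2 \<mu>2 where i2: "input_map T (Phi B2) \<theta>2 \<mu>2" by (rule input_map_Phi[OF B2])
  obtain m where m: "m > 0" "\<And>x u. norm (F x u) \<le> m * norm x * norm u" using F1 by blast
  obtain M \<tau> where M: "M \<ge> 1" "\<And>t x. t \<ge> 0 \<Longrightarrow> norm (T t x) \<le> M * norm x"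
    "\<tau> > 0" "\<And>x. norm (T \<tau> x) \<le> norm x / 4" "\<And>x. continuous_on {0..} (\<lambda>t. T t x)"
    by (rule exponential_stability_constants[OF B1]) blast
  interpret S: bilinear_system T "Phi B1" \<theta>1 \<mu>1 "Phi B2" \<theta>2 \<mu>2 F m M \<tau>
  proof (intro bilinear_system.intro bilinear_system_axioms.intro i1 i2 T_0 T_add M m)
    show "\<exists>L>0. \<forall>x\<in>Xb. \<forall>x'\<in>Xb. \<forall>u. norm (F x u - F x' u) \<le> L * norm u * norm (x - x')" if "bounded Xb" for Xb
      using F2 that by blast
    show "strongly_measurable (lebesgue_on I) (\<lambda>s. F (f s) (g s))"
      if "is_interval I" "strongly_measurable (lebesgue_on I) f" "strongly_measurable (lebesgue_on I) g" for I :: "real set" and f g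
      using that by (intro F3[rule_format] conjI)
  qed
  have solution: "\<exists>x. unique_global_mild_solution (bilinear_mild_solution J T B1 B2 F x0 u1 u2) x \<and>
      (\<forall>b. S.solves x0 u1 u2 b x)"
    if u1: "u1 \<in> Linf {0..}" and u2: "u2 \<in> Linf {0..}" for x0 u1 u2
  proof -
    have ub: "u1 \<in> Linf {0..b}" "u2 \<in> Linf {0..b}" for b
      by (auto intro!: Linf_subset[OF _ _ _ u1] Linf_subset[OF _ _ _ u2])
    have iff: "bilinear_mild_solution J T B1 B2 F x0 u1 u2 0 b y \<longleftrightarrow> S.solves x0 u1 u2 b y" for b y
      unfolding S.solves_def S.rhs_def
      by (rule bilinear_mild_solution_iff[OF B1 B2 ub(2)]) (rule S.F_Linf[OF _ ub(1)])
    obtain x where x: "\<And>b. S.solves x0 u1 u2 b x" using S.global_solution_exists[OF u1 u2] by blast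
    have "unique_global_mild_solution (bilinear_mild_solution J T B1 B2 F x0 u1 u2) x"
      unfolding unique_global_mild_solution_def iff
    proof (intro conjI allI impI x)
      fix y t assume y: "\<forall>t1>0. S.solves x0 u1 u2 t1 y" and t: "0 \<le> (t::real)"
      show "y t = x t"
        by (rule S.solves_unique[OF ub _ x[of "t + 1"]]) (use y t in auto)
    qed
    with x show ?thesis by blast
  qed
  have ub: "u \<in> Linf {0..b}" if "u \<in> Linf {0..}" for u :: "real \<Rightarrow> 'v::real_normed_vector" and b
    by (rule Linf_subset[OF _ _ _ that]) auto
  have "bilinear_integral_ISS J T B1 B2 F"
    unfolding bilinear_integral_ISS_def
  proof (rule bexI[OF _ S.B_KL], rule bexI[OF _ S.\<theta>'_K_inf], rule bexI[OF _ S.Q_K_inf[OF S.in2.\<theta>]],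
      rule bexI[OF _ S.\<mu>1_K], rule bexI[OF _ S.in2.\<mu>], intro allI ballI)
    fix x0 and u1 :: "real \<Rightarrow> 'u1" and u2 :: "real \<Rightarrow> 'u2" assume u1: "u1 \<in> Linf {0..}" and u2: "u2 \<in> Linf {0..}"
    obtain x where x: "unique_global_mild_solution (bilinear_mild_solution J T B1 B2 F x0 u1 u2) x"
      and sol: "\<And>b. S.solves x0 u1 u2 b x" using solution[OF u1 u2] by blast
    have "norm (x t) \<le> S.B (norm x0) t + S.\<theta>' (S.E u1 0 t) + S.Q (S.P u2 0 t)" if t: "t \<ge> 0" for t
      by (rule S.solution_bound[OF ub[OF u1] ub[OF u2] sol t]) (auto intro: S.P_mono[OF ub[OF u2]])
    with x show "\<exists>x. unique_global_mild_solution (bilinear_mild_solution J T B1 B2 F x0 u1 u2) x \<and>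
        (\<forall>t\<ge>0. norm (x t) \<le> S.B (norm x0) t
           + S.\<theta>' (\<integral>s. \<mu>1 (m * norm (u1 s)) \<partial>lebesgue_on {0..t})
           + S.Q (\<theta>2 (\<integral>s. \<mu>2 (norm (u2 s)) \<partial>lebesgue_on {0..t})))"
      unfolding S.E_def S.P_def by blast
  qed
  moreover have "bilinear_integral_ISS_ISS J T B1 B2 F"
    unfolding bilinear_integral_ISS_ISS_def
  proof (rule bexI[OF _ S.B_KL], rule bexI[OF _ S.\<theta>'_K_inf], rule bexI[OF _ S.ISS_gain_K_inf],
      rule bexI[OF _ S.\<mu>1_K], intro allI ballI)
    fix x0 and u1 :: "real \<Rightarrow> 'u1" and u2 :: "real \<Rightarrow> 'u2" assume u1: "u1 \<in> Linf {0..}" and u2: "u2 \<in> Linf {0..}"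
    obtain x where x: "unique_global_mild_solution (bilinear_mild_solution J T B1 B2 F x0 u1 u2) x"
      and sol: "\<And>b. S.solves x0 u1 u2 b x" using solution[OF u1 u2] by blast
    have "norm (x t) \<le> S.B (norm x0) t + S.\<theta>' (S.E u1 0 t) +
        S.Q (\<theta>2 (\<tau> * \<mu>2 (Linf_norm {0..t} u2)) + Linf_norm {0..t} u2)" if t: "t \<ge> 0" for t
      by (rule S.solution_bound[OF ub[OF u1] ub[OF u2] sol t]) (rule S.P_le_Linf_norm[OF ub[OF u2] t])
    with x show "\<exists>x. unique_global_mild_solution (bilinear_mild_solution J T B1 B2 F x0 u1 u2) x \<and>
        (\<forall>t\<ge>0. norm (x t) \<le> S.B (norm x0) t
           + S.\<theta>' (\<integral>s. \<mu>1 (m * norm (u1 s)) \<partial>lebesgue_on {0..t})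
           + S.Q (\<theta>2 (\<tau> * \<mu>2 (Linf_norm {0..t} u2)) + Linf_norm {0..t} u2))"
      unfolding S.E_def by blast
  qed
  ultimately show ?thesis ..
qed

end

text \<open>For \<open>u1 = 0\<close> the nonlinear term vanishes identically, so both equations
  have the same mild solutions, and the gain of the first input contributes 0.\<close>

lemma linear_of_bilinear_integral_ISS:
  fixes B1 :: "'xb::banach \<Rightarrow>\<^sub>L 'm::banach" and B2 :: "'u2::banach \<Rightarrow>\<^sub>L 'm" and F :: "'x::banach \<Rightarrow> 'u1::banach \<Rightarrow> 'xb"
  assumes F0: "\<And>x. F x 0 = 0" and iISS: "bilinear_integral_ISS J T B1 B2 F"
  shows "linear_integral_ISS J T B2"
proof -
  obtain \<beta> \<theta>1 \<theta>2 \<mu>1 \<mu>2 where b: "\<beta> \<in> class_KL" "\<theta>1 \<in> class_K_inf" "\<theta>2 \<in> class_K_inf" "\<mu>1 \<in> class_K" "\<mu>2 \<in> class_K"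
    and ex: "\<forall>x0. \<forall>u1\<in>Linf {0..}. \<forall>u2\<in>Linf {0..}.
          \<exists>x. unique_global_mild_solution (bilinear_mild_solution J T B1 B2 F x0 u1 u2) x \<and>
              (\<forall>t\<ge>0. norm (x t) \<le> \<beta> (norm x0) t
                 + \<theta>1 (\<integral>s. \<mu>1 (norm (u1 s)) \<partial>lebesgue_on {0..t})
                 + \<theta>2 (\<integral>s. \<mu>2 (norm (u2 s)) \<partial>lebesgue_on {0..t}))"
    using iISS unfolding bilinear_integral_ISS_def by blast
  have eq: "bilinear_mild_solution J T B1 B2 F x0 (\<lambda>s. 0) u2 = linear_mild_solution J T B2 x0 u2" for x0 u2
    by (intro ext) (simp add: bilinear_mild_solution_def linear_mild_solution_def F0)
  have 0: "(\<lambda>s. 0 :: 'u1) \<in> Linf {0..}" by (rule Linf_zero) simp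
  show ?thesis
    unfolding linear_integral_ISS_def
  proof (rule bexI[OF _ b(1)], rule bexI[OF _ b(3)], rule bexI[OF _ b(5)], intro allI ballI)
    fix x0 :: 'x and u :: "real \<Rightarrow> 'u2" assume u: "u \<in> Linf {0..}"
    from bspec[OF bspec[OF spec[OF ex, of x0] 0] u]
    show "\<exists>x. unique_global_mild_solution (linear_mild_solution J T B2 x0 u) x \<and>
              (\<forall>t\<ge>0. norm (x t) \<le> \<beta> (norm x0) t
                 + \<theta>2 (\<integral>s. \<mu>2 (norm (u s)) \<partial>lebesgue_on {0..t}))"
      by (simp add: eq class_K_zero[OF b(4)] class_K_zero[OF class_K_inf_K[OF b(2)]])
  qed
qed

theorem theorem2p9:
  fixes D :: "'x::banach set" and A :: "'x \<Rightarrow> 'x" and T :: "real \<Rightarrow> 'x \<Rightarrow>\<^sub>L 'x"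
    and \<beta> :: real and J :: "'x \<Rightarrow> 'm::banach"
    and B1 :: "'xb::banach \<Rightarrow>\<^sub>L 'm" and B2 :: "'u2::banach \<Rightarrow>\<^sub>L 'm"
    and F :: "'x \<Rightarrow> 'u1::banach \<Rightarrow> 'xb"
  assumes gen: "generates_C0_semigroup D A T"
    and extrapolation: "extrapolation_space D A \<beta> J"
    and F1: "\<exists>m>0. \<forall>x u. norm (F x u) \<le> m * norm x * norm u"
    and F2: "\<forall>Xb. bounded Xb \<longrightarrow>
               (\<exists>L>0. \<forall>x\<in>Xb. \<forall>x'\<in>Xb. \<forall>u. norm (F x u - F x' u) \<le> L * norm u * norm (x - x'))"
    and F3: "\<forall>I f g. is_interval I \<and> strongly_measurable (lebesgue_on I) f \<and>
               strongly_measurable (lebesgue_on I) g \<longrightarrow>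
               strongly_measurable (lebesgue_on I) (\<lambda>s::real. F (f s) (g s))"
  shows "(linear_integral_ISS J T B1 \<and> linear_integral_ISS J T B2 \<longrightarrow>
            bilinear_integral_ISS J T B1 B2 F \<and> bilinear_integral_ISS_ISS J T B1 B2 F) \<and>
         (bilinear_integral_ISS J T B1 B2 F \<longrightarrow> linear_integral_ISS J T B2)"
proof -
  interpret extrapolation D A T \<beta> J
    using gen extrapolation by unfold_locales
  have "F x 0 = 0" for x using F1 by (metis mult_zero_right norm_le_zero_iff norm_zero)
  then show ?thesis
    using bilinear_stability[OF F1 F2 F3] linear_of_bilinear_integral_ISS by blast
qed

end
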